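(* Fix $q\in\mathbb{N}$, $q\ge 2$, and let the random triple $(J,\bm{K}_J,\bm{\theta})$ be the hierarchical spline prior described in the context, satisfying the following prior conditions, with constants $c_1,c_2,c_3>0$, $0\le t_1,t_2,t_3\le 1$, $\tau\ge 1$ and a strictly decreasing function $\delta:\mathbb{N}\to(0,1]$. (P1) For all sufficiently large $j$: $\mathbb{P}(J>j)\lesssim \exp(-c_1 j\log^{t_1}j)$. (P2) For all sufficiently large $j$: $\mathbb{P}(J=j)\gtrsim\exp(-c_2 j\log^{t_2}j)$. (P3) For all $j\ge q$: $\mathbb{P}(m(\bm{K}_j)<\delta(j)\mid J=j)=0$. (P4) For all $j\ge q$: $\mathbb{P}(M(\bm{K}_j)\le \tau/j\mid J=j)\gtrsim\exp(-c_3 j\log^{t_3}j)$. (P5) For every $M>0$ there exists $c_0=c_0(M)$ such that for each $j\ge q$, $\mathbb{P}(\|\bm{\theta}-\bm{\theta}_0\|_\infty\le\epsilon\mid J=j)\gtrsim\exp(-c_0\, j\log(1/\epsilon))$ for all sufficiently small $\epsilon>0$ and all $\bm{\theta}_0\in\mathbb{R}^j$ with $\|\bm{\theta}_0\|_\infty\le M$. Let $\alpha>0$, $M>0$, and let $f_0\in\mathcal{F}_\alpha$ with $\|f_0\|_\infty<M$; let $C_{f_0}$ be a constant such that for every set of inner knots $\bm{k}$ there is $s_{\bm{a},\bm{k}}\in\mathcal{S}^{\bm{k}}_q$ with $\|f_0-s_{\bm{a},\bm{k}}\|_\infty\le C_{f_0}M^\alpha(\bm{k})$. Let $\epsilon_n,\bar\epsilon_n$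 be two positive sequences such that $\epsilon_n\ge\bar\epsilon_n$, $\epsilon_n\to 0$ as $n\to\infty$, and $n\bar\epsilon_n^2>1$. Assume that there exist integer sequences $J_n,\bar J_n>q$, a sequence $M_n>0$ and a constant $c_M\ge c_1$ satisfying $$J_n\log\Big[\frac{J_n(M_n\vee 1)}{\epsilon_n\,\delta(J_n)}\Big]\lesssim n\epsilon_n^2,$$ $$\frac{n\bar\epsilon_n^2}{\log^{t_1}J_n}\le J_n,\qquad \mathbb{P}\big(\bm{\theta}\notin[-M_n,M_n]^j\mid J=j\big)\lesssim\exp(-c_M n\bar\epsilon_n^2)\ \text{ for } q\le j\le J_n,$$ $$\Big[\frac{\bar\epsilon_n}{\tau^\alpha C_{f_0}}\Big]^{-1/\alpha}\le\bar J_n,\qquad \log^{t_2\vee t_3}\bar J_n\lesssim\log\frac{1}{\bar\epsilon_n}.$$ Let $$\mathcal{S}_n=\bigcup_{j=q}^{J_n}\ \bigcup_{\bm{k}\in\mathcal{K}_j^{\delta(j)}}\big\{s_{\bm{\theta},\bm{k}}\in\mathcal{S}_q^{\bm{k}}:\|\bm{\theta}\|_\infty\le M_n\big\},\qquad \mathcal{K}_j^{\delta}=\{\bm{k}\in\mathcal{K}_j: m(\bm{k})>\delta\}.$$ Then $$\log N(\epsilon_n,\mathcal{S}_n,\|\cdot\|_2)\lesssim n\epsilon_n^2,$$ $$\mathbb{P}\big(s_{\bm{\theta},\bm{K}_J}\notin\mathcal{S}_n\big)\lesssim\exp(-c_1 n\bar\epsilon_n^2),$$ $$\mathbb{P}\big(\|s_{\bm{\theta},\bm{K}_J}-f_0\|_\infty\le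 2\bar\epsilon_n\big)\gtrsim\exp\big\{-(c_0(M)+c_2+c_3)\,\bar J_n\log(1/\bar\epsilon_n)\big\}.$$
   Context: Notation. $\lesssim$ (resp. $\gtrsim$) means smaller (resp. greater) than or equal up to a positive multiplicative constant; the constant does not depend on the running quantities ($n$, $j$, $\epsilon$, $\bm{\theta}_0$), and relations involving $n$ are understood for all sufficiently large $n$. $a\vee b=\max\{a,b\}$. For vectors, $\|\bm{x}\|_\infty=\max_i|x_i|$. For functions on $[0,1]$, $\|f\|_2=(\int_0^1|f|^2dx)^{1/2}$ and $\|f\|_\infty=\sup_{x\in[0,1]}|f(x)|$. $N(\epsilon,S,d)$ is the smallest number of $d$-balls of radius $\epsilon$ needed to cover $S$. Splines. The order $q\ge2$ is fixed. For an integer $j\ge q$, $\mathcal{K}_j=\{(k_1,\dots,k_{j-q})\in(0,1)^{j-q}:0<k_1<\dots<k_{j-q}<1\}$; its elements are called sets of inner knots. Put $k_0=0$, $k_{j-q+1}=1$. The mesh size is $M(\bm{k})=\max_{1\le i\le j-q+1}|k_i-k_{i-1}|$ and the sparseness is $m(\bm{k})=\min_{1\le i\le j-q+1}|k_i-k_{i-1}|$. (The mesh size $M(\cdot)$ and the scalar bound $M$ are different objects.) $\mathcal{S}^{\bm{k}}=\mathcal{S}^{\bm{k}}_q$ is the $j$-dimensional linear space of splines of order $q$ on $[0,1]$ with simple inner knots $\bm{k}$, i.e. functions that are $q-2$ times continuously differentiable and coincide with a polynomial of degree at most $q-1$ on each interval of the partition $[k_0,k_1),[k_1,k_2),\dots,[k_{j-q},k_{j-q+1}]$.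 $\{B_1^{\bm{k}},\dots,B_j^{\bm{k}}\}$ is its (normalized) B-spline basis, built with the extra knots $k_{-q+1}=\dots=k_{-1}=k_0=0$ and $1=k_{j-q+1}=\dots=k_j$; these functions are nonnegative, $B_i^{\bm{k}}$ vanishes outside $[k_{i-q},k_i]$, and $\sum_{i=1}^jB_i^{\bm{k}}\equiv1$ on $[0,1]$. For $\bm{a}\in\mathbb{R}^j$, $s_{\bm{a},\bm{k}}=\sum_{i=1}^ja_iB_i^{\bm{k}}$. Smoothness class. $\mathcal{F}_\alpha$ ($\alpha>0$) denotes a generic class of functions on $[0,1]$ such that (i) for every $f\in\mathcal{F}_\alpha$ there is a finite constant $C_f$ such that for every set of inner knots $\bm{k}$ there is a spline $s_{\bm{a},\bm{k}}\in\mathcal{S}^{\bm{k}}_q$ with $\|f-s_{\bm{a},\bm{k}}\|_\infty\le C_fM^\alpha(\bm{k})$; and (ii) for some $\kappa_\alpha,L_\alpha>0$, every $f\in\mathcal{F}_\alpha$ satisfies $|f(x_1)-f(x_2)|\le L_\alpha|x_1-x_2|^{\kappa_\alpha}$ for all $x_1,x_2\in[0,1]$. Hierarchical spline prior. Draw an integer $J\ge q$; given $J=j$, draw independently a random set of inner knots $\bm{K}_j\in\mathcal{K}_j$ and a random coefficient vector $\bm{\theta}\in\mathbb{R}^j$ (so $\bm{K}_j$ and $\bm{\theta}$ are conditionally independent given $J=j$). The prior is the law of the random spline $s_{\bm{\theta},\bm{K}_J}$ on $\bigcup_{j\ge q}\bigcup_{\bm{k}\in\mathcal{K}_j}\ma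thcal{S}_q^{\bm{k}}$.
   Formalization: The sieve uses knots with m(k) ≥ δ instead of m(k) > δ, since with strict inequality the second conclusion fails (equidistant knots with m(K_j) = δ(j)); in (P5) the threshold for "sufficiently small ε" is taken uniform in j and θ_0. *)

theory Defs
  imports "HOL-Probability.Probability"
begin

text \<open>
  Conventions. A vector in \<open>\<real>\<^sup>j\<close> is an element of \<open>{1..j} \<rightarrow>\<^sub>E UNIV\<close>, so that random vectors are
  measurable maps into \<open>Pi\<^sub>M {1..j} (\<lambda>_. borel)\<close>. Splines and other functions on \<open>[0,1]\<close> are
  functions \<open>real \<Rightarrow> real\<close> of which only the values on \<open>[0,1]\<close> matter; splines vanish outside
  \<open>[0,1]\<close>, so two of them are equal as soon as they agree on \<open>[0,1]\<close>.
\<close>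

definition inner_knots :: "nat \<Rightarrow> nat \<Rightarrow> (nat \<Rightarrow> real) set" where
  "inner_knots q j = {k \<in> {1..j - q} \<rightarrow>\<^sub>E {0<..<1}. strict_mono_on {1..j - q} k}"

text \<open>
  The full knot sequence \<open>0 = k\<^sub>-\<^sub>q\<^sub>+\<^sub>1 = \<dots> = k\<^sub>0 < k\<^sub>1 < \<dots> < k\<^sub>j\<^sub>-\<^sub>q < k\<^sub>j\<^sub>-\<^sub>q\<^sub>+\<^sub>1 = \<dots> = k\<^sub>j = 1\<close>,
  indexed by the integers.
\<close>
definition full_knots :: "nat \<Rightarrow> nat \<Rightarrow> (nat \<Rightarrow> real) \<Rightarrow> int \<Rightarrow> real" where
  "full_knots q j k i =
     (if i \<le> 0 then 0 else if i \<le> int j - int q then k (nat i) else 1)"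

definition mesh_size :: "nat \<Rightarrow> nat \<Rightarrow> (nat \<Rightarrow> real) \<Rightarrow> real" where
  "mesh_size q j k =
     (MAX i\<in>{1..int j - int q + 1}. \<bar>full_knots q j k i - full_knots q j k (i - 1)\<bar>)"

definition sparseness :: "nat \<Rightarrow> nat \<Rightarrow> (nat \<Rightarrow> real) \<Rightarrow> real" where
  "sparseness q j k =
     (MIN i\<in>{1..int j - int q + 1}. \<bar>full_knots q j k i - full_knots q j k (i - 1)\<bar>)"

text \<open>
  \<open>bspline t d i\<close> is the normalized B-spline of degree \<open>d\<close> (order \<open>d + 1\<close>) with support
  \<open>[t (i - d - 1), t i]\<close>, given by the Cox--de Boor recursion. Division by zero being zero yields
  the usual convention for coinciding knots. The last nondegenerate knot interval is closed at
  the right endpoint 1, so that the B-splines also sum to one there.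
\<close>
primrec bspline :: "(int \<Rightarrow> real) \<Rightarrow> nat \<Rightarrow> int \<Rightarrow> real \<Rightarrow> real" where
  "bspline t 0 i x =
     (if t (i - 1) \<le> x \<and> x < t i \<or> t (i - 1) < t i \<and> t i = 1 \<and> x = 1 then 1 else 0)"
| "bspline t (Suc d) i x =
     (x - t (i - int d - 2)) / (t (i - 1) - t (i - int d - 2)) * bspline t d (i - 1) x
   + (t i - x) / (t i - t (i - int d - 1)) * bspline t d i x"

definition spline :: "nat \<Rightarrow> nat \<Rightarrow> (nat \<Rightarrow> real) \<Rightarrow> (nat \<Rightarrow> real) \<Rightarrow> real \<Rightarrow> real" where
  "spline q j a k = (\<lambda>x. \<Sum>i = 1..j. a i * bspline (full_knots q j k) (q - 1) (int i) x)"

definition vec_norm_inf :: "nat \<Rightarrow> (nat \<Rightarrow> real) \<Rightarrow> real" where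
  "vec_norm_inf j x = (MAX i\<in>{1..j}. \<bar>x i\<bar>)"

text \<open>Only meaningful for functions that are bounded on \<open>[0,1]\<close>.\<close>
definition sup_norm :: "(real \<Rightarrow> real) \<Rightarrow> real" where
  "sup_norm f = (SUP x\<in>{0..1}. \<bar>f x\<bar>)"

definition l2_norm :: "(real \<Rightarrow> real) \<Rightarrow> real" where
  "l2_norm f = sqrt (LINT x:{0..1}|lborel. \<bar>f x\<bar>\<^sup>2)"

definition l2_dist :: "(real \<Rightarrow> real) \<Rightarrow> (real \<Rightarrow> real) \<Rightarrow> real" where
  "l2_dist f g = l2_norm (\<lambda>x. f x - g x)"

definition l2_functions :: "(real \<Rightarrow> real) set" where
  "l2_functions = {f. set_borel_measurable lborel {0..1} f \<and>
                      set_integrable lborel {0..1} (\<lambda>x. \<bar>f x\<bar>\<^sup>2)}"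

text \<open>
  Least number of \<open>d\<close>-balls of radius \<open>\<epsilon>\<close> with centres in the ambient space \<open>X\<close> that cover \<open>S\<close>;
  it is \<open>\<infinity>\<close> if there is no finite cover.
\<close>
definition covering_number ::
    "'a set \<Rightarrow> ('a \<Rightarrow> 'a \<Rightarrow> real) \<Rightarrow> real \<Rightarrow> 'a set \<Rightarrow> enat" where
  "covering_number X d \<epsilon> S =
     (INF C\<in>{C. finite C \<and> C \<subseteq> X \<and> S \<subseteq> (\<Union>c\<in>C. {f \<in> X. d c f < \<epsilon>})}. enat (card C))"

text \<open>\<open>C\<close> is an admissible constant \<open>C\<^sub>f\<close> for the spline approximation of \<open>f\<close> at rate \<open>\<alpha>\<close>.\<close>
definition spline_approx_const :: "nat \<Rightarrow> real \<Rightarrow> (real \<Rightarrow> real) \<Rightarrow> real \<Rightarrow> bool" where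
  "spline_approx_const q \<alpha> f C \<longleftrightarrow>
     (\<forall>j\<ge>q. \<forall>k\<in>inner_knots q j. \<exists>a\<in>{1..j} \<rightarrow>\<^sub>E UNIV.
        sup_norm (\<lambda>x. f x - spline q j a k x) \<le> C * mesh_size q j k powr \<alpha>)"

definition smoothness_class :: "nat \<Rightarrow> real \<Rightarrow> (real \<Rightarrow> real) set \<Rightarrow> bool" where
  "smoothness_class q \<alpha> F \<longleftrightarrow>
     (\<forall>f\<in>F. \<exists>C. spline_approx_const q \<alpha> f C) \<and>
     (\<exists>\<kappa>>0. \<exists>L>0. \<forall>f\<in>F. \<forall>x\<in>{0..1}. \<forall>y\<in>{0..1}. \<bar>f x - f y\<bar> \<le> L * \<bar>x - y\<bar> powr \<kappa>)"

text \<open>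
  The hierarchical prior: \<open>K j\<close> and \<open>\<Theta> j\<close> are the random knots and coefficients of a spline of
  dimension \<open>j\<close>; they are only used on the event \<open>J = j\<close>. The last clause is conditional
  independence given \<open>J = j\<close>.
\<close>
definition hierarchical_spline_prior ::
    "nat \<Rightarrow> 'w measure \<Rightarrow> ('w \<Rightarrow> nat) \<Rightarrow> (nat \<Rightarrow> 'w \<Rightarrow> nat \<Rightarrow> real) \<Rightarrow>
     (nat \<Rightarrow> 'w \<Rightarrow> nat \<Rightarrow> real) \<Rightarrow> bool" where
  "hierarchical_spline_prior q \<Omega> J K \<Theta> \<longleftrightarrow>
     prob_space \<Omega> \<and>
     J \<in> measurable \<Omega> (count_space UNIV) \<and>
     (\<forall>\<omega>\<in>space \<Omega>. q \<le> J \<omega>) \<and>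
     (\<forall>j\<ge>q. K j \<in> measurable \<Omega> (Pi\<^sub>M {1..j - q} (\<lambda>_. borel))) \<and>
     (\<forall>j\<ge>q. \<forall>\<omega>\<in>space \<Omega>. J \<omega> = j \<longrightarrow> K j \<omega> \<in> inner_knots q j) \<and>
     (\<forall>j\<ge>q. \<Theta> j \<in> measurable \<Omega> (Pi\<^sub>M {1..j} (\<lambda>_. borel))) \<and>
     (\<forall>j\<ge>q. \<forall>A\<in>sets (Pi\<^sub>M {1..j - q} (\<lambda>_. borel)). \<forall>B\<in>sets (Pi\<^sub>M {1..j} (\<lambda>_. borel)).
        \<P>(\<omega> in \<Omega>. K j \<omega> \<in> A \<and> \<Theta> j \<omega> \<in> B \<bar> J \<omega> = j) =
        \<P>(\<omega> in \<Omega>. K j \<omega> \<in> A \<bar> J \<omega> = j) * \<P>(\<omega> in \<Omega>. \<Theta> j \<omega> \<in> B \<bar> J \<omega> = j))"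

definition random_spline ::
    "nat \<Rightarrow> ('w \<Rightarrow> nat) \<Rightarrow> (nat \<Rightarrow> 'w \<Rightarrow> nat \<Rightarrow> real) \<Rightarrow> (nat \<Rightarrow> 'w \<Rightarrow> nat \<Rightarrow> real) \<Rightarrow>
     'w \<Rightarrow> real \<Rightarrow> real" where
  "random_spline q J K \<Theta> \<omega> = spline q (J \<omega>) (\<Theta> (J \<omega>) \<omega>) (K (J \<omega>) \<omega>)"

text \<open>
  The inequality is non-strict, so as to match a prior condition that only excludes knots of
  sparseness strictly below \<open>\<delta>\<close>: with a strict inequality here, knots of sparseness exactly \<open>\<delta>\<close>
  could carry all of the prior mass and yet be left out of the sieve.
\<close>
definition sparse_knots :: "nat \<Rightarrow> nat \<Rightarrow> real \<Rightarrow> (nat \<Rightarrow> real) set" where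
  "sparse_knots q j \<delta> = {k \<in> inner_knots q j. sparseness q j k \<ge> \<delta>}"

definition spline_sieve :: "nat \<Rightarrow> (nat \<Rightarrow> real) \<Rightarrow> nat \<Rightarrow> real \<Rightarrow> (real \<Rightarrow> real) set" where
  "spline_sieve q \<delta> j\<^sub>m\<^sub>a\<^sub>x m =
     (\<Union>j\<in>{q..j\<^sub>m\<^sub>a\<^sub>x}. \<Union>k\<in>sparse_knots q j (\<delta> j).
        {spline q j \<theta> k | \<theta>. \<theta> \<in> {1..j} \<rightarrow>\<^sub>E UNIV \<and> vec_norm_inf j \<theta> \<le> m})"

end

theory Submission
  imports Defs "HOL-Real_Asymp.Real_Asymp"
begin

text \<open>
  Entropy: away from the knots, B-splines depend on \<open>\<delta>\<close>-separated knots in a Lipschitz way, with a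
  constant polynomial in \<open>1 / \<delta>\<close>, and the exceptional set has small measure. Hence splines whose
  knots and coefficients share the same rounded values are \<open>L\<^sup>2\<close>-close, and it suffices to count the
  rounded values.

  Small balls: the prior of a ball around \<open>f0\<close> is bounded below by that of the splines of one fixed
  dimension with fine knots and coefficients close to those of an approximating spline. The prior
  condition on the coefficients applies only if the latter are bounded by the same \<open>M\<close> as \<open>f0\<close>.
  This holds for fine knots: each coefficient of a spline is an average with signed weights of total
  mass one, bounded independently of the knots, of values of the spline on a single knot interval,
  and \<open>f0\<close> is uniformly continuous. The weights come from Marsden's identity.
\<close>

section \<open>B-splines and Marsden's identity\<close>

text \<open>The small-ball bound has to come out with the exponent \<open>c0 M + c2 + c3\<close> and
  no further factor. Mere stability of the B-spline basis would bound the coefficients by a multiple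
  of \<open>M\<close> and yield \<open>c0\<close> at that multiple; the strict inequality
  \<open>sup_norm f0 < M\<close> is the room that prevents this. For the same reason the dimension
  must be chosen with care: the logarithm of a dimension of order
  \<open>\<epsilon>' n powr (- 1 / \<alpha>)\<close> is about \<open>1 / \<alpha>\<close> times
  \<open>ln (1 / \<epsilon>' n)\<close>, so that for \<alpha> < 1 the costs in \<open>P2\<close> and
  \<open>P4\<close> could exceed the target. The gap between the approximation error and the radius
  \<open>2 * \<epsilon>' n\<close> pays for a smaller dimension. Condition \<open>P4\<close>
  controls the largest knot gap only, so the weights must be bounded without any condition on the
  ratio of gaps; this is why they live on the longest interval in the support of a B-spline. In the
  entropy bound, a net of rounded knots would not do, since rounding can destroy the separation on
  which the Lipschitz estimate rests. Splines are grouped by rounded data instead, and a member of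
  each group is its centre.\<close>

definition in_cell :: "(int \<Rightarrow> real) \<Rightarrow> int \<Rightarrow> real \<Rightarrow> bool" where
  "in_cell t l x \<longleftrightarrow> t (l - 1) < t l \<and> t (l - 1) \<le> x \<and> x \<le> t l \<and>
     (\<forall>i. bspline t 0 i x = (if i = l then 1 else 0))"

text \<open>\<open>in_cell\<close> is phrased through the degree 0 B-splines because at
  \<open>x = 1\<close> the active cell is closed on the right. This rule covers the points below a
  right end: there \<open>x < t l\<close> and \<open>t l \<le> 1\<close>, so the endpoint clause of
  \<open>bspline\<close> cannot fire.\<close>

lemma in_cellI:
  assumes "mono t" "t (l - 1) \<le> x" "x < t l" and top: "\<And>i. t i \<le> 1"
  shows "in_cell t l x"
proof -
  have "x < 1" using assms(3) top[of l] by simp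
  have "bspline t 0 i x = (if i = l then 1 else 0)" for i
  proof (cases i l rule: linorder_cases)
    case less
    then have "t i \<le> t (l - 1)" using assms(1) by (simp add: monoD)
    then show ?thesis using less assms \<open>x < 1\<close> by auto
  next
    case equal
    then show ?thesis using assms by simp
  next
    case greater
    then have "t l \<le> t (i - 1)" using assms(1) by (simp add: monoD)
    then show ?thesis using greater assms \<open>x < 1\<close> by auto
  qed
  then show ?thesis using assms by (auto simp: in_cell_def)
qed

lemma bspline_outside_cell:
  assumes "in_cell t l x" "i < l \<or> l + int d < i"
  shows "bspline t d i x = 0"
  using assms(2)
proof (induction d arbitrary: i)
  case 0
  then show ?case using assms(1) by (auto simp: in_cell_def)
next
  case (Suc d)
  then show ?case by (auto simp del: bspline.simps(1))
qed

text \<open>Wherever a weight of the recursion could be negative, the B-spline that it multiplies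
  vanishes.\<close>

lemma bspline_nonneg:
  assumes "mono t" "in_cell t l x"
  shows "0 \<le> bspline t d i x"
proof (induction d arbitrary: i)
  case 0
  then show ?case using assms(2) by (auto simp: in_cell_def)
next
  case (Suc d)
  have cell: "t (l - 1) \<le> x" "x \<le> t l" using assms(2) by (auto simp: in_cell_def)
  have "0 \<le> (x - t (i - int d - 2)) / (t (i - 1) - t (i - int d - 2)) * bspline t d (i - 1) x"
  proof (cases "l \<le> i - 1 \<and> i - 1 \<le> l + int d")
    case True
    then have "t (i - int d - 2) \<le> t (l - 1)" "t (i - int d - 2) \<le> t (i - 1)"
      using assms(1) by (auto intro: monoD)
    then show ?thesis using Suc cell by simp
  qed (use bspline_outside_cell[OF assms(2), of "i - 1" d] in auto)
  moreover have "0 \<le> (t i - x) / (t i - t (i - int d - 1)) * bspline t d i x"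
  proof (cases "l \<le> i \<and> i \<le> l + int d")
    case True
    then have "t l \<le> t i" "t (i - int d - 1) \<le> t i"
      using assms(1) by (auto intro: monoD)
    then show ?thesis using Suc cell by simp
  qed (use bspline_outside_cell[OF assms(2), of i d] in auto)
  ultimately show ?case by simp
qed

text \<open>One step of de Boor's algorithm: the recursion for B-splines read as a recursion for
  coefficients. The coefficients \<open>b\<close> are averages of neighbouring \<open>a\<close>,
  given in multiplied-out form to avoid division. The outermost terms drop out because their
  B-splines vanish on the cell.\<close>

lemma bspline_sum_Suc:
  fixes a :: "int \<Rightarrow> real"
  assumes "mono t" "in_cell t l x"
    and b: "\<And>m. m \<le> d \<Longrightarrow>
      (t (l + int m) - x) * a (l + int m) + (x - t (l + int m - int d - 1)) * a (l + int m + 1)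
        = (t (l + int m) - t (l + int m - int d - 1)) * b (l + int m)"
  shows "(\<Sum>m\<le>Suc d. a (l + int m) * bspline t (Suc d) (l + int m) x)
       = (\<Sum>m\<le>d. b (l + int m) * bspline t d (l + int m) x)"
proof -
  define f where "f m = a (l + int m) * ((x - t (l + int m - int d - 2)) /
    (t (l + int m - 1) - t (l + int m - int d - 2))) * bspline t d (l + int m - 1) x" for m
  define g where "g m = a (l + int m) * ((t (l + int m) - x) /
    (t (l + int m) - t (l + int m - int d - 1))) * bspline t d (l + int m) x" for m
  have "(\<Sum>m\<le>Suc d. a (l + int m) * bspline t (Suc d) (l + int m) x) = (\<Sum>m\<le>Suc d. f m + g m)"
    by (simp add: f_def g_def algebra_simps del: sum.atMost_Suc)
  also have "\<dots> = (\<Sum>m\<le>Suc d. f m) + (\<Sum>m\<le>Suc d. g m)" by (rule sum.distrib)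
  also have "(\<Sum>m\<le>Suc d. f m) = f 0 + (\<Sum>m\<le>d. f (Suc m))" by (rule sum.atMost_Suc_shift)
  also have "f 0 = 0" unfolding f_def using bspline_outside_cell[OF assms(2), of "l - 1" d] by simp
  also have "(\<Sum>m\<le>Suc d. g m) = (\<Sum>m\<le>d. g m)"
    using bspline_outside_cell[OF assms(2), of "l + int (Suc d)" d] by (simp add: g_def)
  also have "0 + (\<Sum>m\<le>d. f (Suc m)) + (\<Sum>m\<le>d. g m) = (\<Sum>m\<le>d. f (Suc m) + g m)"
    by (simp add: sum.distrib)
  also have "\<dots> = (\<Sum>m\<le>d. b (l + int m) * bspline t d (l + int m) x)"
  proof (rule sum.cong[OF refl])
    fix m assume "m \<in> {..d}"
    then have m: "m \<le> d" by simp
    \<comment> \<open>The interval from index \<open>l + m - d - 1\<close> to index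
      \<open>l + m\<close> contains the cell \<open>l\<close>, so the denominator is positive even
      if knots coincide.\<close>
    have "t l \<le> t (l + int m)" "t (l + int m - int d - 1) \<le> t (l - 1)"
      using assms(1) m by (auto intro: monoD)
    then have pos: "t (l + int m) - t (l + int m - int d - 1) > 0"
      using assms(2) by (auto simp: in_cell_def)
    have "f (Suc m) + g m = ((t (l + int m) - x) * a (l + int m) + (x - t (l + int m - int d - 1)) * a (l + int m + 1))
      / (t (l + int m) - t (l + int m - int d - 1)) * bspline t d (l + int m) x"
      by (simp add: f_def g_def algebra_simps add_divide_distrib diff_divide_distrib)
    then show "f (Suc m) + g m = b (l + int m) * bspline t d (l + int m) x"
      using b[OF m] pos by simp
  qed
  finally show ?thesis .
qed

lemma bspline_partition_of_unity:
  assumes "mono t" "in_cell t l x"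
  shows "(\<Sum>m\<le>d. bspline t d (l + int m) x) = 1"
proof (induction d)
  case 0
  then show ?case using assms(2) by (simp add: in_cell_def del: bspline.simps)
next
  case (Suc d)
  then show ?case
    using bspline_sum_Suc[OF assms, of d "\<lambda>_. 1" "\<lambda>_. 1"] by (simp del: bspline.simps sum.atMost_Suc)
qed

text \<open>The dual polynomials of Marsden's identity: the roots are the \<open>d\<close> knots
  strictly between the end indices of the support \<open>[t (i - d - 1), t i]\<close>, taken from
  right to left.\<close>

definition knot_poly :: "(int \<Rightarrow> real) \<Rightarrow> nat \<Rightarrow> int \<Rightarrow> real poly" where
  "knot_poly t d i = (\<Prod>r<d. [:- t (i - 1 - int r), 1:])"

text \<open>Raising the degree adds to \<open>knot_poly t d i\<close> the root
  \<open>t (i - d - 1)\<close> at index \<open>i\<close> and the root \<open>t i\<close> at index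
  \<open>i + 1\<close>. Linear interpolation of \<open>y - s\<close> between these two values of
  \<open>s\<close> at \<open>s = x\<close> gives the factor \<open>y - x\<close>, so
  \<open>bspline_sum_Suc\<close> applies.\<close>

lemma marsden_identity:
  assumes "mono t" "in_cell t l x"
  shows "(\<Sum>m\<le>d. poly (knot_poly t d (l + int m)) y * bspline t d (l + int m) x) = (y - x) ^ d"
proof (induction d)
  case 0
  then show ?case using assms(2) by (simp add: in_cell_def knot_poly_def del: bspline.simps)
next
  case (Suc d)
  have 1: "poly (knot_poly t (Suc d) i) y = (y - t (i - int d - 1)) * poly (knot_poly t d i) y" for i
    by (simp add: knot_poly_def algebra_simps)
  have 2: "poly (knot_poly t (Suc d) (i + 1)) y = (y - t i) * poly (knot_poly t d i) y" for i
    unfolding knot_poly_def prod.lessThan_Suc_shift by (simp add: algebra_simps)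
  have "(\<Sum>m\<le>Suc d. poly (knot_poly t (Suc d) (l + int m)) y * bspline t (Suc d) (l + int m) x)
    = (\<Sum>m\<le>d. ((y - x) * poly (knot_poly t d (l + int m)) y) * bspline t d (l + int m) x)"
    by (rule bspline_sum_Suc[OF assms, of d "\<lambda>i. poly (knot_poly t (Suc d) i) y"
      "\<lambda>i. (y - x) * poly (knot_poly t d i) y"])
      (unfold 2, unfold 1, simp add: algebra_simps)
  also have "\<dots> = (y - x) * (\<Sum>m\<le>d. poly (knot_poly t d (l + int m)) y * bspline t d (l + int m) x)"
    by (simp add: sum_distrib_left mult.assoc)
  finally show ?case using Suc by simp
qed

text \<open>Comparing values at \<open>u 0\<close> kills the last coefficient; cancelling the linear factor of
  \<open>u 0\<close> from what is left lowers the degree.\<close>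

lemma independent_split_products:
  fixes u v :: "nat \<Rightarrow> real" and \<beta> :: "nat \<Rightarrow> real"
  assumes "\<And>r s. u r \<noteq> v s"
    and "(\<Sum>m\<le>d. smult (\<beta> m) ((\<Prod>r<d-m. [:- u r, 1:]) * (\<Prod>r<m. [:- v r, 1:]))) = 0"
  shows "\<forall>m\<le>d. \<beta> m = 0"
  using assms
proof (induction d arbitrary: u)
  case 0
  then show ?case by simp
next
  case (Suc d)
  let ?T = "\<lambda>m. smult (\<beta> m) ((\<Prod>r<Suc d-m. [:- u r, 1:]) * (\<Prod>r<m. [:- v r, 1:]))"
  let ?T' = "\<lambda>m. smult (\<beta> m) ((\<Prod>r<d-m. [:- u (Suc r), 1:]) * (\<Prod>r<m. [:- v r, 1:]))"
  have fac: "(\<Sum>m\<le>d. ?T m) = [:- u 0, 1:] * (\<Sum>m\<le>d. ?T' m)"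
    unfolding sum_distrib_left
  proof (rule sum.cong[OF refl])
    fix m assume "m \<in> {..d}"
    then have "Suc d - m = Suc (d - m)" by auto
    then show "?T m = [:- u 0, 1:] * ?T' m"
      by (simp only: prod.lessThan_Suc_shift mult_smult_right mult.assoc)
  qed
  have 0: "[:- u 0, 1:] * (\<Sum>m\<le>d. ?T' m) + ?T (Suc d) = 0"
    using Suc.prems(2) fac by simp
  then have "poly ([:- u 0, 1:] * (\<Sum>m\<le>d. ?T' m) + ?T (Suc d)) (u 0) = 0" by simp
  then have "\<beta> (Suc d) * (\<Prod>r<Suc d. u 0 - v r) = 0" by (simp add: poly_prod)
  then have last: "\<beta> (Suc d) = 0" using Suc.prems(1) by simp
  have "[:- u 0, 1:] * (\<Sum>m\<le>d. ?T' m) = 0"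
    using 0 unfolding last by (simp only: smult_0_left add_0_right)
  then have "(\<Sum>m\<le>d. ?T' m) = 0" by (simp only: mult_eq_0_iff pCons_eq_0_iff one_neq_zero) simp
  then have "\<forall>m\<le>d. \<beta> m = 0" using Suc.IH[of "\<lambda>r. u (Suc r)"] Suc.prems(1) by simp
  then show ?case using last by (metis le_Suc_eq)
qed

lemma prod_lessThan_split_rev:
  fixes f u v :: "nat \<Rightarrow> 'a::comm_monoid_mult"
  assumes a: "m \<le> d" "\<And>r. r < m \<Longrightarrow> f r = v (m - Suc r)" "\<And>r. r < d - m \<Longrightarrow> f (m + r) = u r"
  shows "(\<Prod>r<d. f r) = (\<Prod>r<d-m. u r) * (\<Prod>r<m. v r)"
proof -
  have "(\<Prod>r<d. f r) = (\<Prod>r<m+(d-m). f r)" using a by simp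
  also have "\<dots> = (\<Prod>r<m. f r) * (\<Prod>r<d-m. f (m + r))"
    by (simp add: prod.nat_group atLeast0LessThan[symmetric] prod.atLeastLessThan_concat[of 0 m "m+(d-m)", symmetric] prod.shift_bounds_nat_ivl[of _ 0 m "d-m", symmetric] add.commute)
  also have "(\<Prod>r<m. f r) = (\<Prod>r<m. v (m - Suc r))" using a by simp
  also have "\<dots> = (\<Prod>r<m. v r)" by (rule prod.nat_diff_reindex)
  finally show ?thesis using a by (simp add: mult.commute)
qed

text \<open>The cell separates the roots: index \<open>l + m\<close> has the first \<open>m\<close>
  knots from \<open>t l\<close> upwards and the first \<open>d - m\<close> knots from
  \<open>t (l - 1)\<close> downwards. Knots on one side may coincide, but knots on different sides
  differ because the cell is nondegenerate.\<close>

lemma knot_poly_independent: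
  assumes "mono t" "t (l - 1) < t l"
    and "(\<Sum>m\<le>d. smult (\<beta> m) (knot_poly t d (l + int m))) = 0" "m \<le> d"
  shows "\<beta> m = 0"
proof -
  have ne: "t (l - 1 - int r) \<noteq> t (l + int s)" for r s
    using monoD[OF assms(1), of "l - 1 - int r" "l - 1"] monoD[OF assms(1), of l "l + int s"] assms(2)
    by auto
  have "knot_poly t d (l + int m) =
    (\<Prod>r<d-m. [:- t (l - 1 - int r), 1:]) * (\<Prod>r<m. [:- t (l + int r), 1:])" if "m \<le> d" for m
    unfolding knot_poly_def
    by (rule prod_lessThan_split_rev) (use that in \<open>auto simp: of_nat_diff algebra_simps\<close>)
  then have "(\<Sum>m\<le>d. smult (\<beta> m) ((\<Prod>r<d-m. [:- t (l - 1 - int r), 1:]) *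
    (\<Prod>r<m. [:- t (l + int r), 1:]))) = 0"
    using assms(3) by simp
  from independent_split_products[OF ne this] assms(4) show ?thesis by blast
qed

section \<open>Dual functionals of B-splines\<close>

text \<open>\<open>c m k'\<close> is the coefficient of degree \<open>k'\<close> of the
  \<open>m\<close>-th Lagrange basis polynomial. Interpolation reproduces monomials of degree at
  most \<open>d\<close>, and comparing coefficients gives the identity.\<close>

lemma vandermonde_right_inverse:
  fixes \<xi> :: "nat \<Rightarrow> real"
  assumes "inj_on \<xi> {..d}"
  obtains c where "\<And>k k'. k \<le> d \<Longrightarrow> (\<Sum>m\<le>d. c m k' * \<xi> m ^ k) = (if k' = k then 1 else 0)"
proof -
  define lag where "lag m = smult (1 / (\<Prod>i\<in>{..d}-{m}. \<xi> m - \<xi> i)) (\<Prod>i\<in>{..d}-{m}. [:- \<xi> i, 1:])" for m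
  have deg: "degree (lag m) \<le> d" if "m \<le> d" for m
  proof -
    have "degree (lag m) \<le> degree (\<Prod>i\<in>{..d}-{m}. [:- \<xi> i, 1:])"
      unfolding lag_def by (rule degree_smult_le)
    also have "\<dots> \<le> sum (degree \<circ> (\<lambda>i. [:- \<xi> i, 1:])) ({..d}-{m})" by (rule degree_prod_sum_le) simp
    also have "\<dots> = d" using that by simp
    finally show ?thesis .
  qed
  have val: "poly (lag m) (\<xi> i) = (if i = m then 1 else 0)" if "m \<le> d" "i \<le> d" for m i
  proof (cases "i = m")
    case True
    have "\<xi> m \<noteq> \<xi> i" if "i \<in> {..d} - {m}" for i
      using assms \<open>m \<le> d\<close> that by (auto simp: inj_on_def)
    then have "(\<Prod>i\<in>{..d}-{m}. \<xi> m - \<xi> i) \<noteq> 0" by simp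
    then show ?thesis using True by (simp add: lag_def poly_prod)
  next
    case False
    then show ?thesis using that by (auto simp: lag_def poly_prod)
  qed
  have "(\<Sum>m\<le>d. smult (\<xi> m ^ k) (lag m)) = monom 1 k" if "k \<le> d" for k
  proof (rule poly_eqI_degree[where A = "\<xi> ` {..d}"])
    have card: "card (\<xi> ` {..d}) = Suc d" using assms by (simp add: card_image)
    show "degree (\<Sum>m\<le>d. smult (\<xi> m ^ k) (lag m)) < card (\<xi> ` {..d})" unfolding card
      by (rule le_imp_less_Suc, rule degree_sum_le) (auto simp: deg)
    show "degree (monom (1::real) k) < card (\<xi> ` {..d})" unfolding card
      using that degree_monom_le[of "1::real" k] by simp
    fix x assume "x \<in> \<xi> ` {..d}"
    then obtain i where i: "i \<le> d" "x = \<xi> i" by auto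
    have "(\<Sum>m\<le>d. \<xi> m ^ k * poly (lag m) (\<xi> i)) = (\<Sum>m\<le>d. if i = m then \<xi> m ^ k else 0)"
      by (rule sum.cong) (use val i in auto)
    then show "poly (\<Sum>m\<le>d. smult (\<xi> m ^ k) (lag m)) x = poly (monom 1 k) x"
      using i by (simp add: poly_sum poly_monom)
  qed
  then have "coeff (\<Sum>m\<le>d. smult (\<xi> m ^ k) (lag m)) k' = coeff (monom 1 k) k'" if "k \<le> d" for k k'
    using that by simp
  then have "(\<Sum>m\<le>d. coeff (lag m) k' * \<xi> m ^ k) = (if k' = k then 1 else 0)" if "k \<le> d" for k k'
    using that by (auto simp: coeff_sum mult.commute)
  then show ?thesis by (rule that)
qed

lemma abs_coeff_prod_linear_le:
  fixes z :: "nat \<Rightarrow> real"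
  assumes "\<And>r. r < d \<Longrightarrow> \<bar>z r\<bar> \<le> R" "0 \<le> R"
  shows "\<bar>coeff (\<Prod>r<d. [:- z r, 1:]) k\<bar> \<le> (1 + R) ^ d"
  using assms(1)
proof (induction d arbitrary: k)
  case 0
  then show ?case by simp
next
  case (Suc d)
  let ?P = "\<Prod>r<d. [:- z r, 1:]"
  have "(\<Prod>r<Suc d. [:- z r, 1:]) = pCons 0 ?P + smult (- z d) ?P" by simp
  then have "coeff (\<Prod>r<Suc d. [:- z r, 1:]) k = coeff (pCons 0 ?P) k + (- z d) * coeff ?P k"
    by (simp only: coeff_add coeff_smult)
  moreover have "\<bar>coeff (pCons 0 ?P) k\<bar> \<le> (1 + R) ^ d"
    using Suc assms(2) by (auto simp: coeff_pCons split: nat.splits)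
  moreover have "\<bar>(- z d) * coeff ?P k\<bar> \<le> R * (1 + R) ^ d"
    unfolding abs_mult using Suc assms(2) by (intro mult_mono) auto
  ultimately show ?case by (simp add: algebra_simps)
qed

text \<open>The weights evaluate the polar form at \<open>(z\<^sub>0, \<dots>, z\<^sub>d\<^sub>-\<^sub>1)\<close>; the size of \<open>w\<close> is
  controlled since the moments \<open>\<Sum> w\<^sub>m \<xi>\<^sub>m\<^sup>k\<close> are normalized elementary symmetric functions of \<open>z\<close>.\<close>

lemma polarization_weights:
  fixes \<xi> :: "nat \<Rightarrow> real"
  assumes "inj_on \<xi> {..d}" "0 \<le> R"
  obtains D where "\<And>z. (\<And>r. r < d \<Longrightarrow> \<bar>z r\<bar> \<le> R) \<Longrightarrow>
    \<exists>w. (\<Sum>m\<le>d. \<bar>w m\<bar>) \<le> D \<and> (\<Sum>m\<le>d. w m) = 1 \<and>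
        (\<forall>y. (\<Sum>m\<le>d. w m * (y - \<xi> m) ^ d) = (\<Prod>r<d. y - z r))"
proof -
  obtain c where c: "\<And>k k'. k \<le> d \<Longrightarrow> (\<Sum>m\<le>d. c m k' * \<xi> m ^ k) = (if k' = k then 1 else 0)"
    using vandermonde_right_inverse[OF assms(1)] by blast
  define D where "D = (\<Sum>m\<le>d. \<Sum>k\<le>d. \<bar>c m k\<bar> * (1 + R) ^ d)"
  show ?thesis
  proof (rule that[of D])
    fix z :: "nat \<Rightarrow> real"
    assume z: "\<And>r. r < d \<Longrightarrow> \<bar>z r\<bar> \<le> R"
    define P where "P = (\<Prod>r<d. [:- z r, 1:])"
    have degP: "degree P = d" unfolding P_def
      by (subst degree_prod_eq_sum_degree) auto
    have "lead_coeff P = 1" unfolding P_def lead_coeff_prod by simp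
    then have monic: "coeff P d = 1" using degP by simp
    \<comment> \<open>Comparing the coefficients of \<open>y ^ (d - k)\<close> in
      \<open>\<Sum>m\<le>d. w m * (y - \<xi> m) ^ d\<close> and in \<open>P\<close> forces this
      value of the \<open>k\<close>-th moment of \<open>w\<close>. For \<open>k = 0\<close> the
      leading coefficient 1 of \<open>P\<close> becomes the total mass.\<close>
    define \<mu> where "\<mu> k = coeff P (d - k) / (real (d choose k) * (-1) ^ k)" for k
    define w where "w m = (\<Sum>k\<le>d. c m k * \<mu> k)" for m
    have mom: "(\<Sum>m\<le>d. w m * \<xi> m ^ k) = \<mu> k" if "k \<le> d" for k
    proof -
      have "(\<Sum>m\<le>d. w m * \<xi> m ^ k) = (\<Sum>k'\<le>d. \<mu> k' * (\<Sum>m\<le>d. c m k' * \<xi> m ^ k))"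
        unfolding w_def sum_distrib_right sum_distrib_left
        by (subst sum.swap) (simp add: mult_ac)
      also have "\<dots> = (\<Sum>k'\<le>d. if k' = k then \<mu> k' else 0)" using that by (intro sum.cong) (auto simp: c)
      finally show ?thesis using that by simp
    qed
    have \<mu>: "\<bar>\<mu> k\<bar> \<le> (1 + R) ^ d" if "k \<le> d" for k
    proof -
      have "1 \<le> real (d choose k)" using that by (simp add: Suc_leI)
      then have "\<bar>coeff P (d - k)\<bar> / real (d choose k) \<le> \<bar>coeff P (d - k)\<bar> / 1"
        using that by (intro divide_left_mono) auto
      then have "\<bar>\<mu> k\<bar> \<le> \<bar>coeff P (d - k)\<bar>"
        unfolding \<mu>_def by (simp add: abs_mult power_abs)
      also have "\<dots> \<le> (1 + R) ^ d" unfolding P_def by (rule abs_coeff_prod_linear_le) (use z assms(2) in auto)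
      finally show ?thesis .
    qed
    have "(\<Sum>m\<le>d. \<bar>w m\<bar>) \<le> D" unfolding D_def
    proof (rule sum_mono)
      fix m
      have "\<bar>w m\<bar> \<le> (\<Sum>k\<le>d. \<bar>c m k * \<mu> k\<bar>)" unfolding w_def by (rule sum_abs)
      also have "\<dots> \<le> (\<Sum>k\<le>d. \<bar>c m k\<bar> * (1 + R) ^ d)"
        unfolding abs_mult by (intro sum_mono mult_left_mono) (auto intro: \<mu>)
      finally show "\<bar>w m\<bar> \<le> (\<Sum>k\<le>d. \<bar>c m k\<bar> * (1 + R) ^ d)" .
    qed
    moreover have "(\<Sum>m\<le>d. w m) = 1" using mom[of 0] monic by (simp add: \<mu>_def)
    moreover have "(\<Sum>m\<le>d. w m * (y - \<xi> m) ^ d) = (\<Prod>r<d. y - z r)" for y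
    proof -
      have "(\<Sum>m\<le>d. w m * (y - \<xi> m) ^ d) =
        (\<Sum>m\<le>d. \<Sum>k\<le>d. (real (d choose k) * (-1) ^ k * y ^ (d - k)) * (w m * \<xi> m ^ k))"
      proof (rule sum.cong[OF refl])
        fix m
        have "(y - \<xi> m) ^ d = (- \<xi> m + y) ^ d" by simp
        also have "\<dots> = (\<Sum>k\<le>d. real (d choose k) * (- \<xi> m) ^ k * y ^ (d - k))" by (rule binomial_ring)
        also have "\<dots> = (\<Sum>k\<le>d. (real (d choose k) * (-1) ^ k * y ^ (d - k)) * \<xi> m ^ k)"
          by (rule sum.cong[OF refl]) (simp add: power_minus[of "\<xi> m"] mult_ac)
        finally show "w m * (y - \<xi> m) ^ d = (\<Sum>k\<le>d. (real (d choose k) * (-1) ^ k * y ^ (d - k)) * (w m * \<xi> m ^ k))"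
          by (simp add: sum_distrib_left mult_ac)
      qed
      also have "\<dots> = (\<Sum>k\<le>d. (real (d choose k) * (-1) ^ k * y ^ (d - k)) * (\<Sum>m\<le>d. w m * \<xi> m ^ k))"
        unfolding sum_distrib_left by (rule sum.swap)
      also have "\<dots> = (\<Sum>k\<le>d. coeff P (d - k) * y ^ (d - k))"
      proof (rule sum.cong[OF refl])
        fix k assume "k \<in> {..d}"
        then have "k \<le> d" by simp
        then show "(real (d choose k) * (-1) ^ k * y ^ (d - k)) * (\<Sum>m\<le>d. w m * \<xi> m ^ k) = coeff P (d - k) * y ^ (d - k)"
          unfolding mom[OF \<open>k \<le> d\<close>] \<mu>_def by (simp add: binomial_eq_0_iff)
      qed
      also have "\<dots> = (\<Sum>k\<le>d. coeff P k * y ^ k)"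
        using sum.nat_diff_reindex[of "\<lambda>k. coeff P k * y ^ k" "Suc d"] by (simp only: diff_Suc_Suc lessThan_Suc_atMost)
      also have "\<dots> = poly P y" unfolding poly_altdef degP ..
      finally show ?thesis by (simp add: P_def poly_prod)
    qed
    ultimately show "\<exists>w. (\<Sum>m\<le>d. \<bar>w m\<bar>) \<le> D \<and> (\<Sum>m\<le>d. w m) = 1 \<and>
        (\<forall>y. (\<Sum>m\<le>d. w m * (y - \<xi> m) ^ d) = (\<Prod>r<d. y - z r))" by blast
  qed
qed

lemma longest_knot_interval:
  fixes t :: "int \<Rightarrow> real"
  obtains l where "l \<in> {i - int d..i}" "t i - t (i - int d - 1) \<le> real (d + 1) * (t l - t (l - 1))"
proof -
  let ?L = "(\<lambda>l. t l - t (l - 1)) ` {i - int d..i}"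
  have "Max ?L \<in> ?L" by (intro Max_in) auto
  then obtain l where l: "l \<in> {i - int d..i}" "Max ?L = t l - t (l - 1)" by (elim imageE)
  have "t i - t (i - int d - 1) = (\<Sum>n<Suc d. t (i - int d - 1 + int (Suc n)) - t (i - int d - 1 + int n))"
    by (subst sum_lessThan_telescope) simp
  also have "\<dots> \<le> (\<Sum>n<Suc d. Max ?L)"
  proof (rule sum_mono)
    fix n assume n: "n \<in> {..<Suc d}"
    have "t (i - int d - 1 + int (Suc n)) - t (i - int d - 1 + int n) \<in> ?L"
      by (rule image_eqI[of _ _ "i - int d + int n"]) (use n in \<open>auto simp: algebra_simps\<close>)
    then show "t (i - int d - 1 + int (Suc n)) - t (i - int d - 1 + int n) \<le> Max ?L" by (intro Max_ge) auto
  qed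
  finally show ?thesis using that[OF l(1)] l(2) by simp
qed

text \<open>In the longest knot interval of the support of the \<open>i\<close>-th B-spline, all knots of the support
  lie within \<open>d + 1\<close> interval lengths, so \<open>D\<close> does not depend on the knots.\<close>

lemma bspline_dual_weights:
  obtains D where "\<And>t i. mono t \<Longrightarrow> (\<And>i. t i \<le> 1) \<Longrightarrow> t (i - int d - 1) < t i \<Longrightarrow>
    \<exists>l x w. t (l - 1) < t l \<and> (\<forall>m\<le>d. t (l - 1) \<le> x m \<and> x m < t l) \<and>
      (\<Sum>m\<le>d. \<bar>w m\<bar>) \<le> D \<and> (\<Sum>m\<le>d. w m) = 1 \<and>
      (\<forall>i'. (\<Sum>m\<le>d. w m * bspline t d i' (x m)) = (if i' = i then 1 else 0))"
proof -
  \<comment> \<open>Nodes fixed in advance make \<open>D\<close> depend on \<open>d\<close> alone.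
    The denominator \<open>d + 1\<close> keeps them below 1, so that their images stay in a
    half-open cell.\<close>
  define \<xi> where "\<xi> m = real m / real (d + 1)" for m
  have "inj_on \<xi> {..d}" by (auto simp: inj_on_def \<xi>_def)
  then obtain D where D: "\<And>z. (\<And>r. r < d \<Longrightarrow> \<bar>z r\<bar> \<le> real (d + 1)) \<Longrightarrow>
    \<exists>w. (\<Sum>m\<le>d. \<bar>w m\<bar>) \<le> D \<and> (\<Sum>m\<le>d. w m) = 1 \<and>
        (\<forall>y. (\<Sum>m\<le>d. w m * (y - \<xi> m) ^ d) = (\<Prod>r<d. y - z r))"
    using polarization_weights[of \<xi> d "real (d + 1)"] by auto
  show ?thesis
  proof (rule that[of D])
    fix t :: "int \<Rightarrow> real" and i
    assume t: "mono t" "\<And>i. t i \<le> 1" "t (i - int d - 1) < t i"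
    obtain l where l: "l \<in> {i - int d..i}" "t i - t (i - int d - 1) \<le> real (d + 1) * (t l - t (l - 1))"
      by (rule longest_knot_interval)
    define h where "h = t l - t (l - 1)"
    have "0 < real (d + 1) * h" using l(2) t(3) unfolding h_def by linarith
    then have h: "h > 0" by (simp add: zero_less_mult_iff)
    \<comment> \<open>The roots of \<open>knot_poly t d i\<close> in the coordinate that turns the
      chosen cell into \<open>[0, 1]\<close>; the choice of \<open>l\<close> bounds them by
      \<open>d + 1\<close>.\<close>
    define z where "z r = (t (i - 1 - int r) - t (l - 1)) / h" for r
    define x where "x m = t (l - 1) + h * \<xi> m" for m
    have "\<bar>z r\<bar> \<le> real (d + 1)" if "r < d" for r
    proof -
      have "t (i - int d - 1) \<le> t (i - 1 - int r)" "t (i - 1 - int r) \<le> t i"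
        "t (i - int d - 1) \<le> t (l - 1)" "t (l - 1) \<le> t i"
        using l(1) that by (auto intro!: monoD[OF t(1)])
      then have "\<bar>t (i - 1 - int r) - t (l - 1)\<bar> \<le> real (d + 1) * h" using l(2) unfolding h_def by linarith
      then show ?thesis using h by (simp add: z_def divide_le_eq)
    qed
    then obtain w where w: "(\<Sum>m\<le>d. \<bar>w m\<bar>) \<le> D" "(\<Sum>m\<le>d. w m) = 1"
      "\<And>y. (\<Sum>m\<le>d. w m * (y - \<xi> m) ^ d) = (\<Prod>r<d. y - z r)" using D[of z] by blast
    have x: "t (l - 1) \<le> x m \<and> x m < t l" if "m \<le> d" for m
    proof -
      have "0 \<le> \<xi> m" "\<xi> m < 1" using that by (auto simp: \<xi>_def)
      then have "0 \<le> h * \<xi> m" "h * \<xi> m < h" using h by auto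
      then show ?thesis by (auto simp: x_def h_def)
    qed
    have cell: "in_cell t l (x m)" if "m \<le> d" for m
      using x[OF that] t by (intro in_cellI) auto
    define W where "W i' = (\<Sum>m\<le>d. w m * bspline t d i' (x m))" for i'
    obtain n where n: "i = l + int n" "n \<le> d" using l(1) by (intro that[of "nat (i - l)"]) auto
    \<comment> \<open>By Marsden's identity the weighted sum of the \<open>(y - x m) ^ d\<close> has
      coordinates \<open>W\<close> with respect to the polynomials \<open>knot_poly\<close>; by the
      choice of \<open>w\<close> it is \<open>knot_poly t d i\<close> itself. Independence then
      determines \<open>W\<close>.\<close>
    have "poly (\<Sum>r\<le>d. smult (W (l + int r) - (if r = n then 1 else 0)) (knot_poly t d (l + int r))) y = 0" for y
    proof -
      have "(\<Sum>r\<le>d. poly (knot_poly t d (l + int r)) y * W (l + int r))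
        = (\<Sum>m\<le>d. w m * (\<Sum>r\<le>d. poly (knot_poly t d (l + int r)) y * bspline t d (l + int r) (x m)))"
        unfolding W_def sum_distrib_left by (subst sum.swap) (simp add: mult_ac)
      also have "\<dots> = (\<Sum>m\<le>d. w m * (y - x m) ^ d)"
        using cell t(1) by (intro sum.cong) (auto simp: marsden_identity)
      also have "\<dots> = (\<Sum>m\<le>d. h ^ d * (w m * ((y - t (l - 1)) / h - \<xi> m) ^ d))"
      proof (rule sum.cong[OF refl])
        fix m
        have "y - x m = h * ((y - t (l - 1)) / h - \<xi> m)" using h by (simp add: x_def field_simps)
        then show "w m * (y - x m) ^ d = h ^ d * (w m * ((y - t (l - 1)) / h - \<xi> m) ^ d)"
          by (simp add: power_mult_distrib)
      qed
      also have "\<dots> = h ^ d * (\<Prod>r<d. (y - t (l - 1)) / h - z r)"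
        unfolding sum_distrib_left[symmetric] w(3) ..
      also have "\<dots> = (\<Prod>r<d. h * ((y - t (l - 1)) / h - z r))" by (simp add: prod.distrib)
      also have "\<dots> = (\<Prod>r<d. y - t (i - 1 - int r))"
        using h by (intro prod.cong) (auto simp: z_def field_simps)
      also have "\<dots> = poly (knot_poly t d i) y" by (simp add: knot_poly_def poly_prod)
      finally have "(\<Sum>r\<le>d. poly (knot_poly t d (l + int r)) y * W (l + int r)) = poly (knot_poly t d i) y" .
      moreover have "(\<Sum>r\<le>d. (if r = n then 1 else 0) * poly (knot_poly t d (l + int r)) y) = poly (knot_poly t d i) y"
        using n by (simp add: if_distrib[of "\<lambda>x. x * _"] cong: if_cong)
      ultimately show ?thesis by (simp add: poly_sum algebra_simps sum_subtractf)
    qed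
    then have "(\<Sum>r\<le>d. smult (W (l + int r) - (if r = n then 1 else 0)) (knot_poly t d (l + int r))) = 0"
      using poly_all_0_iff_0 by blast
    from knot_poly_independent[OF t(1) _ this] h
    have Wl: "W (l + int r) = (if r = n then 1 else 0)" if "r \<le> d" for r
      using that unfolding h_def by force
    have "W i' = (if i' = i then 1 else 0)" for i'
    proof (cases "l \<le> i' \<and> i' \<le> l + int d")
      case True
      then show ?thesis using Wl[of "nat (i' - l)"] n by auto
    next
      case False
      then have "bspline t d i' (x m) = 0" if "m \<le> d" for m
        using bspline_outside_cell[OF cell[OF that]] by (meson not_le)
      then have "W i' = 0" unfolding W_def by simp
      then show ?thesis using False n by auto
    qed
    then show "\<exists>l x w. t (l - 1) < t l \<and> (\<forall>m\<le>d. t (l - 1) \<le> x m \<and> x m < t l) \<and>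
      (\<Sum>m\<le>d. \<bar>w m\<bar>) \<le> D \<and> (\<Sum>m\<le>d. w m) = 1 \<and>
      (\<forall>i'. (\<Sum>m\<le>d. w m * bspline t d i' (x m)) = (if i' = i then 1 else 0))"
      using x w h unfolding W_def h_def by (intro exI[of _ l] exI[of _ x] exI[of _ w]) auto
  qed
qed

section \<open>Splines with simple inner knots\<close>

lemma full_knots_bounds:
  assumes "k \<in> inner_knots q j"
  shows "0 \<le> full_knots q j k i" "full_knots q j k i \<le> 1"
proof -
  have "k n \<in> {0<..<1}" if "n \<in> {1..j - q}" for n
    using assms that by (auto simp: inner_knots_def)
  moreover have "nat i \<in> {1..j - q}" if "0 < i" "i \<le> int j - int q" using that by auto
  ultimately have "k (nat i) \<in> {0<..<1}" if "0 < i" "i \<le> int j - int q" using that by blast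
  then show "0 \<le> full_knots q j k i" "full_knots q j k i \<le> 1" by (fastforce simp: full_knots_def)+
qed

lemma full_knots_less:
  assumes "k \<in> inner_knots q j" "q \<le> j" "0 \<le> i" "i < i'" "i' \<le> int j - int q + 1"
  shows "full_knots q j k i < full_knots q j k i'"
proof -
  have k: "k n \<in> {0<..<1}" if "n \<in> {1..j - q}" for n
    using assms that by (auto simp: inner_knots_def)
  have mono: "k n < k n'" if "n \<in> {1..j - q}" "n' \<in> {1..j - q}" "n < n'" for n n'
    using assms(1) that by (auto simp: inner_knots_def strict_mono_on_def)
  have "nat i \<in> {1..j - q}" if "0 < i" using assms that by auto
  moreover have "nat i' \<in> {1..j - q}" if "i' \<le> int j - int q" using assms that by auto
  ultimately show ?thesis using k[of "nat i"] k[of "nat i'"] mono[of "nat i" "nat i'"] assms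
    by (auto simp: full_knots_def)
qed

lemma mono_full_knots:
  assumes "k \<in> inner_knots q j" "q \<le> j"
  shows "mono (full_knots q j k)"
proof (rule monoI)
  fix i i' :: int
  assume "i \<le> i'"
  then consider "i = i'" | "i < i'" "i \<ge> 0" "i' \<le> int j - int q + 1" | "i < 0" | "i' > int j - int q + 1"
    by linarith
  then show "full_knots q j k i \<le> full_knots q j k i'"
  proof cases
    case 3
    then have "full_knots q j k i = 0" by (simp add: full_knots_def)
    then show ?thesis using full_knots_bounds[OF assms(1)] by simp
  next
    case 4
    then have "full_knots q j k i' = 1" using assms(2) by (simp add: full_knots_def)
    then show ?thesis using full_knots_bounds[OF assms(1)] by simp
  qed (use full_knots_less[OF assms] in \<open>auto intro: less_imp_le\<close>)
qed

lemma full_knots_cell: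
  assumes "k \<in> inner_knots q j" "q \<le> j" "x \<in> {0..1}"
  obtains l where "1 \<le> l" "l \<le> j - q + 1" "in_cell (full_knots q j k) (int l) x"
proof -
  let ?t = "full_knots q j k"
  note less = full_knots_less[OF assms(1,2)]
  have top: "?t i = 1" if "i \<ge> int j - int q + 1" for i
    using that assms(2) by (simp add: full_knots_def)
  show ?thesis
  proof (cases "x = 1")
    case True
    \<comment> \<open>The endpoint 1 belongs to the only nondegenerate knot interval that ends at
      1.\<close>
    let ?l = "j - q + 1"
    have "in_cell ?t (int ?l) x"
      unfolding in_cell_def
    proof (intro conjI allI)
      show "?t (int ?l - 1) < ?t (int ?l)" by (rule less) (use assms(2) in auto)
      show "?t (int ?l - 1) \<le> x" "x \<le> ?t (int ?l)"
        using full_knots_bounds[OF assms(1)] top True assms(2) by auto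
      fix i
      show "bspline ?t 0 i x = (if i = int ?l then 1 else 0)"
      proof (cases i "int ?l" rule: linorder_cases)
        case less
        have "?t i \<noteq> 1"
        proof (cases "i \<ge> 0")
          case True
          then show ?thesis using full_knots_less[OF assms(1,2), of i "int ?l"] less assms(2) top[of "int ?l"] by auto
        qed (simp add: full_knots_def)
        then show ?thesis using less full_knots_bounds[OF assms(1), of i] True by auto
      next
        case equal
        have "?t (i - 1) < ?t i"
          by (rule full_knots_less[OF assms(1,2)]) (use equal assms(2) in auto)
        then show ?thesis using equal top[of i] True assms(2) by simp
      next
        case greater
        then show ?thesis using top[of i] top[of "i - 1"] True assms(2) by auto
      qed
    qed
    then show ?thesis using that[of ?l] by auto
  next
    case False
    then have x: "0 \<le> x" "x < 1" using assms(3) by auto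
    let ?S = "{n. n \<le> j - q \<and> ?t (int n) \<le> x}"
    define n where "n = Max ?S"
    have fin: "finite ?S" by simp
    have "0 \<in> ?S" using x by (simp add: full_knots_def)
    then have "n \<in> ?S" unfolding n_def using fin by (intro Max_in) auto
    moreover have "x < ?t (int (n + 1))"
    proof (rule ccontr)
      assume *: "\<not> x < ?t (int (n + 1))"
      have "n + 1 \<le> j - q"
      proof (rule ccontr)
        assume "\<not> n + 1 \<le> j - q"
        then have "?t (int (n + 1)) = 1" using assms(2) by (intro top) auto
        then show False using * x by simp
      qed
      then have "n + 1 \<in> ?S" using * by auto
      then have "n + 1 \<le> n" unfolding n_def using fin by (intro Max_ge) auto
      then show False by simp
    qed
    ultimately show ?thesis
      using that[of "n + 1"] in_cellI[OF mono_full_knots[OF assms(1,2)], of "int (n + 1)" x]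
        full_knots_bounds[OF assms(1)] by auto
  qed
qed

lemma full_knots_bspline_nonneg:
  assumes "k \<in> inner_knots q j" "q \<le> j" "x \<in> {0..1}"
  shows "0 \<le> bspline (full_knots q j k) d i x"
  using full_knots_cell[OF assms] bspline_nonneg[OF mono_full_knots[OF assms(1,2)]] by metis

lemma full_knots_partition_of_unity:
  assumes "k \<in> inner_knots q j" "1 \<le> q" "q \<le> j" "x \<in> {0..1}"
  shows "(\<Sum>i = 1..j. bspline (full_knots q j k) (q - 1) (int i) x) = 1"
proof -
  obtain l where l: "1 \<le> l" "l \<le> j - q + 1" "in_cell (full_knots q j k) (int l) x"
    by (rule full_knots_cell[OF assms(1,3,4)])
  let ?B = "\<lambda>i. bspline (full_knots q j k) (q - 1) (int i) x"
  have "(\<Sum>i = 1..j. ?B i) = (\<Sum>i = l + 0..l + (q - 1). ?B i)"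
    using l assms(2,3) by (intro sum.mono_neutral_right) (auto intro!: bspline_outside_cell[OF l(3)])
  also have "\<dots> = (\<Sum>m\<le>q - 1. ?B (l + m))"
    by (simp only: add_0_right sum.atLeastAtMost_shift_0[of l "l + (q - 1)"] atLeast0AtMost) (simp add: atLeast0AtMost)
  also have "\<dots> = 1"
    using bspline_partition_of_unity[OF mono_full_knots[OF assms(1,3)] l(3)] by simp
  finally show ?thesis .
qed

lemma abs_spline_le:
  assumes "k \<in> inner_knots q j" "1 \<le> q" "q \<le> j" "x \<in> {0..1}" "\<And>i. i \<in> {1..j} \<Longrightarrow> \<bar>a i\<bar> \<le> A"
  shows "\<bar>spline q j a k x\<bar> \<le> A"
proof -
  have "\<bar>spline q j a k x\<bar> \<le> (\<Sum>i = 1..j. \<bar>a i * bspline (full_knots q j k) (q - 1) (int i) x\<bar>)"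
    unfolding spline_def by (rule sum_abs)
  also have "\<dots> \<le> (\<Sum>i = 1..j. A * bspline (full_knots q j k) (q - 1) (int i) x)"
    unfolding abs_mult using full_knots_bspline_nonneg[OF assms(1,3,4)] assms(5)
    by (intro sum_mono) (auto intro!: mult_right_mono)
  also have "\<dots> = A" using full_knots_partition_of_unity[OF assms(1-4)]
    by (simp only: sum_distrib_left[symmetric] mult_1_right)
  finally show ?thesis .
qed

lemma spline_diff_coeff: "spline q j a k x - spline q j b k x = spline q j (\<lambda>i. a i - b i) k x"
  by (simp add: spline_def sum_subtractf algebra_simps)

lemma abs_le_vec_norm_inf:
  "i \<in> {1..j} \<Longrightarrow> \<bar>x i\<bar> \<le> vec_norm_inf j x"
  unfolding vec_norm_inf_def by (intro Max_ge) auto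

lemma vec_norm_inf_le_iff:
  "1 \<le> j \<Longrightarrow> vec_norm_inf j x \<le> c \<longleftrightarrow> (\<forall>i\<in>{1..j}. \<bar>x i\<bar> \<le> c)"
  unfolding vec_norm_inf_def by (subst Max_le_iff) auto

lemma bounded_spline:
  assumes "k \<in> inner_knots q j" "1 \<le> q" "q \<le> j"
  shows "bounded (spline q j a k ` {0..1})"
  unfolding bounded_iff
  using abs_spline_le[OF assms _ abs_le_vec_norm_inf[of _ j a]] by fastforce

lemma sup_norm_le_iff:
  assumes "bounded (f ` {0..1})"
  shows "sup_norm f \<le> c \<longleftrightarrow> (\<forall>x\<in>{0..1}. \<bar>f x\<bar> \<le> c)"
proof -
  have "bdd_above ((\<lambda>x. \<bar>f x\<bar>) ` {0..1})"
    using assms unfolding bounded_iff bdd_above_def by fastforce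
  then show ?thesis unfolding sup_norm_def by (subst cSUP_le_iff) auto
qed

lemma knot_interval_le_mesh_size:
  "i \<in> {1..int j - int q + 1} \<Longrightarrow> \<bar>full_knots q j k i - full_knots q j k (i - 1)\<bar> \<le> mesh_size q j k"
  unfolding mesh_size_def by (intro Max_ge) auto

lemma sparseness_le_knot_interval:
  "i \<in> {1..int j - int q + 1} \<Longrightarrow> sparseness q j k \<le> \<bar>full_knots q j k i - full_knots q j k (i - 1)\<bar>"
  unfolding sparseness_def by (intro Min_le) auto

text \<open>Since the weights have mass one, the number \<open>f (x 0)\<close> can be subtracted
  before they are applied. Hence \<open>D\<close> multiplies only the approximation error and the
  oscillation of \<open>f\<close> over one knot interval, while the bound \<open>A\<close> on
  \<open>f\<close> enters with constant one. Applying the weights to the spline directly would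
  produce \<open>D * A\<close>.\<close>

lemma spline_coeff_bound:
  assumes "1 \<le> q"
  obtains D where "\<And>j k a i f e w A. \<lbrakk>q \<le> j; k \<in> inner_knots q j; i \<in> {1..j};
      \<And>x. x \<in> {0..1} \<Longrightarrow> \<bar>f x - spline q j a k x\<bar> \<le> e; \<And>x. x \<in> {0..1} \<Longrightarrow> \<bar>f x\<bar> \<le> A;
      \<And>x y. \<lbrakk>x \<in> {0..1}; y \<in> {0..1}; \<bar>x - y\<bar> \<le> mesh_size q j k\<rbrakk> \<Longrightarrow> \<bar>f x - f y\<bar> \<le> w\<rbrakk>
    \<Longrightarrow> \<bar>a i\<bar> \<le> A + D * (e + w)"
proof -
  define d where "d = q - 1"
  obtain D where D: "\<And>t i. mono t \<Longrightarrow> (\<And>i. t i \<le> 1) \<Longrightarrow> t (i - int d - 1) < t i \<Longrightarrow>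
    \<exists>l x w. t (l - 1) < t l \<and> (\<forall>m\<le>d. t (l - 1) \<le> x m \<and> x m < t l) \<and>
      (\<Sum>m\<le>d. \<bar>w m\<bar>) \<le> D \<and> (\<Sum>m\<le>d. w m) = 1 \<and>
      (\<forall>i'. (\<Sum>m\<le>d. w m * bspline t d i' (x m)) = (if i' = i then 1 else 0))"
    by (rule bspline_dual_weights[of d]) blast
  show ?thesis
  proof (rule that[of D])
    fix j k a i f e w A
    assume j: "q \<le> j" and k: "k \<in> inner_knots q j" and i: "i \<in> {1..j}"
      and e: "\<And>x. x \<in> {0..1} \<Longrightarrow> \<bar>f x - spline q j a k x\<bar> \<le> e"
      and A: "\<And>x. x \<in> {0..1} \<Longrightarrow> \<bar>f x\<bar> \<le> (A::real)"
      and w: "\<And>x y. \<lbrakk>x \<in> {0..1}; y \<in> {0..1}; \<bar>x - y\<bar> \<le> mesh_size q j k\<rbrakk> \<Longrightarrow> \<bar>f x - f y\<bar> \<le> w"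
    let ?t = "full_knots q j k"
    have supp: "?t (int i - int d - 1) < ?t (int i)"
    proof -
      \<comment> \<open>Both indices are clipped to the range \<open>0..j - q + 1\<close>, on which
        the knots increase strictly. The support is therefore nondegenerate in spite of the multiple
        end knots.\<close>
      have "?t (int i - int d - 1) \<le> ?t (max 0 (int i - int q))"
        using assms mono_full_knots[OF k j] by (auto intro!: monoD[of ?t] simp: d_def)
      also have "\<dots> < ?t (min (int i) (int j - int q + 1))"
        by (rule full_knots_less[OF k j]) (use i j assms in auto)
      also have "\<dots> \<le> ?t (int i)" by (rule monoD[OF mono_full_knots[OF k j]]) auto
      finally show ?thesis .
    qed
    obtain l x v where l: "?t (l - 1) < ?t l" and x: "\<And>m. m \<le> d \<Longrightarrow> ?t (l - 1) \<le> x m \<and> x m < ?t l"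
      and v: "(\<Sum>m\<le>d. \<bar>v m\<bar>) \<le> D" "(\<Sum>m\<le>d. v m) = 1"
        "\<And>i'. (\<Sum>m\<le>d. v m * bspline ?t d i' (x m)) = (if i' = int i then 1 else 0)"
      using D[OF mono_full_knots[OF k j] full_knots_bounds(2)[OF k] supp] by blast
    have "l \<in> {1..int j - int q + 1}"
    proof (rule ccontr)
      assume "l \<notin> {1..int j - int q + 1}"
      then have "?t (l - 1) = ?t l" using j by (auto simp: full_knots_def)
      then show False using l by simp
    qed
    from knot_interval_le_mesh_size[OF this, of k] l
    have mesh: "?t l - ?t (l - 1) \<le> mesh_size q j k" by simp
    have x01: "x m \<in> {0..1}" if "m \<le> d" for m
      using x[OF that] full_knots_bounds[OF k, of "l - 1"] full_knots_bounds[OF k, of l] by auto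
    have "(\<Sum>m\<le>d. v m * spline q j a k (x m)) = (\<Sum>i'=1..j. a i' * (\<Sum>m\<le>d. v m * bspline ?t d (int i') (x m)))"
      unfolding spline_def d_def[symmetric] sum_distrib_left by (subst sum.swap) (simp add: mult_ac)
    also have "\<dots> = a i" using i by (simp add: v(3) if_distrib[of "\<lambda>x. _ * x"] cong: if_cong)
    finally have "a i - f (x 0) = (\<Sum>m\<le>d. v m * spline q j a k (x m)) - (\<Sum>m\<le>d. v m) * f (x 0)"
      using v(2) by simp
    also have "\<dots> = (\<Sum>m\<le>d. v m * (spline q j a k (x m) - f (x 0)))"
      by (simp only: sum_distrib_right right_diff_distrib sum_subtractf)
    also have "\<bar>\<dots>\<bar> \<le> (\<Sum>m\<le>d. \<bar>v m\<bar> * (e + w))"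
    proof (rule order.trans[OF sum_abs], rule sum_mono)
      fix m assume "m \<in> {..d}"
      then have m: "m \<le> d" by simp
      have "\<bar>x m - x 0\<bar> \<le> mesh_size q j k" using x[OF m] x[of 0] mesh by auto
      from w[OF x01[OF m] x01[of 0] this] e[OF x01[OF m]]
      have "\<bar>spline q j a k (x m) - f (x 0)\<bar> \<le> e + w" by simp
      then show "\<bar>v m * (spline q j a k (x m) - f (x 0))\<bar> \<le> \<bar>v m\<bar> * (e + w)"
        unfolding abs_mult by (rule mult_left_mono) simp
    qed
    also have "\<dots> = (\<Sum>m\<le>d. \<bar>v m\<bar>) * (e + w)" by (simp add: sum_distrib_right)
    also have "\<dots> \<le> D * (e + w)"
    proof (rule mult_right_mono[OF v(1)])
      have x0: "x 0 \<in> {0..1}" using x01[of 0] by simp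
      have "0 \<le> mesh_size q j k" using mesh l by linarith
      then show "0 \<le> e + w" using e[OF x0] w[OF x0 x0] by auto
    qed
    finally show "\<bar>a i\<bar> \<le> A + D * (e + w)" using A[OF x01[of 0]] by simp
  qed
qed

text \<open>Serves to reduce suprema over \<open>[0,1]\<close> to countably many points. The
  half-open cells make degree 0 right-continuous, and the recursion preserves this, so no smoothness
  at the knots has to be discussed.\<close>

lemma bspline_right_continuous:
  assumes "x < 1"
  shows "((\<lambda>y. bspline t d i y) \<longlongrightarrow> bspline t d i x) (at_right x)"
proof (induction d arbitrary: i)
  case 0
  have "\<forall>\<^sub>F y in at_right x. y < c" if "x < c" for c :: real
    unfolding eventually_at_right[OF that] using that by blast
  then have lt: "\<forall>\<^sub>F y in at_right x. y < c \<longleftrightarrow> x < c" for c :: real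
    using eventually_at_right_less[of x] by (cases "x < c") (auto elim: eventually_mono)
  have "\<forall>\<^sub>F y in at_right x. bspline t 0 i y = bspline t 0 i x"
    using lt[of 1] lt[of "t i"] lt[of "t (i - 1)"] by eventually_elim (use assms in \<open>auto simp: not_less[symmetric]\<close>)
  then show ?case by (rule tendsto_eventually)
next
  case (Suc d)
  show ?case unfolding bspline.simps divide_inverse by (intro tendsto_intros Suc)
qed

lemma spline_right_continuous:
  "x < 1 \<Longrightarrow> ((\<lambda>y. spline q j a k y) \<longlongrightarrow> spline q j a k x) (at_right x)"
  unfolding spline_def by (intro tendsto_intros bspline_right_continuous)

lemma abs_le_on_rationals:
  fixes g :: "real \<Rightarrow> real"
  assumes "\<And>x. \<lbrakk>0 \<le> x; x < 1\<rbrakk> \<Longrightarrow> (g \<longlongrightarrow> g x) (at_right x)"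
  shows "(\<forall>x\<in>{0..1}. \<bar>g x\<bar> \<le> c) \<longleftrightarrow> (\<forall>x\<in>{0..1} \<inter> \<rat>. \<bar>g x\<bar> \<le> c)"
proof (intro iffI ballI)
  fix x assume c: "\<forall>x\<in>{0..1} \<inter> \<rat>. \<bar>g x\<bar> \<le> c" and x: "x \<in> {0..1::real}"
  show "\<bar>g x\<bar> \<le> c"
  proof (cases "x = 1")
    case False
    then have "0 \<le> x" "x < 1" using x by auto
    show ?thesis
    proof (rule ccontr)
      assume "\<not> \<bar>g x\<bar> \<le> c"
      then have "\<forall>\<^sub>F y in at_right x. c < \<bar>g y\<bar>"
        by (intro order_tendstoD(1)[OF tendsto_rabs[OF assms[OF \<open>0 \<le> x\<close> \<open>x < 1\<close>]]]) simp
      then obtain b where b: "b > x" "\<And>y. x < y \<Longrightarrow> y < b \<Longrightarrow> c < \<bar>g y\<bar>"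
        unfolding eventually_at_right[OF \<open>x < 1\<close>] by blast
      obtain r where "r \<in> \<rat>" "x < r" "r < min b 1" using Rats_dense_in_real[of x "min b 1"] b \<open>x < 1\<close> by auto
      then show False using b(2)[of r] c \<open>0 \<le> x\<close> by force
    qed
  qed (use c in auto)
qed auto

section \<open>Measurability of splines in argument, knots and coefficients\<close>

lemma measurable_bspline_knots:
  assumes "\<And>i. (\<lambda>\<omega>. T \<omega> i) \<in> borel_measurable M"
  shows "(\<lambda>\<omega>. bspline (T \<omega>) d i x) \<in> borel_measurable M"
proof (induction d arbitrary: i)
  case 0
  note [measurable] = assms
  show ?case unfolding bspline.simps by measurable
next
  case (Suc d)
  note [measurable] = assms Suc
  show ?case unfolding bspline.simps by measurable
qed

lemma measurable_bspline: "(\<lambda>x. bspline t d i x) \<in> borel_measurable borel"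
proof (induction d arbitrary: i)
  case 0
  show ?case unfolding bspline.simps(1)[abs_def] by measurable
next
  case (Suc d)
  note [measurable] = Suc
  show ?case unfolding bspline.simps(2)[abs_def] by measurable
qed

lemma measurable_spline: "spline q j a k \<in> borel_measurable borel"
  unfolding spline_def using measurable_bspline by measurable

lemma measurable_full_knots:
  assumes "q \<le> j"
  shows "(\<lambda>k. full_knots q j k i) \<in> borel_measurable (Pi\<^sub>M {1..j - q} (\<lambda>_. borel))"
proof -
  consider "i \<le> 0" | "0 < i" "i \<le> int j - int q" | "i > 0" "i > int j - int q" by linarith
  then show ?thesis
  proof cases
    case 2
    then have "nat i \<in> {1..j - q}" by auto
    then show ?thesis unfolding full_knots_def using 2 by simp
  qed (simp_all add: full_knots_def)
qed

lemma measurable_spline_pair: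
  assumes "q \<le> j"
  shows "(\<lambda>(k, \<theta>). spline q j \<theta> k x) \<in>
    borel_measurable (Pi\<^sub>M {1..j - q} (\<lambda>_. borel) \<Otimes>\<^sub>M Pi\<^sub>M {1..j} (\<lambda>_. borel))"
proof -
  let ?M = "Pi\<^sub>M {1..j - q} (\<lambda>_. borel) \<Otimes>\<^sub>M Pi\<^sub>M {1..j} (\<lambda>_. borel :: real measure)"
  have "(\<lambda>p. full_knots q j (fst p) i) \<in> borel_measurable ?M" for i
    using measurable_compose[OF measurable_fst measurable_full_knots[OF assms]] by simp
  then have "(\<lambda>p. bspline (full_knots q j (fst p)) (q - 1) (int i) x) \<in> borel_measurable ?M" for i
    by (rule measurable_bspline_knots)
  moreover have "(\<lambda>p. snd p i) \<in> borel_measurable ?M" if "i \<in> {1..j}" for i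
    using measurable_compose[OF measurable_snd measurable_component_singleton[OF that]] by simp
  ultimately have "(\<lambda>p. \<Sum>i = 1..j. snd p i * bspline (full_knots q j (fst p)) (q - 1) (int i) x) \<in> borel_measurable ?M"
    by (intro borel_measurable_sum borel_measurable_times) auto
  then show ?thesis by (simp add: spline_def case_prod_beta')
qed

lemma measurable_Max_image:
  fixes f :: "'i \<Rightarrow> 'a \<Rightarrow> real"
  assumes "finite I" "I \<noteq> {}" "\<And>i. i \<in> I \<Longrightarrow> f i \<in> borel_measurable M"
  shows "(\<lambda>x. MAX i\<in>I. f i x) \<in> borel_measurable M" "(\<lambda>x. MIN i\<in>I. f i x) \<in> borel_measurable M"
proof -
  have "(\<lambda>x. MAX i\<in>I. f i x) = (\<lambda>x. SUP i\<in>I. f i x)" "(\<lambda>x. MIN i\<in>I. f i x) = (\<lambda>x. INF i\<in>I. f i x)"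
    using assms by (auto simp: cSup_eq_Max cInf_eq_Min)
  then show "(\<lambda>x. MAX i\<in>I. f i x) \<in> borel_measurable M" "(\<lambda>x. MIN i\<in>I. f i x) \<in> borel_measurable M"
    using assms by (auto intro!: borel_measurable_cSUP borel_measurable_cINF simp: countable_finite)
qed

lemma measurable_mesh_size_sparseness:
  assumes "q \<le> j"
  shows "mesh_size q j \<in> borel_measurable (Pi\<^sub>M {1..j - q} (\<lambda>_. borel))"
    and "sparseness q j \<in> borel_measurable (Pi\<^sub>M {1..j - q} (\<lambda>_. borel))"
  unfolding mesh_size_def[abs_def] sparseness_def[abs_def]
  using assms measurable_full_knots[OF assms]
  by (auto intro!: measurable_Max_image borel_measurable_abs borel_measurable_diff)

lemma measurable_vec_norm_inf:
  assumes "1 \<le> j"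
  shows "(\<lambda>\<theta>. vec_norm_inf j (\<lambda>i. \<theta> i - \<theta>\<^sub>0 i)) \<in> borel_measurable (Pi\<^sub>M {1..j} (\<lambda>_. borel))"
  unfolding vec_norm_inf_def[abs_def]
  using assms by (auto intro!: measurable_Max_image borel_measurable_abs borel_measurable_diff)

section \<open>Entropy of the sieve\<close>

lemma full_knots_bspline_le_1:
  assumes "k \<in> inner_knots q j" "q \<le> j" "x \<in> {0..1}"
  shows "bspline (full_knots q j k) d i x \<le> 1"
proof -
  obtain l where l: "in_cell (full_knots q j k) (int l) x"
    using full_knots_cell[OF assms] by metis
  show ?thesis
  proof (cases "int l \<le> i \<and> i \<le> int l + int d")
    case True
    then obtain n where n: "i = int l + int n" "n \<le> d" by (intro that[of "nat (i - int l)"]) auto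
    have "bspline (full_knots q j k) d (int l + int n) x \<le>
      (\<Sum>m\<le>d. bspline (full_knots q j k) d (int l + int m) x)"
      using n full_knots_bspline_nonneg[OF assms] by (intro member_le_sum) auto
    then show ?thesis using n bspline_partition_of_unity[OF mono_full_knots[OF assms(1,2)] l] by simp
  next
    case False
    then show ?thesis using bspline_outside_cell[OF l, of i d] by auto
  qed
qed

text \<open>The index conditions ensure that some interval of the partition, starting at index
  \<open>max a 0\<close>, lies between the two knots. If they fail for \<open>a \<le> b\<close>, the
  two knots coincide, which is the other case in the Lipschitz estimate.\<close>

lemma full_knots_gap:
  assumes "k \<in> sparse_knots q j \<delta>" "q \<le> j" "a < b" "0 < b" "a \<le> int j - int q"
  shows "\<delta> \<le> full_knots q j k b - full_knots q j k a"
proof -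
  let ?t = "full_knots q j k"
  have k: "k \<in> inner_knots q j" "\<delta> \<le> sparseness q j k" using assms(1) by (auto simp: sparse_knots_def)
  define c where "c = max a 0"
  have "sparseness q j k \<le> \<bar>?t (c + 1) - ?t (c + 1 - 1)\<bar>"
    by (rule sparseness_le_knot_interval) (use assms in \<open>auto simp: c_def\<close>)
  moreover have "?t c \<le> ?t (c + 1)" by (rule monoD[OF mono_full_knots[OF k(1) assms(2)]]) simp
  moreover have "?t (c + 1) \<le> ?t b"
    by (rule monoD[OF mono_full_knots[OF k(1) assms(2)]]) (use assms in \<open>auto simp: c_def\<close>)
  moreover have "?t a = ?t c" by (auto simp: c_def full_knots_def max_def)
  ultimately show ?thesis using k(2) by simp
qed

lemma abs_divide_diff_le:
  fixes u u' w w' :: real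
  assumes "0 < \<delta>" "\<delta> \<le> w" "\<delta> \<le> w'" "\<bar>u\<bar> \<le> 1" "w \<le> 1" "\<bar>u - u'\<bar> \<le> \<eta>" "\<bar>w - w'\<bar> \<le> 2 * \<eta>"
  shows "\<bar>u / w - u' / w'\<bar> \<le> 3 * \<eta> / \<delta>\<^sup>2"
proof -
  have eq: "u / w - u' / w' = (u * (w' - w) + (u - u') * w) / (w * w')"
    using assms by (simp add: field_simps)
  have "\<bar>u * (w' - w) + (u - u') * w\<bar> \<le> \<bar>u\<bar> * \<bar>w - w'\<bar> + \<bar>u - u'\<bar> * \<bar>w\<bar>"
    by (metis abs_minus_commute abs_mult abs_triangle_ineq)
  also have "\<dots> \<le> 1 * (2 * \<eta>) + \<eta> * 1"
    using assms by (intro add_mono mult_mono) auto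
  finally have num: "\<bar>u * (w' - w) + (u - u') * w\<bar> \<le> 3 * \<eta>" by simp
  have "\<delta>\<^sup>2 \<le> w * w'" unfolding power2_eq_square using assms by (intro mult_mono) auto
  then have "\<bar>u * (w' - w) + (u - u') * w\<bar> / (w * w') \<le> 3 * \<eta> / \<delta>\<^sup>2"
    using num assms by (intro frac_le) auto
  then show ?thesis unfolding eq abs_divide using assms by simp
qed

text \<open>Every denominator in the recursion is either zero for both knot vectors or at least
  \<open>\<delta>\<close> for both. One degree costs \<open>8 / \<delta>\<^sup>2\<close>: two
  summands, each with 1 for the change of the lower B-spline and 3 for the change of the quotient,
  where \<open>1 / \<delta>\<close> is enlarged to \<open>1 / \<delta>\<^sup>2\<close>.\<close>

lemma bspline_knots_lipschitz:
  assumes k: "k \<in> sparse_knots q j \<delta>" "k' \<in> sparse_knots q j \<delta>" and j: "q \<le> j"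
    and \<delta>: "0 < \<delta>" "\<delta> \<le> 1" and x: "x \<in> {0..1}"
    and \<eta>: "0 \<le> \<eta>" "\<And>i. \<bar>full_knots q j k i - full_knots q j k' i\<bar> \<le> \<eta>"
    and base: "\<And>i. bspline (full_knots q j k) 0 i x = bspline (full_knots q j k') 0 i x"
  shows "\<bar>bspline (full_knots q j k) d i x - bspline (full_knots q j k') d i x\<bar> \<le> \<eta> * (8 / \<delta>\<^sup>2) ^ d"
proof (induction d arbitrary: i)
  case 0
  then show ?case using base \<eta>(1) by simp
next
  case (Suc d)
  let ?t = "full_knots q j k" and ?t' = "full_knots q j k'"
  have in_k: "k \<in> inner_knots q j" "k' \<in> inner_knots q j" using k by (auto simp: sparse_knots_def)
  have t01: "0 \<le> ?t i" "?t i \<le> 1" "0 \<le> ?t' i" "?t' i \<le> 1" for i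
    using full_knots_bounds[OF in_k(1)] full_knots_bounds[OF in_k(2)] by auto
  have step: "\<bar>u / (?t b - ?t a) * B - u' / (?t' b - ?t' a) * B'\<bar> \<le> \<eta> * (8 / \<delta>\<^sup>2) ^ d / \<delta> + 3 * \<eta> / \<delta>\<^sup>2"
    if "a \<le> b" "\<bar>u\<bar> \<le> 1" "\<bar>u'\<bar> \<le> 1" "\<bar>u - u'\<bar> \<le> \<eta>" "0 \<le> B'" "B' \<le> 1"
      "\<bar>B - B'\<bar> \<le> \<eta> * (8 / \<delta>\<^sup>2) ^ d" for a b u u' B B'
  proof (cases "a < b \<and> 0 < b \<and> a \<le> int j - int q")
    case True
    then have gap: "\<delta> \<le> ?t b - ?t a" "\<delta> \<le> ?t' b - ?t' a" using full_knots_gap k j by blast+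
    have "u / (?t b - ?t a) * B - u' / (?t' b - ?t' a) * B' =
      u / (?t b - ?t a) * (B - B') + (u / (?t b - ?t a) - u' / (?t' b - ?t' a)) * B'"
      by (simp only: algebra_simps)
    also have "\<bar>\<dots>\<bar> \<le> \<bar>u / (?t b - ?t a)\<bar> * \<bar>B - B'\<bar> + \<bar>u / (?t b - ?t a) - u' / (?t' b - ?t' a)\<bar> * \<bar>B'\<bar>"
      by (metis abs_mult abs_triangle_ineq)
    also have "\<dots> \<le> (1 / \<delta>) * (\<eta> * (8 / \<delta>\<^sup>2) ^ d) + (3 * \<eta> / \<delta>\<^sup>2) * 1"
    proof (intro add_mono mult_mono)
      show "\<bar>u / (?t b - ?t a)\<bar> \<le> 1 / \<delta>"
        unfolding abs_divide using that gap \<delta> by (intro frac_le) auto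
      have "\<bar>(?t b - ?t a) - (?t' b - ?t' a)\<bar> \<le> 2 * \<eta>" using \<eta>(2)[of a] \<eta>(2)[of b] by linarith
      then show "\<bar>u / (?t b - ?t a) - u' / (?t' b - ?t' a)\<bar> \<le> 3 * \<eta> / \<delta>\<^sup>2"
        using that gap \<delta> t01[of a] t01[of b] by (intro abs_divide_diff_le) auto
    qed (use that \<delta> \<eta> in auto)
    finally show ?thesis by simp
  next
    case False
    \<comment> \<open>Both quotients are then zero by the convention for division by zero.\<close>
    then have "?t a = ?t b" "?t' a = ?t' b" using that(1) j by (auto simp: full_knots_def)
    then show ?thesis using \<delta> \<eta> by simp
  qed
  have "\<bar>bspline ?t (Suc d) i x - bspline ?t' (Suc d) i x\<bar> \<le>
    \<bar>(x - ?t (i - int d - 2)) / (?t (i - 1) - ?t (i - int d - 2)) * bspline ?t d (i - 1) x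
     - (x - ?t' (i - int d - 2)) / (?t' (i - 1) - ?t' (i - int d - 2)) * bspline ?t' d (i - 1) x\<bar> +
    \<bar>(?t i - x) / (?t i - ?t (i - int d - 1)) * bspline ?t d i x
     - (?t' i - x) / (?t' i - ?t' (i - int d - 1)) * bspline ?t' d i x\<bar>"
    unfolding bspline.simps by (rule abs_diff_triangle_ineq)
  also have "\<dots> \<le> 2 * (\<eta> * (8 / \<delta>\<^sup>2) ^ d / \<delta> + 3 * \<eta> / \<delta>\<^sup>2)"
    unfolding mult_2
  proof (intro add_mono step)
    show "\<bar>x - ?t (i - int d - 2)\<bar> \<le> 1" "\<bar>x - ?t' (i - int d - 2)\<bar> \<le> 1" "\<bar>?t i - x\<bar> \<le> 1" "\<bar>?t' i - x\<bar> \<le> 1"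
      using x t01[of "i - int d - 2"] t01[of i] by auto
    show "\<bar>x - ?t (i - int d - 2) - (x - ?t' (i - int d - 2))\<bar> \<le> \<eta>" "\<bar>?t i - x - (?t' i - x)\<bar> \<le> \<eta>"
      using \<eta>(2)[of "i - int d - 2"] \<eta>(2)[of i] by auto
  qed (use Suc full_knots_bspline_nonneg[OF in_k(2) j x] full_knots_bspline_le_1[OF in_k(2) j x] in auto)
  also have "\<dots> \<le> \<eta> * (8 / \<delta>\<^sup>2) ^ Suc d"
  proof -
    have 1: "1 \<le> 1 / \<delta>" "1 / \<delta> \<le> 1 / \<delta>\<^sup>2" using \<delta> by (auto simp: field_simps power2_eq_square)
    have "1 \<le> 8 / \<delta>\<^sup>2" using 1 by simp
    then have "1 \<le> (8 / \<delta>\<^sup>2) ^ d" by (rule one_le_power)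
    then have "(2 / \<delta>) * (\<eta> * (8 / \<delta>\<^sup>2) ^ d) + (6 / \<delta>\<^sup>2) * (\<eta> * 1) \<le>
      (2 / \<delta>\<^sup>2) * (\<eta> * (8 / \<delta>\<^sup>2) ^ d) + (6 / \<delta>\<^sup>2) * (\<eta> * (8 / \<delta>\<^sup>2) ^ d)"
      using \<eta>(1) 1 by (intro add_mono mult_right_mono mult_left_mono) auto
    then show ?thesis by (simp add: algebra_simps)
  qed
  finally show ?case .
qed

lemma spline_perturbation:
  assumes k: "k \<in> sparse_knots q j \<delta>" "k' \<in> sparse_knots q j \<delta>" and j: "q \<le> j"
    and \<delta>: "0 < \<delta>" "\<delta> \<le> 1" and A: "1 \<le> A"
    and \<eta>: "0 \<le> \<eta>" "\<And>i. i \<in> {1..j - q} \<Longrightarrow> \<bar>k i - k' i\<bar> \<le> \<eta>"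
    and a: "\<And>i. i \<in> {1..j} \<Longrightarrow> \<bar>a i - a' i\<bar> \<le> \<eta>" "\<And>i. i \<in> {1..j} \<Longrightarrow> \<bar>a' i\<bar> \<le> A"
    and x: "0 \<le> x" "x < 1" "x \<notin> (\<Union>i\<in>{1..j - q}. {min (k i) (k' i)..max (k i) (k' i)})"
  shows "\<bar>spline q j a k x - spline q j a' k' x\<bar> \<le> 2 * real j * A * \<eta> * (8 / \<delta>\<^sup>2) ^ (q - 1)"
proof -
  let ?t = "full_knots q j k" and ?t' = "full_knots q j k'" and ?L = "(8 / \<delta>\<^sup>2) ^ (q - 1)"
  have in_k: "k \<in> inner_knots q j" "k' \<in> inner_knots q j" using k by (auto simp: sparse_knots_def)
  have x01: "x \<in> {0..1}" using x by simp
  have close: "\<bar>?t i - ?t' i\<bar> \<le> \<eta>" for i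
  proof (cases "0 < i \<and> i \<le> int j - int q")
    case True
    then have "nat i \<in> {1..j - q}" by auto
    then show ?thesis using \<eta>(2) True by (simp add: full_knots_def)
  qed (use \<eta>(1) in \<open>auto simp: full_knots_def\<close>)
  \<comment> \<open>No knot passes over \<open>x\<close> on its way from \<open>k\<close> to
    \<open>k'\<close>, so \<open>x\<close> sees the same active cell in both knot vectors.\<close>
  have "?t i \<le> x \<longleftrightarrow> ?t' i \<le> x" for i
  proof (cases "0 < i \<and> i \<le> int j - int q")
    case True
    then have "nat i \<in> {1..j - q}" by auto
    then have "x \<notin> {min (k (nat i)) (k' (nat i))..max (k (nat i)) (k' (nat i))}"
      using x(3) by blast
    then show ?thesis using True by (auto simp: full_knots_def)
  qed (auto simp: full_knots_def)
  then have base: "bspline ?t 0 i x = bspline ?t' 0 i x" for i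
    using x by (auto simp: not_le[symmetric])
  have L: "1 \<le> ?L"
  proof (rule one_le_power)
    show "1 \<le> 8 / \<delta>\<^sup>2" using \<delta> power_le_one[of \<delta> 2] by (simp add: field_simps)
  qed
  have "\<bar>a i * bspline ?t (q - 1) (int i) x - a' i * bspline ?t' (q - 1) (int i) x\<bar> \<le> 2 * A * \<eta> * ?L"
    if "i \<in> {1..j}" for i
  proof -
    let ?B = "bspline ?t (q - 1) (int i) x" and ?B' = "bspline ?t' (q - 1) (int i) x"
    have "a i * ?B - a' i * ?B' = (a i - a' i) * ?B + a' i * (?B - ?B')" by (simp only: algebra_simps)
    also have "\<bar>\<dots>\<bar> \<le> \<bar>a i - a' i\<bar> * \<bar>?B\<bar> + \<bar>a' i\<bar> * \<bar>?B - ?B'\<bar>"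
      by (metis abs_mult abs_triangle_ineq)
    also have "\<dots> \<le> \<eta> * 1 + A * (\<eta> * ?L)"
      using a that A \<eta>(1) full_knots_bspline_nonneg[OF in_k(1) j x01] full_knots_bspline_le_1[OF in_k(1) j x01]
        bspline_knots_lipschitz[OF k j \<delta> x01 \<eta>(1) close base]
      by (intro add_mono mult_mono) auto
    also have "\<dots> \<le> A * (\<eta> * ?L) + A * (\<eta> * ?L)"
    proof -
      have "1 * (\<eta> * 1) \<le> A * (\<eta> * ?L)" using A L \<eta>(1) by (intro mult_mono) auto
      then show ?thesis by simp
    qed
    finally show ?thesis by (simp add: algebra_simps)
  qed
  then have "(\<Sum>i = 1..j. \<bar>a i * bspline ?t (q - 1) (int i) x - a' i * bspline ?t' (q - 1) (int i) x\<bar>)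
    \<le> of_nat (card {1..j}) * (2 * A * \<eta> * ?L)"
    by (rule sum_bounded_above)
  then have "\<bar>\<Sum>i = 1..j. a i * bspline ?t (q - 1) (int i) x - a' i * bspline ?t' (q - 1) (int i) x\<bar>
    \<le> of_nat (card {1..j}) * (2 * A * \<eta> * ?L)"
    by (rule order.trans[OF sum_abs])
  then show ?thesis unfolding spline_def sum_subtractf by (simp add: mult_ac)
qed

text \<open>On the set \<open>E\<close> swept by the moving knots only the trivial bound
  \<open>2 * A\<close> is used. The measure of \<open>E\<close> is at most
  \<open>j * \<eta>\<close>, which is why the squared distance is estimated linearly in \<eta>. The
  point 1 is put into \<open>E\<close> to avoid the endpoint clause of
  \<open>bspline\<close>.\<close>

lemma l2_dist_spline_le:
  assumes k: "k \<in> sparse_knots q j \<delta>" "k' \<in> sparse_knots q j \<delta>" and j: "1 \<le> q" "q \<le> j"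
    and \<delta>: "0 < \<delta>" "\<delta> \<le> 1" and A: "1 \<le> A"
    and \<eta>: "0 \<le> \<eta>" "\<eta> \<le> 1" "\<And>i. i \<in> {1..j - q} \<Longrightarrow> \<bar>k i - k' i\<bar> \<le> \<eta>"
    and a: "\<And>i. i \<in> {1..j} \<Longrightarrow> \<bar>a i - a' i\<bar> \<le> \<eta>" "\<And>i. i \<in> {1..j} \<Longrightarrow> \<bar>a i\<bar> \<le> A"
      "\<And>i. i \<in> {1..j} \<Longrightarrow> \<bar>a' i\<bar> \<le> A"
  shows "(l2_dist (spline q j a k) (spline q j a' k'))\<^sup>2 \<le> 8 * real j ^ 2 * A\<^sup>2 * ((8 / \<delta>\<^sup>2) ^ (q - 1))\<^sup>2 * \<eta>"
proof -
  let ?L = "(8 / \<delta>\<^sup>2) ^ (q - 1)"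
  let ?g = "\<lambda>x. spline q j a k x - spline q j a' k' x"
  define E where "E = {1} \<union> (\<Union>i\<in>{1..j - q}. {min (k i) (k' i)..max (k i) (k' i)})"
  define b1 where "b1 = (2 * real j * A * \<eta> * ?L)\<^sup>2"
  define b2 where "b2 = (2 * A)\<^sup>2"
  have in_k: "k \<in> inner_knots q j" "k' \<in> inner_knots q j" using k by (auto simp: sparse_knots_def)
  have L: "1 \<le> ?L"
  proof (rule one_le_power)
    show "1 \<le> 8 / \<delta>\<^sup>2" using \<delta> power_le_one[of \<delta> 2] by (simp add: field_simps)
  qed
  have bound: "\<bar>?g x\<bar>\<^sup>2 \<le> b1 + b2 * indicator E x" if "x \<in> {0..1}" for x
  proof (cases "x \<in> E")
    case True
    have "\<bar>?g x\<bar> \<le> 2 * A"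
      using abs_spline_le[OF in_k(1) j that, of a A] abs_spline_le[OF in_k(2) j that, of a' A] a by fastforce
    then have "\<bar>?g x\<bar>\<^sup>2 \<le> b2" unfolding b2_def by (intro power_mono) auto
    then show ?thesis using True by (simp add: b1_def add_increasing)
  next
    case False
    have "\<bar>?g x\<bar> \<le> 2 * real j * A * \<eta> * ?L"
      by (rule spline_perturbation[OF k j(2) \<delta> A \<eta>(1) \<eta>(3) a(1) a(3)]) (use False that in \<open>auto simp: E_def\<close>)
    then have "\<bar>?g x\<bar>\<^sup>2 \<le> b1" unfolding b1_def by (intro power_mono) auto
    then show ?thesis using False by simp
  qed
  have E: "E \<in> sets lborel" "emeasure lborel E \<noteq> \<infinity>" "measure lborel E \<le> j * \<eta>"
  proof -
    show "E \<in> sets lborel" unfolding E_def by (auto intro!: sets.finite_UN)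
    have "measure lborel E \<le> measure lborel {1::real} + measure lborel (\<Union>i\<in>{1..j - q}. {min (k i) (k' i)..max (k i) (k' i)})"
      unfolding E_def by (rule measure_Un_le) auto
    also have "measure lborel (\<Union>i\<in>{1..j - q}. {min (k i) (k' i)..max (k i) (k' i)}) \<le>
      (\<Sum>i\<in>{1..j - q}. measure lborel {min (k i) (k' i)..max (k i) (k' i)})"
      by (rule measure_UNION_le) auto
    also have "\<dots> \<le> of_nat (card {1..j - q}) * \<eta>"
    proof (rule sum_bounded_above)
      fix i assume "i \<in> {1..j - q}"
      then show "measure lborel {min (k i) (k' i)..max (k i) (k' i)} \<le> \<eta>"
        using \<eta>(3)[of i] by (auto simp: min_def max_def)
    qed
    also have "\<dots> \<le> j * \<eta>" using \<eta>(1) by (auto intro: mult_right_mono)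
    finally show "measure lborel E \<le> j * \<eta>" by simp
    have "bounded E" unfolding E_def by (auto intro!: bounded_UN)
    then show "emeasure lborel E \<noteq> \<infinity>" using emeasure_bounded_finite by (auto simp: less_top)
  qed
  have "(LINT x:{0..1}|lborel. \<bar>?g x\<bar>\<^sup>2) \<le> (LINT x|lborel. b1 * indicator {0..1} x + b2 * indicator E x)"
    unfolding set_lebesgue_integral_def
  proof (rule integral_mono')
    show "integrable lborel (\<lambda>x. b1 * indicator {0..1} x + b2 * indicator E x)"
      using E by (intro Bochner_Integration.integrable_add integrable_mult_right integrable_real_indicator) (auto simp: less_top)
  qed (use bound in \<open>auto simp: indicator_def b1_def b2_def\<close>)
  also have "\<dots> = b1 + b2 * measure lborel E"
    using E by (subst Bochner_Integration.integral_add)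
      (auto intro!: integrable_mult_right integrable_real_indicator simp: less_top)
  also have "\<dots> \<le> b1 + b2 * (j * \<eta>)"
    using E(3) by (intro add_left_mono mult_left_mono) (auto simp: b2_def)
  also have "\<dots> \<le> 4 * real j ^ 2 * A\<^sup>2 * ?L\<^sup>2 * \<eta> + 4 * real j ^ 2 * A\<^sup>2 * ?L\<^sup>2 * \<eta>"
  proof (rule add_mono)
    have "\<eta>\<^sup>2 \<le> \<eta>" using \<eta>(1,2) by (simp add: power2_eq_square mult_left_le)
    then have "4 * real j ^ 2 * A\<^sup>2 * ?L\<^sup>2 * \<eta>\<^sup>2 \<le> 4 * real j ^ 2 * A\<^sup>2 * ?L\<^sup>2 * \<eta>"
      by (intro mult_left_mono) auto
    then show "b1 \<le> 4 * real j ^ 2 * A\<^sup>2 * ?L\<^sup>2 * \<eta>" by (simp add: b1_def power_mult_distrib mult_ac)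
    have "1 \<le> ?L\<^sup>2" using L by (rule one_le_power)
    moreover have "real j \<le> real j ^ 2" using j by (simp add: power2_eq_square)
    ultimately have "real j * 1 * (4 * A\<^sup>2 * \<eta>) \<le> real j ^ 2 * ?L\<^sup>2 * (4 * A\<^sup>2 * \<eta>)"
      using \<eta>(1) by (intro mult_right_mono mult_mono) auto
    then show "b2 * (j * \<eta>) \<le> 4 * real j ^ 2 * A\<^sup>2 * ?L\<^sup>2 * \<eta>"
      by (simp add: b2_def power_mult_distrib mult_ac)
  qed
  finally have "(LINT x:{0..1}|lborel. \<bar>?g x\<bar>\<^sup>2) \<le> 8 * real j ^ 2 * A\<^sup>2 * ?L\<^sup>2 * \<eta>" by linarith
  moreover have "0 \<le> (LINT x:{0..1}|lborel. \<bar>?g x\<bar>\<^sup>2)"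
    unfolding set_lebesgue_integral_def by (rule integral_nonneg_AE) auto
  ultimately show ?thesis by (simp add: l2_dist_def l2_norm_def)
qed

text \<open>The centres are members of \<open>S\<close>, one for each label that occurs. Labels are
  only compared and never turned back into points, so rounded data need not satisfy the constraints
  that define \<open>S\<close>.\<close>

lemma covering_number_le_card_labels:
  assumes "finite L" "lab ` S \<subseteq> L" "S \<subseteq> X"
    and "\<And>f g. \<lbrakk>f \<in> S; g \<in> S; lab f = lab g\<rbrakk> \<Longrightarrow> d f g < \<epsilon>"
  shows "covering_number X d \<epsilon> S \<le> enat (card L)"
proof -
  let ?C = "inv_into S lab ` lab ` S"
  have fin: "finite (lab ` S)" using assms(1,2) by (rule finite_subset[rotated])
  have "S \<subseteq> (\<Union>c\<in>?C. {f \<in> X. d c f < \<epsilon>})"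
  proof
    fix f assume f: "f \<in> S"
    then have "lab (inv_into S lab (lab f)) = lab f" "inv_into S lab (lab f) \<in> S"
      by (auto intro: f_inv_into_f inv_into_into)
    then have "d (inv_into S lab (lab f)) f < \<epsilon>" using assms(4) f by blast
    then show "f \<in> (\<Union>c\<in>?C. {f \<in> X. d c f < \<epsilon>})" using f assms(3) by auto
  qed
  moreover have "?C \<subseteq> X" using assms(3) inv_into_into[of _ lab S] by blast
  ultimately have "covering_number X d \<epsilon> S \<le> enat (card ?C)"
    unfolding covering_number_def using fin by (intro INF_lower) auto
  also have "card ?C \<le> card L"
    using card_image_le[OF fin] card_mono[OF assms(1,2)] by (rule order.trans)
  finally show ?thesis by simp
qed

lemma spline_in_l2_functions:
  assumes "k \<in> inner_knots q j" "1 \<le> q" "q \<le> j"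
  shows "spline q j a k \<in> l2_functions"
proof -
  have m: "spline q j a k \<in> borel_measurable lborel" using measurable_spline by simp
  obtain A where A: "\<And>x. x \<in> {0..1} \<Longrightarrow> \<bar>spline q j a k x\<bar> \<le> A"
    using bounded_spline[OF assms, of a] by (fastforce simp: bounded_iff)
  have sq: "\<bar>spline q j a k x\<bar>\<^sup>2 \<le> A\<^sup>2" if "x \<in> {0..1}" for x
    using A[OF that] by (intro power_mono) auto
  have "set_integrable lborel {0..1} (\<lambda>x. \<bar>spline q j a k x\<bar>\<^sup>2)"
    unfolding set_integrable_def
  proof (rule Bochner_Integration.integrable_bound)
    show "integrable lborel (\<lambda>x. A\<^sup>2 * indicator {0..1::real} x)"
      by (intro integrable_mult_right integrable_real_indicator) auto
    show "AE x in lborel. norm (indicator {0..1} x *\<^sub>R \<bar>spline q j a k x\<bar>\<^sup>2) \<le> norm (A\<^sup>2 * indicator {0..1} x)"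
      using sq by (auto simp: indicator_def)
  qed (use m in measurable)
  moreover have "set_borel_measurable lborel {0..1} (spline q j a k)"
    unfolding set_borel_measurable_def using m by measurable
  ultimately show ?thesis by (simp add: l2_functions_def)
qed

lemma floor_divide_eq_imp_close:
  fixes a b :: real
  assumes "\<lfloor>a / \<eta>\<rfloor> = \<lfloor>b / \<eta>\<rfloor>" "0 < \<eta>"
  shows "\<bar>a - b\<bar> \<le> \<eta>"
proof -
  have "\<bar>a / \<eta> - b / \<eta>\<bar> \<le> 1"
    using floor_correct[of "a / \<eta>"] floor_correct[of "b / \<eta>"] unfolding assms(1) by linarith
  then have "\<bar>a - b\<bar> / \<eta> \<le> 1" using assms(2) by (simp add: diff_divide_distrib[symmetric])
  then show ?thesis using assms(2) by simp
qed

lemma floor_divide_mem: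
  fixes a :: real
  assumes "\<bar>a\<bar> \<le> A" "0 < \<eta>"
  shows "\<lfloor>a / \<eta>\<rfloor> \<in> {- \<lceil>A / \<eta>\<rceil>..\<lceil>A / \<eta>\<rceil>}"
proof -
  have "- (A / \<eta>) \<le> a / \<eta>" "a / \<eta> \<le> A / \<eta>"
    using assms by (auto simp: field_simps)
  then have "\<lfloor>- (A / \<eta>)\<rfloor> \<le> \<lfloor>a / \<eta>\<rfloor>" "\<lfloor>a / \<eta>\<rfloor> \<le> \<lfloor>A / \<eta>\<rfloor>" by (auto intro: floor_mono)
  moreover have "\<lfloor>A / \<eta>\<rfloor> \<le> \<lceil>A / \<eta>\<rceil>" by linarith
  ultimately show ?thesis unfolding floor_minus atLeastAtMost_iff by linarith
qed

lemma covering_number_spline_sieve: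
  fixes \<eta> :: real
  assumes q: "1 \<le> q" and \<delta>: "\<And>j. 0 < \<delta> j \<and> \<delta> j \<le> 1" "antimono \<delta>"
    and A: "A = max m 1" and \<eta>: "0 < \<eta>" "\<eta> \<le> 1"
    and \<epsilon>: "0 < \<epsilon>" "8 * real J ^ 2 * A\<^sup>2 * ((8 / (\<delta> J)\<^sup>2) ^ (q - 1))\<^sup>2 * \<eta> < \<epsilon>\<^sup>2"
  shows "covering_number l2_functions l2_dist \<epsilon> (spline_sieve q \<delta> J m)
    \<le> enat (J * nat (2 * \<lceil>A / \<eta>\<rceil> + 1) ^ (2 * J))"
proof -
  let ?S = "spline_sieve q \<delta> J m"
  let ?I = "{- \<lceil>A / \<eta>\<rceil>..\<lceil>A / \<eta>\<rceil>}"
  define L where "L = Sigma {q..J} (\<lambda>j. ({1..j} \<rightarrow>\<^sub>E ?I) \<times> ({1..j - q} \<rightarrow>\<^sub>E ?I))"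
  define P where "P f p \<longleftrightarrow> (case p of (j, \<theta>, k) \<Rightarrow> j \<in> {q..J} \<and> k \<in> sparse_knots q j (\<delta> J) \<and>
    (\<forall>i\<in>{1..j}. \<bar>\<theta> i\<bar> \<le> A) \<and> f = spline q j \<theta> k)" for f p
  \<comment> \<open>A function in the sieve need not determine its dimension, knots and
    coefficients, so the label is read off a chosen representation.\<close>
  define rep where "rep f = (SOME p. P f p)" for f
  define lab where "lab f = (case rep f of (j, \<theta>, k) \<Rightarrow>
    (j, (\<lambda>i\<in>{1..j}. \<lfloor>\<theta> i / \<eta>\<rfloor>), (\<lambda>i\<in>{1..j - q}. \<lfloor>k i / \<eta>\<rfloor>)))" for f
  have P: "P f (rep f)" if f: "f \<in> ?S" for f
  proof -
    obtain j k \<theta> where j: "j \<in> {q..J}" and k: "k \<in> sparse_knots q j (\<delta> j)"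
      and \<theta>: "vec_norm_inf j \<theta> \<le> m" "f = spline q j \<theta> k"
      using f by (auto simp: spline_sieve_def)
    \<comment> \<open>As \<delta> decreases, the separation \<open>\<delta> J\<close> of the largest
      dimension serves for all dimensions at once.\<close>
    have "\<delta> J \<le> \<delta> j" using \<delta>(2) j by (auto intro: antimonoD)
    then have "k \<in> sparse_knots q j (\<delta> J)" using k by (auto simp: sparse_knots_def)
    moreover have "\<bar>\<theta> i\<bar> \<le> A" if "i \<in> {1..j}" for i
      using abs_le_vec_norm_inf[OF that, of \<theta>] \<theta>(1) A by simp
    ultimately have "P f (j, \<theta>, k)" using j \<theta> by (simp add: P_def)
    then show ?thesis unfolding rep_def by (rule someI)
  qed
  have A1: "1 \<le> A" using A by simp
  have fin: "finite L" unfolding L_def by (auto intro!: finite_PiE)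
  have "covering_number l2_functions l2_dist \<epsilon> ?S \<le> enat (card L)"
  proof (rule covering_number_le_card_labels[OF fin])
    show "lab ` ?S \<subseteq> L"
    proof (rule image_subsetI)
      fix f assume f: "f \<in> ?S"
      obtain j \<theta> k where rep: "rep f = (j, \<theta>, k)" by (cases "rep f") auto
      with P[OF f] have p: "j \<in> {q..J}" "k \<in> sparse_knots q j (\<delta> J)" "\<forall>i\<in>{1..j}. \<bar>\<theta> i\<bar> \<le> A"
        by (auto simp: P_def)
      \<comment> \<open>Because \<open>A \<ge> 1\<close>, the range \<open>?I\<close> of rounded
        coefficients also accommodates the rounded knots.\<close>
      have "\<bar>k i\<bar> \<le> A" if "i \<in> {1..j - q}" for i
      proof -
        have "k i \<in> {0<..<1}" using p(2) that by (auto simp: sparse_knots_def inner_knots_def)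
        then show ?thesis using A1 by simp
      qed
      then show "lab f \<in> L" using p floor_divide_mem[OF _ \<eta>(1)] by (auto simp: lab_def rep L_def)
    qed
    show "?S \<subseteq> l2_functions"
      using q by (auto simp: spline_sieve_def sparse_knots_def intro!: spline_in_l2_functions)
    fix f g assume fg: "f \<in> ?S" "g \<in> ?S" "lab f = lab g"
    obtain j \<theta> k where f: "rep f = (j, \<theta>, k)" by (cases "rep f") auto
    obtain j' \<theta>' k' where g: "rep g = (j', \<theta>', k')" by (cases "rep g") auto
    have j': "j' = j" using fg(3) by (simp add: lab_def f g)
    have pf: "j \<in> {q..J}" "k \<in> sparse_knots q j (\<delta> J)" "\<forall>i\<in>{1..j}. \<bar>\<theta> i\<bar> \<le> A" "f = spline q j \<theta> k"
      using P[OF fg(1)] by (auto simp: P_def f)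
    have pg: "k' \<in> sparse_knots q j (\<delta> J)" "\<forall>i\<in>{1..j}. \<bar>\<theta>' i\<bar> \<le> A" "g = spline q j \<theta>' k'"
      using P[OF fg(2)] by (auto simp: P_def g j')
    have l: "(\<lambda>i\<in>{1..j}. \<lfloor>\<theta> i / \<eta>\<rfloor>) = (\<lambda>i\<in>{1..j}. \<lfloor>\<theta>' i / \<eta>\<rfloor>)"
      "(\<lambda>i\<in>{1..j - q}. \<lfloor>k i / \<eta>\<rfloor>) = (\<lambda>i\<in>{1..j - q}. \<lfloor>k' i / \<eta>\<rfloor>)"
      using fg(3) by (auto simp: lab_def f g j')
    have \<theta>: "\<bar>\<theta> i - \<theta>' i\<bar> \<le> \<eta>" if "i \<in> {1..j}" for i
      using fun_cong[OF l(1), of i] that \<eta>(1) by (intro floor_divide_eq_imp_close) auto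
    have k: "\<bar>k i - k' i\<bar> \<le> \<eta>" if "i \<in> {1..j - q}" for i
      using fun_cong[OF l(2), of i] that \<eta>(1) by (intro floor_divide_eq_imp_close) auto
    have "q \<le> j" "0 < \<delta> J" "\<delta> J \<le> 1" using pf(1) \<delta>(1)[of J] by auto
    then have "(l2_dist f g)\<^sup>2 \<le> 8 * real j ^ 2 * A\<^sup>2 * ((8 / (\<delta> J)\<^sup>2) ^ (q - 1))\<^sup>2 * \<eta>"
      unfolding pf(4) pg(3) using pf(3) pg(2)
      by (intro l2_dist_spline_le[OF pf(2) pg(1) q _ _ _ A1 less_imp_le[OF \<eta>(1)] \<eta>(2) k \<theta>]) blast+
    also have "\<dots> \<le> 8 * real J ^ 2 * A\<^sup>2 * ((8 / (\<delta> J)\<^sup>2) ^ (q - 1))\<^sup>2 * \<eta>"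
      using pf(1) \<eta> by (intro mult_right_mono mult_left_mono power_mono) auto
    also have "\<dots> < \<epsilon>\<^sup>2" by (rule \<epsilon>)
    finally show "l2_dist f g < \<epsilon>" using \<epsilon>(1) by (simp add: power2_less_imp_less)
  qed
  also have "card L \<le> J * nat (2 * \<lceil>A / \<eta>\<rceil> + 1) ^ (2 * J)"
  proof -
    let ?N = "nat (2 * \<lceil>A / \<eta>\<rceil> + 1)"
    have "0 < A / \<eta>" using A1 \<eta> by simp
    then have c0: "0 < \<lceil>A / \<eta>\<rceil>" by simp
    then have N: "card ?I = ?N" "1 \<le> ?N" by (simp, linarith)
    have "card L = (\<Sum>j\<in>{q..J}. ?N ^ j * ?N ^ (j - q))"
      unfolding L_def by (subst card_SigmaI) (auto intro!: finite_PiE simp: card_cartesian_product card_PiE N(1))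
    also have "\<dots> \<le> of_nat (card {q..J}) * ?N ^ (2 * J)"
    proof (rule sum_bounded_above)
      fix j assume "j \<in> {q..J}"
      then show "?N ^ j * ?N ^ (j - q) \<le> ?N ^ (2 * J)"
        unfolding power_add[symmetric] using N(2) by (intro power_increasing) auto
    qed
    also have "\<dots> \<le> J * ?N ^ (2 * J)" using q by (intro mult_right_mono) auto
    finally show ?thesis .
  qed
  finally show ?thesis by simp
qed

lemma ln_covering_number_spline_sieve:
  assumes q: "2 \<le> q" and \<delta>: "\<And>j. 0 < \<delta> j \<and> \<delta> j \<le> 1" "antimono \<delta>"
  obtains C where "0 < C" "\<And>J m \<epsilon>. \<lbrakk>q < J; 0 < \<epsilon>; \<epsilon> \<le> 1\<rbrakk> \<Longrightarrow>
    covering_number l2_functions l2_dist \<epsilon> (spline_sieve q \<delta> J m) < \<infinity> \<and>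
    ln (real (the_enat (covering_number l2_functions l2_dist \<epsilon> (spline_sieve q \<delta> J m))))
      \<le> C * (real J * ln (real J * max m 1 / (\<epsilon> * \<delta> J)))"
proof -
  define d where "d = q - 1"
  \<comment> \<open>Dominates the exponents 2, 3, 2 and \<open>4 * d\<close> of \<open>J\<close>,
    \<open>A\<close>, \<open>1 / \<epsilon>\<close> and \<open>1 / D\<close> in the bound for
    \<open>N\<close>.\<close>
  define p where "p = 4 * d + 3"
  \<comment> \<open>\<open>80 = 5 * 16\<close>: there are at most \<open>5 * (A / \<eta>)\<close>
    rounded values, 16 is the constant in \<open>\<eta>\<close>, and \<open>64 ^ d\<close> is the
    numerical part of \<open>\<Lambda>\<^sup>2\<close>.\<close>
  define B where "B = (80 * 64 ^ d :: real)"
  have B: "1 \<le> B" unfolding B_def using one_le_power[of "64::real" d] by linarith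
  define C where "C = 1 + 2 * (ln B + real p)"
  have "0 < C" using B by (simp add: C_def add_pos_nonneg)
  moreover have "covering_number l2_functions l2_dist \<epsilon> (spline_sieve q \<delta> J m) < \<infinity> \<and>
    ln (real (the_enat (covering_number l2_functions l2_dist \<epsilon> (spline_sieve q \<delta> J m))))
      \<le> C * (real J * ln (real J * max m 1 / (\<epsilon> * \<delta> J)))"
    if J: "q < J" and \<epsilon>: "0 < \<epsilon>" "\<epsilon> \<le> 1" for J m \<epsilon>
  proof -
    let ?cov = "covering_number l2_functions l2_dist \<epsilon> (spline_sieve q \<delta> J m)"
    define A where "A = max m 1"
    define D where "D = \<delta> J"
    define \<Lambda> where "\<Lambda> = (8 / D\<^sup>2) ^ d"
    \<comment> \<open>Makes the bound on the squared distance equal to half of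
      \<open>\<epsilon>\<^sup>2\<close>, which gives the strict inequality of open balls.\<close>
    define \<eta> where "\<eta> = \<epsilon>\<^sup>2 / (16 * real J ^ 2 * A\<^sup>2 * \<Lambda>\<^sup>2)"
    define X where "X = real J * A / (\<epsilon> * D)"
    define N where "N = nat (2 * \<lceil>A / \<eta>\<rceil> + 1)"
    have A: "1 \<le> A" by (simp add: A_def)
    have D: "0 < D" "D \<le> 1" using \<delta>(1) by (auto simp: D_def)
    have J3: "3 \<le> real J" using J q by simp
    have "1 \<le> 8 / D\<^sup>2" using D power_le_one[of D 2] by (simp add: field_simps)
    then have \<Lambda>: "1 \<le> \<Lambda>" unfolding \<Lambda>_def by (rule one_le_power)
    have den: "1 \<le> 16 * real J ^ 2 * A\<^sup>2 * \<Lambda>\<^sup>2"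
      using J3 A \<Lambda> by (intro mult_ge1_I one_le_power) auto
    have \<eta>: "0 < \<eta>" "\<eta> \<le> 1"
    proof -
      have "0 < 16 * real J ^ 2 * A\<^sup>2 * \<Lambda>\<^sup>2" using den by linarith
      moreover have "\<epsilon>\<^sup>2 \<le> 16 * real J ^ 2 * A\<^sup>2 * \<Lambda>\<^sup>2"
        using power_le_one[of \<epsilon> 2] \<epsilon> den by linarith
      ultimately show "0 < \<eta>" "\<eta> \<le> 1" using \<epsilon> unfolding \<eta>_def by (simp_all only: divide_le_eq_1_pos) simp
    qed
    have half: "8 * real J ^ 2 * A\<^sup>2 * \<Lambda>\<^sup>2 * \<eta> < \<epsilon>\<^sup>2"
    proof -
      have "16 * real J ^ 2 * A\<^sup>2 * \<Lambda>\<^sup>2 \<noteq> 0" using den by linarith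
      then have "\<eta> * (16 * real J ^ 2 * A\<^sup>2 * \<Lambda>\<^sup>2) = \<epsilon>\<^sup>2"
        unfolding \<eta>_def by (metis nonzero_eq_divide_eq)
      then have "2 * (8 * real J ^ 2 * A\<^sup>2 * \<Lambda>\<^sup>2 * \<eta>) = \<epsilon>\<^sup>2" by (simp add: mult_ac)
      then show ?thesis using zero_less_power[OF \<epsilon>(1), of 2] by linarith
    qed
    have cov: "?cov \<le> enat (J * N ^ (2 * J))"
      unfolding N_def
      by (rule covering_number_spline_sieve[OF _ \<delta> A_def \<eta> \<epsilon>(1)]) (use q half in \<open>auto simp: \<Lambda>_def d_def D_def\<close>)
    have X: "3 \<le> X"
    proof -
      have "\<epsilon> * D \<le> 1 * 1" using \<epsilon> D by (intro mult_mono) auto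
      moreover have "3 * 1 \<le> real J * A" using J3 A by (intro mult_mono) auto
      ultimately have "3 * 1 / 1 \<le> real J * A / (\<epsilon> * D)" using \<epsilon> D by (intro frac_le) auto
      then show ?thesis by (simp add: X_def)
    qed
    \<comment> \<open>From \<open>X \<ge> 3 > exp 1\<close>; it allows the additive constant
      \<open>ln B\<close> to be enlarged to \<open>ln B * ln X\<close>.\<close>
    have lnX: "1 \<le> ln X" using X exp_le by (subst ln_ge_iff) linarith+
    have A\<eta>: "1 \<le> A / \<eta>" using A \<eta> by (simp add: field_simps)
    have N: "1 \<le> real N" "real N \<le> B * X ^ p"
    proof -
      have "0 < \<lceil>A / \<eta>\<rceil>" using A\<eta> by linarith
      then have "real N = 2 * \<lceil>A / \<eta>\<rceil> + 1" "1 \<le> N" unfolding N_def by (simp, linarith)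
      then show "1 \<le> real N" by (simp only: real_of_nat_ge_one_iff)
      have "real N \<le> 2 * (A / \<eta> + 1) + 1"
        unfolding \<open>real N = _\<close> using ceiling_correct[of "A / \<eta>"] by simp
      also have "\<dots> \<le> 5 * (A / \<eta>)" using A\<eta> by simp
      also have "\<dots> = B * (real J ^ 2 * A ^ 3 * (1 / \<epsilon>) ^ 2 * (1 / D) ^ (4 * d))"
      proof -
        have "\<Lambda>\<^sup>2 = ((8 / D\<^sup>2)\<^sup>2) ^ d" unfolding \<Lambda>_def by (simp only: power_mult[symmetric] mult.commute)
        also have "(8 / D\<^sup>2)\<^sup>2 = 64 * (1 / D) ^ 4" by (simp add: power_divide flip: power_mult)
        also have "(64 * (1 / D) ^ 4) ^ d = 64 ^ d * (1 / D) ^ (4 * d)"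
          by (simp only: power_mult_distrib power_mult)
        finally have "\<Lambda>\<^sup>2 = 64 ^ d * (1 / D) ^ (4 * d)" .
        moreover have "5 * (A / \<eta>) = 80 * \<Lambda>\<^sup>2 * (real J ^ 2 * A ^ 3 * (1 / \<epsilon>) ^ 2)"
          by (simp add: \<eta>_def power_divide power2_eq_square power3_eq_cube)
        ultimately show ?thesis by (simp add: B_def mult_ac)
      qed
      also have "\<dots> \<le> B * (real J ^ p * A ^ p * (1 / \<epsilon>) ^ p * (1 / D) ^ p)"
        using B J3 A \<epsilon> D by (intro mult_left_mono mult_mono power_increasing) (auto simp: p_def)
      also have "\<dots> = B * X ^ p" by (simp add: X_def power_mult_distrib power_divide)
      finally show "real N \<le> B * X ^ p" .
    qed
    have JX: "real J \<le> X"
    proof -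
      have "\<epsilon> * D \<le> 1 * 1" using \<epsilon> D by (intro mult_mono) auto
      moreover have "real J * 1 \<le> real J * A" using A by (intro mult_left_mono) auto
      ultimately have "real J * 1 / 1 \<le> real J * A / (\<epsilon> * D)" using \<epsilon> D by (intro frac_le) auto
      then show ?thesis by (simp add: X_def)
    qed
    have "ln (real (the_enat ?cov)) \<le> ln (real (J * N ^ (2 * J)))"
    proof (cases "the_enat ?cov = 0")
      \<comment> \<open>Here the left-hand side is \<open>ln 0\<close>, which is 0, so only the sign
        of the right-hand side matters.\<close>
      case True
      have "1 \<le> J * N ^ (2 * J)" using J N(1) by (simp add: Suc_le_eq)
      then have "0 \<le> ln (real (J * N ^ (2 * J)))" by (intro ln_ge_zero) (simp only: real_of_nat_ge_one_iff)
      then show ?thesis unfolding True by simp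
    next
      case False
      have "the_enat ?cov \<le> J * N ^ (2 * J)" using cov by (cases ?cov) auto
      then show ?thesis using False by (intro ln_mono) (auto simp del: of_nat_mult of_nat_power)
    qed
    also have "\<dots> = ln (real J) + real (2 * J) * ln (real N)"
      using J3 N(1) by (simp add: ln_mult ln_realpow)
    also have "\<dots> \<le> real J * ln X + real (2 * J) * (ln B * ln X + real p * ln X)"
    proof (rule add_mono)
      have "ln (real J) \<le> ln X" using J3 JX by (intro ln_mono) auto
      also have "\<dots> = 1 * ln X" by simp
      also have "\<dots> \<le> real J * ln X" using J3 lnX by (intro mult_right_mono) auto
      finally show "ln (real J) \<le> real J * ln X" .
      have "ln (real N) \<le> ln (B * X ^ p)" using N by (intro ln_mono) auto
      also have "\<dots> = ln B + real p * ln X" using B X by (simp add: ln_mult ln_realpow)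
      also have "ln B \<le> ln B * ln X" using B lnX by (simp add: mult_le_cancel_left1)
      finally show "real (2 * J) * ln (real N) \<le> real (2 * J) * (ln B * ln X + real p * ln X)"
        by (intro mult_left_mono) auto
    qed
    also have "\<dots> = C * (real J * ln X)" by (simp add: C_def algebra_simps)
    finally show ?thesis using cov by (cases ?cov) (auto simp: X_def A_def D_def)
  qed
  ultimately show ?thesis by (rule that)
qed

section \<open>The hierarchical prior\<close>

locale spline_prior =
  fixes q :: nat and \<Omega> :: "'w measure" and J :: "'w \<Rightarrow> nat" and K \<Theta> :: "nat \<Rightarrow> 'w \<Rightarrow> nat \<Rightarrow> real"
  assumes q_ge_1: "1 \<le> q" and prior: "hierarchical_spline_prior q \<Omega> J K \<Theta>"
begin

sublocale prob_space \<Omega>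
  using prior by (simp add: hierarchical_spline_prior_def)

abbreviation knots_M :: "nat \<Rightarrow> (nat \<Rightarrow> real) measure" where
  "knots_M j \<equiv> Pi\<^sub>M {1..j - q} (\<lambda>_. borel)"

abbreviation coeff_M :: "nat \<Rightarrow> (nat \<Rightarrow> real) measure" where
  "coeff_M j \<equiv> Pi\<^sub>M {1..j} (\<lambda>_. borel)"

lemma J_measurable [measurable]: "J \<in> measurable \<Omega> (count_space UNIV)"
  and J_ge: "\<omega> \<in> space \<Omega> \<Longrightarrow> q \<le> J \<omega>"
  and K_measurable: "q \<le> j \<Longrightarrow> K j \<in> measurable \<Omega> (knots_M j)"
  and \<Theta>_measurable: "q \<le> j \<Longrightarrow> \<Theta> j \<in> measurable \<Omega> (coeff_M j)"
  and K_inner_knots: "\<omega> \<in> space \<Omega> \<Longrightarrow> K (J \<omega>) \<omega> \<in> inner_knots q (J \<omega>)"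
  using prior by (auto simp: hierarchical_spline_prior_def)

lemma cond_indep:
  assumes "q \<le> j" "A \<in> sets (knots_M j)" "B \<in> sets (coeff_M j)"
  shows "\<P>(\<omega> in \<Omega>. K j \<omega> \<in> A \<and> \<Theta> j \<omega> \<in> B \<bar> J \<omega> = j) =
    \<P>(\<omega> in \<Omega>. K j \<omega> \<in> A \<bar> J \<omega> = j) * \<P>(\<omega> in \<Omega>. \<Theta> j \<omega> \<in> B \<bar> J \<omega> = j)"
  using prior assms by (simp add: hierarchical_spline_prior_def)

lemma J_event [measurable]: "{\<omega> \<in> space \<Omega>. J \<omega> = j} \<in> sets \<Omega>"
  by measurable

lemma knot_events:
  assumes "q \<le> j"
  shows "{\<omega> \<in> space \<Omega>. sparseness q j (K j \<omega>) < c} \<in> sets \<Omega>"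
    and "{\<omega> \<in> space \<Omega>. mesh_size q j (K j \<omega>) \<le> c} \<in> sets \<Omega>"
proof -
  note [measurable] = measurable_compose[OF K_measurable[OF assms] measurable_mesh_size_sparseness(1)[OF assms]]
    measurable_compose[OF K_measurable[OF assms] measurable_mesh_size_sparseness(2)[OF assms]]
  show "{\<omega> \<in> space \<Omega>. sparseness q j (K j \<omega>) < c} \<in> sets \<Omega>"
    "{\<omega> \<in> space \<Omega>. mesh_size q j (K j \<omega>) \<le> c} \<in> sets \<Omega>" by measurable
qed

lemma \<Theta>_component: "q \<le> j \<Longrightarrow> i \<in> {1..j} \<Longrightarrow> (\<lambda>\<omega>. \<Theta> j \<omega> i) \<in> borel_measurable \<Omega>"
  using measurable_compose[OF \<Theta>_measurable measurable_component_singleton] by blast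

lemma box_event:
  assumes "q \<le> j"
  shows "{\<omega> \<in> space \<Omega>. \<not> (\<forall>i\<in>{1..j}. \<Theta> j \<omega> i \<in> {- m..m})} \<in> sets \<Omega>"
proof -
  have "{\<omega> \<in> space \<Omega>. \<Theta> j \<omega> i \<in> {- m..m}} \<in> sets \<Omega>" if "i \<in> {1..j}" for i
    using measurable_sets_Collect[OF \<Theta>_component[OF assms that], of "\<lambda>x. x \<in> {- m..m}"] by simp
  then have "{\<omega> \<in> space \<Omega>. \<forall>i\<in>{1..j}. \<Theta> j \<omega> i \<in> {- m..m}} \<in> sets \<Omega>"
    by (intro sets.sets_Collect_countable_All') auto
  then show ?thesis by (rule sets.sets_Collect_neg)
qed

lemma random_spline_in_sieve:
  assumes "\<omega> \<in> space \<Omega>" "J \<omega> = j" "j \<le> N" "\<delta> j \<le> sparseness q j (K j \<omega>)"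
    and "\<forall>i\<in>{1..j}. \<Theta> j \<omega> i \<in> {- m..m}"
  shows "random_spline q J K \<Theta> \<omega> \<in> spline_sieve q \<delta> N m"
proof -
  have j: "q \<le> j" using J_ge assms(1,2) by auto
  have "\<Theta> j \<omega> \<in> {1..j} \<rightarrow>\<^sub>E UNIV"
    using measurable_space[OF \<Theta>_measurable[OF j] assms(1)] by (simp add: space_PiM)
  moreover have "vec_norm_inf j (\<Theta> j \<omega>) \<le> m"
    using assms(5) j q_ge_1 by (subst vec_norm_inf_le_iff) auto
  moreover have "K j \<omega> \<in> sparse_knots q j (\<delta> j)"
    using K_inner_knots[OF assms(1)] assms(2,4) by (simp add: sparse_knots_def)
  ultimately show ?thesis
    unfolding spline_sieve_def random_spline_def assms(2) using j assms(3)
    by (intro UN_I[of j] UN_I[of "K j \<omega>"]) auto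
qed

text \<open>Conditional bounds are assumed only where \<open>J = j\<close> has positive probability;
  otherwise both sides are zero.\<close>

lemma prob_conj_le_cond:
  assumes "{\<omega> \<in> space \<Omega>. J \<omega> = j} \<in> sets \<Omega>" "0 \<le> B"
    and "\<P>(\<omega> in \<Omega>. J \<omega> = j) > 0 \<Longrightarrow> \<P>(\<omega> in \<Omega>. P \<omega> \<bar> J \<omega> = j) \<le> B"
  shows "prob {\<omega> \<in> space \<Omega>. P \<omega> \<and> J \<omega> = j} \<le> B * \<P>(\<omega> in \<Omega>. J \<omega> = j)"
proof (cases "\<P>(\<omega> in \<Omega>. J \<omega> = j) > 0")
  case True
  then show ?thesis using assms(3) by (simp add: cond_prob_def divide_le_eq)
next
  case False
  have "prob {\<omega> \<in> space \<Omega>. P \<omega> \<and> J \<omega> = j} \<le> \<P>(\<omega> in \<Omega>. J \<omega> = j)"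
    using assms(1) by (intro finite_measure_mono) auto
  also have "\<dots> = 0" using False by (simp add: zero_less_measure_iff)
  finally show ?thesis using assms(2) by (simp add: measure_le_0_iff)
qed

text \<open>Membership in the sieve asks for some representation with separated knots and bounded
  coefficients, not for the one that was drawn, so the event is not visibly measurable. It is
  enclosed in a measurable event about the drawn dimension, knots and coefficients.\<close>

lemma outer_measure_not_in_sieve:
  assumes P3: "\<And>j. q \<le> j \<Longrightarrow> \<P>(\<omega> in \<Omega>. J \<omega> = j) > 0 \<Longrightarrow>
      \<P>(\<omega> in \<Omega>. sparseness q j (K j \<omega>) < \<delta> j \<bar> J \<omega> = j) = 0"
    and B: "0 \<le> B" "\<And>j. q \<le> j \<Longrightarrow> j \<le> N \<Longrightarrow> \<P>(\<omega> in \<Omega>. J \<omega> = j) > 0 \<Longrightarrow>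
      \<P>(\<omega> in \<Omega>. \<not> (\<forall>i\<in>{1..j}. \<Theta> j \<omega> i \<in> {- m..m}) \<bar> J \<omega> = j) \<le> B"
  shows "outer_measure_of \<Omega> {\<omega> \<in> space \<Omega>. random_spline q J K \<Theta> \<omega> \<notin> spline_sieve q \<delta> N m}
    \<le> ennreal (\<P>(\<omega> in \<Omega>. N < J \<omega>) + B)"
proof -
  define S where "S j = {\<omega> \<in> space \<Omega>. sparseness q j (K j \<omega>) < \<delta> j \<and> J \<omega> = j}" for j
  define T where "T j = {\<omega> \<in> space \<Omega>. \<not> (\<forall>i\<in>{1..j}. \<Theta> j \<omega> i \<in> {- m..m}) \<and> J \<omega> = j}" for j
  define R where "R = {\<omega> \<in> space \<Omega>. N < J \<omega>}"
  have R [measurable]: "R \<in> sets \<Omega>" unfolding R_def by measurable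
  have S: "S j \<in> sets \<Omega>" and T: "T j \<in> sets \<Omega>" if "q \<le> j" for j
    unfolding S_def T_def using knot_events(1)[OF that] box_event[OF that] J_event
    by (auto intro: sets.sets_Collect_conj)
  have ST: "(\<Union>j\<in>{q..N}. S j \<union> T j) \<in> sets \<Omega>" using S T by auto
  have "{\<omega> \<in> space \<Omega>. random_spline q J K \<Theta> \<omega> \<notin> spline_sieve q \<delta> N m} \<subseteq> R \<union> (\<Union>j\<in>{q..N}. S j \<union> T j)"
  proof
    fix \<omega> assume "\<omega> \<in> {\<omega> \<in> space \<Omega>. random_spline q J K \<Theta> \<omega> \<notin> spline_sieve q \<delta> N m}"
    then have \<omega>: "\<omega> \<in> space \<Omega>" "random_spline q J K \<Theta> \<omega> \<notin> spline_sieve q \<delta> N m" by auto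
    have "J \<omega> \<in> {q..N} \<and> \<omega> \<in> S (J \<omega>) \<union> T (J \<omega>)" if "\<omega> \<notin> R"
    proof -
      have "J \<omega> \<le> N" using that \<omega>(1) by (simp add: R_def)
      moreover have "\<omega> \<in> S (J \<omega>) \<union> T (J \<omega>)"
      proof (rule ccontr)
        assume "\<omega> \<notin> S (J \<omega>) \<union> T (J \<omega>)"
        then have "\<delta> (J \<omega>) \<le> sparseness q (J \<omega>) (K (J \<omega>) \<omega>)"
          "\<forall>i\<in>{1..J \<omega>}. \<Theta> (J \<omega>) \<omega> i \<in> {- m..m}"
          using \<omega>(1) by (simp_all add: S_def T_def not_less)
        from random_spline_in_sieve[where \<delta> = \<delta>, OF \<omega>(1) refl \<open>J \<omega> \<le> N\<close> this] \<omega>(2) show False by simp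
      qed
      ultimately show ?thesis using J_ge[OF \<omega>(1)] by simp
    qed
    then show "\<omega> \<in> R \<union> (\<Union>j\<in>{q..N}. S j \<union> T j)" by blast
  qed
  then have "outer_measure_of \<Omega> {\<omega> \<in> space \<Omega>. random_spline q J K \<Theta> \<omega> \<notin> spline_sieve q \<delta> N m}
    \<le> emeasure \<Omega> (R \<union> (\<Union>j\<in>{q..N}. S j \<union> T j))"
    unfolding outer_measure_of_def using R ST by (intro INF_lower) auto
  also have "\<dots> = ennreal (prob (R \<union> (\<Union>j\<in>{q..N}. S j \<union> T j)))" by (rule emeasure_eq_measure)
  also have "\<dots> \<le> ennreal (prob R + B)"
  proof (rule ennreal_leI)
    have "prob (R \<union> (\<Union>j\<in>{q..N}. S j \<union> T j)) \<le> prob R + prob (\<Union>j\<in>{q..N}. S j \<union> T j)"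
      using R ST by (rule measure_Un_le)
    also have "prob (\<Union>j\<in>{q..N}. S j \<union> T j) \<le> (\<Sum>j\<in>{q..N}. prob (S j \<union> T j))"
      using S T by (intro measure_UNION_le) auto
    \<comment> \<open>Keeping the weights \<open>\<P>(\<omega> in \<Omega>. J \<omega> = j)\<close>,
      which sum to at most one, makes \<open>B\<close> appear once instead of once for each
      dimension.\<close>
    also have "\<dots> \<le> (\<Sum>j\<in>{q..N}. B * \<P>(\<omega> in \<Omega>. J \<omega> = j))"
    proof (rule sum_mono)
      fix j assume "j \<in> {q..N}"
      then have j: "q \<le> j" "j \<le> N" by auto
      have "prob (S j) \<le> 0 * \<P>(\<omega> in \<Omega>. J \<omega> = j)"
        unfolding S_def by (rule prob_conj_le_cond) (use P3[OF j(1)] in auto)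
      moreover have "prob (T j) \<le> B * \<P>(\<omega> in \<Omega>. J \<omega> = j)"
        unfolding T_def by (rule prob_conj_le_cond) (use B(1) B(2)[OF j] in auto)
      ultimately show "prob (S j \<union> T j) \<le> B * \<P>(\<omega> in \<Omega>. J \<omega> = j)"
        using measure_Un_le[OF S[OF j(1)] T[OF j(1)]] by linarith
    qed
    also have "\<dots> = B * prob (\<Union>j\<in>{q..N}. {\<omega> \<in> space \<Omega>. J \<omega> = j})"
      unfolding sum_distrib_left[symmetric]
      by (subst finite_measure_finite_Union) (auto simp: disjoint_family_on_def)
    also have "\<dots> \<le> B * 1" using B(1) by (intro mult_left_mono) auto
    finally show "prob (R \<union> (\<Union>j\<in>{q..N}. S j \<union> T j)) \<le> prob R + B" by simp
  qed
  finally show ?thesis unfolding R_def .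
qed

text \<open>Rational points make this a countable intersection of measurable conditions on the pair
  of knots and coefficients; for right-continuous \<open>f\<close> nothing is lost.\<close>

definition near :: "nat \<Rightarrow> (real \<Rightarrow> real) \<Rightarrow> real \<Rightarrow> ((nat \<Rightarrow> real) \<times> (nat \<Rightarrow> real)) set" where
  "near j f c = {p \<in> space (knots_M j \<Otimes>\<^sub>M coeff_M j).
     \<forall>x\<in>{0..1} \<inter> \<rat>. \<bar>spline q j (snd p) (fst p) x - f x\<bar> \<le> c}"

lemma near_sets:
  assumes "q \<le> j"
  shows "near j f c \<in> sets (knots_M j \<Otimes>\<^sub>M coeff_M j)"
  unfolding near_def
proof (rule sets.sets_Collect_countable_All')
  show "countable ({0..1} \<inter> \<rat> :: real set)" by (intro countable_Int2 countable_rat)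
  fix x
  have [measurable]: "(\<lambda>p. spline q j (snd p) (fst p) x) \<in> borel_measurable (knots_M j \<Otimes>\<^sub>M coeff_M j)"
    using measurable_spline_pair[OF assms] by (simp add: case_prod_beta')
  show "{p \<in> space (knots_M j \<Otimes>\<^sub>M coeff_M j). \<bar>spline q j (snd p) (fst p) x - f x\<bar> \<le> c}
    \<in> sets (knots_M j \<Otimes>\<^sub>M coeff_M j)" by measurable
qed

context
  fixes f :: "real \<Rightarrow> real"
  assumes f_bounded: "bounded (f ` {0..1})"
    and f_right: "\<And>x. 0 \<le> x \<Longrightarrow> x < 1 \<Longrightarrow> (f \<longlongrightarrow> f x) (at_right x)"
begin

lemma near_iff:
  assumes "q \<le> j" "k \<in> inner_knots q j" "(k, \<theta>) \<in> space (knots_M j \<Otimes>\<^sub>M coeff_M j)"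
  shows "(k, \<theta>) \<in> near j f c \<longleftrightarrow> (\<forall>x\<in>{0..1}. \<bar>spline q j \<theta> k x - f x\<bar> \<le> c)"
proof -
  have "(\<forall>x\<in>{0..1}. \<bar>spline q j \<theta> k x - f x\<bar> \<le> c) \<longleftrightarrow>
    (\<forall>x\<in>{0..1} \<inter> \<rat>. \<bar>spline q j \<theta> k x - f x\<bar> \<le> c)"
    using f_right by (intro abs_le_on_rationals tendsto_diff spline_right_continuous)
  then show ?thesis using assms(3) by (simp add: near_def)
qed

lemma sup_norm_random_spline_le_iff:
  assumes "\<omega> \<in> space \<Omega>"
  shows "sup_norm (\<lambda>x. random_spline q J K \<Theta> \<omega> x - f x) \<le> c \<longleftrightarrow>
    (K (J \<omega>) \<omega>, \<Theta> (J \<omega>) \<omega>) \<in> near (J \<omega>) f c"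
proof -
  have "(K (J \<omega>) \<omega>, \<Theta> (J \<omega>) \<omega>) \<in> space (knots_M (J \<omega>) \<Otimes>\<^sub>M coeff_M (J \<omega>))"
    using measurable_space[OF K_measurable assms] measurable_space[OF \<Theta>_measurable assms] J_ge[OF assms]
    by (simp add: space_pair_measure)
  moreover have "bounded ((\<lambda>x. spline q (J \<omega>) (\<Theta> (J \<omega>) \<omega>) (K (J \<omega>) \<omega>) x - f x) ` {0..1})"
    using bounded_spline[OF K_inner_knots[OF assms] q_ge_1 J_ge[OF assms]] f_bounded
    by (rule bounded_minus_comp)
  ultimately show ?thesis
    using near_iff[OF J_ge[OF assms] K_inner_knots[OF assms]] sup_norm_le_iff
    unfolding random_spline_def by blast
qed

lemma sup_norm_event: "{\<omega> \<in> space \<Omega>. sup_norm (\<lambda>x. random_spline q J K \<Theta> \<omega> x - f x) \<le> c} \<in> sets \<Omega>"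
proof -
  have "{\<omega> \<in> space \<Omega>. sup_norm (\<lambda>x. random_spline q J K \<Theta> \<omega> x - f x) \<le> c} =
    (\<Union>j\<in>{q..}. ((\<lambda>\<omega>. (K j \<omega>, \<Theta> j \<omega>)) -` near j f c \<inter> space \<Omega>) \<inter> {\<omega> \<in> space \<Omega>. J \<omega> = j})"
    using sup_norm_random_spline_le_iff J_ge by auto
  also have "\<dots> \<in> sets \<Omega>"
    using near_sets K_measurable \<Theta>_measurable
    by (intro sets.countable_UN' sets.Int J_event measurable_sets[OF measurable_Pair]) auto
  finally show ?thesis .
qed

text \<open>The approximating coefficients \<open>a\<close> depend on the knots; integrating over the knots first
  (they are independent of the coefficients given \<open>J = j\<close>) avoids selecting them measurably.\<close>

lemma prob_random_spline_near:
  assumes j: "q \<le> j" "\<P>(\<omega> in \<Omega>. J \<omega> = j) > 0" and p: "0 \<le> p"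
    and approx: "\<And>k. \<lbrakk>k \<in> inner_knots q j; mesh_size q j k \<le> h\<rbrakk> \<Longrightarrow>
      \<exists>a. (\<forall>x\<in>{0..1}. \<bar>f x - spline q j a k x\<bar> \<le> e1) \<and>
        p \<le> \<P>(\<omega> in \<Omega>. vec_norm_inf j (\<lambda>i. \<Theta> j \<omega> i - a i) \<le> e2 \<bar> J \<omega> = j)"
  shows "\<P>(\<omega> in \<Omega>. J \<omega> = j) * (\<P>(\<omega> in \<Omega>. mesh_size q j (K j \<omega>) \<le> h \<bar> J \<omega> = j) * p)
    \<le> \<P>(\<omega> in \<Omega>. sup_norm (\<lambda>x. random_spline q J K \<Theta> \<omega> x - f x) \<le> e1 + e2)"
proof -
  define A where "A = {\<omega> \<in> space \<Omega>. J \<omega> = j}"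
  \<comment> \<open>The conditional law given \<open>J = j\<close>, under which independence of
    knots and coefficients is available.\<close>
  define U where "U = uniform_measure \<Omega> A"
  have A: "A \<in> sets \<Omega>" "0 < prob A" using j(2) by (auto simp: A_def)
  have j1: "1 \<le> j" using j q_ge_1 by simp
  interpret U: prob_space U
    unfolding U_def using A by (intro prob_space_uniform_measure) (auto simp: emeasure_eq_measure)
  have sp [simp]: "space U = space \<Omega>" and se [measurable_cong]: "sets U = sets \<Omega>" by (auto simp: U_def)
  have U_prob: "U.prob {\<omega> \<in> space \<Omega>. P \<omega>} = \<P>(\<omega> in \<Omega>. P \<omega> \<bar> J \<omega> = j)"
    if "{\<omega> \<in> space \<Omega>. P \<omega>} \<in> sets \<Omega>" for P
  proof -
    have "A \<inter> {\<omega> \<in> space \<Omega>. P \<omega>} = {\<omega> \<in> space \<Omega>. P \<omega> \<and> J \<omega> = j}" by (auto simp: A_def)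
    then show ?thesis unfolding U_def cond_prob_def using A that
      by (subst measure_uniform_measure) (auto simp: emeasure_eq_measure A_def)
  qed
  have K [measurable]: "K j \<in> measurable U (knots_M j)" and \<Theta> [measurable]: "\<Theta> j \<in> measurable U (coeff_M j)"
    using K_measurable[OF j(1)] \<Theta>_measurable[OF j(1)] by (simp_all cong: measurable_cong_sets add: se)
  define DK where "DK = distr U (knots_M j) (K j)"
  define D\<Theta> where "D\<Theta> = distr U (coeff_M j) (\<Theta> j)"
  interpret DK: prob_space DK unfolding DK_def by (rule U.prob_space_distr) (rule K)
  interpret D\<Theta>: prob_space D\<Theta> unfolding D\<Theta>_def by (rule U.prob_space_distr) (rule \<Theta>)
  \<comment> \<open>Conditional independence gives the product formula on rectangles, hence the
    joint law is a product, and the section over each knot vector can be treated separately.\<close>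
  have joint: "DK \<Otimes>\<^sub>M D\<Theta> = distr U (knots_M j \<Otimes>\<^sub>M coeff_M j) (\<lambda>\<omega>. (K j \<omega>, \<Theta> j \<omega>))"
  proof (rule pair_measure_eqI)
    show "sigma_finite_measure DK" "sigma_finite_measure D\<Theta>" by unfold_locales
    show "sets (DK \<Otimes>\<^sub>M D\<Theta>) = sets (distr U (knots_M j \<Otimes>\<^sub>M coeff_M j) (\<lambda>\<omega>. (K j \<omega>, \<Theta> j \<omega>)))"
      by (simp add: DK_def D\<Theta>_def cong: sets_pair_measure_cong)
    fix X Y assume "X \<in> sets DK" "Y \<in> sets D\<Theta>"
    then have X: "X \<in> sets (knots_M j)" and Y: "Y \<in> sets (coeff_M j)" by (auto simp: DK_def D\<Theta>_def)
    have ev: "{\<omega> \<in> space \<Omega>. K j \<omega> \<in> X} \<in> sets \<Omega>" "{\<omega> \<in> space \<Omega>. \<Theta> j \<omega> \<in> Y} \<in> sets \<Omega>"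
      using measurable_sets[OF K_measurable[OF j(1)] X] measurable_sets[OF \<Theta>_measurable[OF j(1)] Y]
      by (auto simp: vimage_def Int_def conj_commute)
    have indep: "U.prob {\<omega> \<in> space \<Omega>. K j \<omega> \<in> X \<and> \<Theta> j \<omega> \<in> Y} =
      U.prob {\<omega> \<in> space \<Omega>. K j \<omega> \<in> X} * U.prob {\<omega> \<in> space \<Omega>. \<Theta> j \<omega> \<in> Y}"
      using cond_indep[OF j(1) X Y] ev sets.sets_Collect_conj[OF ev] by (simp add: U_prob)
    have "emeasure DK X = ennreal (U.prob {\<omega> \<in> space \<Omega>. K j \<omega> \<in> X})"
      unfolding DK_def using X by (subst emeasure_distr[OF K]) (auto simp: U.emeasure_eq_measure vimage_def Int_def conj_commute)
    moreover have "emeasure D\<Theta> Y = ennreal (U.prob {\<omega> \<in> space \<Omega>. \<Theta> j \<omega> \<in> Y})"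
      unfolding D\<Theta>_def using Y by (subst emeasure_distr[OF \<Theta>]) (auto simp: U.emeasure_eq_measure vimage_def Int_def conj_commute)
    moreover have "emeasure (distr U (knots_M j \<Otimes>\<^sub>M coeff_M j) (\<lambda>\<omega>. (K j \<omega>, \<Theta> j \<omega>))) (X \<times> Y) =
      ennreal (U.prob {\<omega> \<in> space \<Omega>. K j \<omega> \<in> X \<and> \<Theta> j \<omega> \<in> Y})"
      using X Y by (subst emeasure_distr[OF measurable_Pair[OF K \<Theta>]]) (auto simp: U.emeasure_eq_measure vimage_def Int_def conj_commute)
    ultimately show "emeasure DK X * emeasure D\<Theta> Y =
      emeasure (distr U (knots_M j \<Otimes>\<^sub>M coeff_M j) (\<lambda>\<omega>. (K j \<omega>, \<Theta> j \<omega>))) (X \<times> Y)"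
      using indep by (simp only: ennreal_mult measure_nonneg)
  qed
  let ?E = "near j f (e1 + e2)"
  have E: "?E \<in> sets (DK \<Otimes>\<^sub>M D\<Theta>)"
    using near_sets[OF j(1)] by (simp add: DK_def D\<Theta>_def cong: sets_pair_measure_cong)
  have mesh: "{\<omega> \<in> space \<Omega>. mesh_size q j (K j \<omega>) \<le> h} \<in> sets \<Omega>" by (rule knot_events[OF j(1)])
  have "ennreal (p * U.prob {\<omega> \<in> space \<Omega>. mesh_size q j (K j \<omega>) \<le> h}) =
    (\<integral>\<^sup>+ \<omega>. ennreal p * indicator {\<omega> \<in> space \<Omega>. mesh_size q j (K j \<omega>) \<le> h} \<omega> \<partial>U)"
    using mesh p by (subst nn_integral_cmult_indicator) (auto simp: se U.emeasure_eq_measure ennreal_mult')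
  also have "\<dots> \<le> (\<integral>\<^sup>+ \<omega>. emeasure D\<Theta> (Pair (K j \<omega>) -` ?E) \<partial>U)"
  proof (rule nn_integral_mono_AE)
    \<comment> \<open>The estimate is made on \<open>A\<close>, where the values of
      \<open>K j\<close> are known to be inner knots; this suffices because \<open>U\<close> is
      concentrated on \<open>A\<close>. For fine knots, the section of \<open>?E\<close> contains
      the ball of radius \<open>e2\<close> around the coefficients \<open>a\<close> that belong to
      these knots.\<close>
    have "ennreal p * indicator {\<omega> \<in> space \<Omega>. mesh_size q j (K j \<omega>) \<le> h} \<omega> \<le> emeasure D\<Theta> (Pair (K j \<omega>) -` ?E)"
      if \<omega>: "\<omega> \<in> A" for \<omega>
    proof (cases "mesh_size q j (K j \<omega>) \<le> h")
      case True
      have k: "K j \<omega> \<in> inner_knots q j" "K j \<omega> \<in> space (knots_M j)"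
        using \<omega> K_inner_knots[of \<omega>] measurable_space[OF K_measurable[OF j(1)]] by (auto simp: A_def)
      obtain a where a: "\<And>x. x \<in> {0..1} \<Longrightarrow> \<bar>f x - spline q j a (K j \<omega>) x\<bar> \<le> e1"
        "p \<le> \<P>(\<omega> in \<Omega>. vec_norm_inf j (\<lambda>i. \<Theta> j \<omega> i - a i) \<le> e2 \<bar> J \<omega> = j)"
        using approx[OF k(1) True] by blast
      let ?V = "{\<theta> \<in> space (coeff_M j). vec_norm_inf j (\<lambda>i. \<theta> i - a i) \<le> e2}"
      have V: "?V \<in> sets (coeff_M j)" using measurable_vec_norm_inf[OF j1, of a] by measurable
      have "{\<omega> \<in> space \<Omega>. vec_norm_inf j (\<lambda>i. \<Theta> j \<omega> i - a i) \<le> e2} = \<Theta> j -` ?V \<inter> space \<Omega>"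
        using measurable_space[OF \<Theta>_measurable[OF j(1)]] by auto
      then have "ennreal p \<le> ennreal (U.prob (\<Theta> j -` ?V \<inter> space \<Omega>))"
        using a(2) U_prob[of "\<lambda>\<omega>. vec_norm_inf j (\<lambda>i. \<Theta> j \<omega> i - a i) \<le> e2"] measurable_sets[OF \<Theta>_measurable[OF j(1)] V]
        by (intro ennreal_leI) simp
      also have "\<dots> = emeasure D\<Theta> ?V"
        unfolding D\<Theta>_def using V by (subst emeasure_distr[OF \<Theta>]) (auto simp: U.emeasure_eq_measure)
      also have "\<dots> \<le> emeasure D\<Theta> (Pair (K j \<omega>) -` ?E)"
      proof (rule emeasure_mono)
        show "Pair (K j \<omega>) -` ?E \<in> sets D\<Theta>" using E by (rule sets_Pair1)
        show "?V \<subseteq> Pair (K j \<omega>) -` ?E"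
        proof
          fix \<theta> assume \<theta>: "\<theta> \<in> ?V"
          have "\<bar>spline q j \<theta> (K j \<omega>) x - f x\<bar> \<le> e1 + e2" if x: "x \<in> {0..1}" for x
          proof -
            have "\<bar>spline q j \<theta> (K j \<omega>) x - spline q j a (K j \<omega>) x\<bar> \<le> e2"
              unfolding spline_diff_coeff
              using \<theta> vec_norm_inf_le_iff[OF j1] by (intro abs_spline_le[OF k(1) q_ge_1 j(1) x]) auto
            then show ?thesis using a(1)[OF x] by linarith
          qed
          then show "\<theta> \<in> Pair (K j \<omega>) -` ?E"
            using \<theta> k near_iff[OF j(1) k(1)] by (simp add: space_pair_measure)
        qed
      qed
      finally show ?thesis using True by (simp add: indicator_def)
    qed (simp add: indicator_def)
    then show "AE \<omega> in U. ennreal p * indicator {\<omega> \<in> space \<Omega>. mesh_size q j (K j \<omega>) \<le> h} \<omega>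
      \<le> emeasure D\<Theta> (Pair (K j \<omega>) -` ?E)"
      unfolding U_def by (intro AE_uniform_measureI[OF A(1)]) auto
  qed
  also have "\<dots> = (\<integral>\<^sup>+ k. emeasure D\<Theta> (Pair k -` ?E) \<partial>DK)"
    unfolding DK_def using D\<Theta>.measurable_emeasure_Pair[OF E]
    by (subst nn_integral_distr[OF K]) (auto simp: DK_def)
  also have "\<dots> = emeasure (DK \<Otimes>\<^sub>M D\<Theta>) ?E" by (rule D\<Theta>.emeasure_pair_measure_alt[symmetric, OF E])
  also have "\<dots> = ennreal (U.prob {\<omega> \<in> space \<Omega>. (K j \<omega>, \<Theta> j \<omega>) \<in> ?E})"
    unfolding joint using near_sets[OF j(1), of f "e1 + e2"]
    by (subst emeasure_distr[OF measurable_Pair[OF K \<Theta>]]) (auto simp: U.emeasure_eq_measure vimage_def Int_def conj_commute)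
  finally have "p * U.prob {\<omega> \<in> space \<Omega>. mesh_size q j (K j \<omega>) \<le> h} \<le>
    U.prob {\<omega> \<in> space \<Omega>. (K j \<omega>, \<Theta> j \<omega>) \<in> ?E}" by simp
  moreover have "{\<omega> \<in> space \<Omega>. (K j \<omega>, \<Theta> j \<omega>) \<in> ?E} \<in> sets \<Omega>"
    using measurable_sets[OF measurable_Pair[OF K_measurable[OF j(1)] \<Theta>_measurable[OF j(1)]] near_sets[OF j(1)]]
    by (auto simp: vimage_def Int_def conj_commute)
  ultimately have "\<P>(\<omega> in \<Omega>. mesh_size q j (K j \<omega>) \<le> h \<bar> J \<omega> = j) * p
    \<le> \<P>(\<omega> in \<Omega>. (K j \<omega>, \<Theta> j \<omega>) \<in> ?E \<bar> J \<omega> = j)" using mesh by (simp add: U_prob mult.commute)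
  then have "\<P>(\<omega> in \<Omega>. J \<omega> = j) * (\<P>(\<omega> in \<Omega>. mesh_size q j (K j \<omega>) \<le> h \<bar> J \<omega> = j) * p)
    \<le> \<P>(\<omega> in \<Omega>. (K j \<omega>, \<Theta> j \<omega>) \<in> ?E \<and> J \<omega> = j)"
    using j(2) by (subst (asm) (2) cond_prob_def) (simp add: le_divide_eq mult.commute)
  also have "\<dots> \<le> \<P>(\<omega> in \<Omega>. sup_norm (\<lambda>x. random_spline q J K \<Theta> \<omega> x - f x) \<le> e1 + e2)"
    using sup_norm_random_spline_le_iff by (intro finite_measure_mono sup_norm_event) auto
  finally show ?thesis .
qed

end
end

section \<open>Prior mass of small balls\<close>

text \<open>The room \<open>M - sup_norm f\<close> eventually exceeds \<open>D\<close> times the sum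
  of approximation error and Hoelder oscillation, both of which vanish with the mesh. The
  coefficients are estimated at the mesh size itself; the error is then relaxed to
  \<open>h\<close>.\<close>

lemma spline_approx_bounded_coeffs:
  assumes q: "1 \<le> q" and \<alpha>: "0 < \<alpha>" and C: "0 < C" "spline_approx_const q \<alpha> f C"
    and holder: "0 < \<kappa>" "0 < L" "\<And>x y. \<lbrakk>x \<in> {0..1}; y \<in> {0..1}\<rbrakk> \<Longrightarrow> \<bar>f x - f y\<bar> \<le> L * \<bar>x - y\<bar> powr \<kappa>"
    and f: "bounded (f ` {0..1})" "sup_norm f < M"
  obtains h0 where "0 < h0" "\<And>j k h. \<lbrakk>q \<le> j; k \<in> inner_knots q j; mesh_size q j k \<le> h; h < h0\<rbrakk> \<Longrightarrow>
    \<exists>a\<in>{1..j} \<rightarrow>\<^sub>E UNIV. (\<forall>x\<in>{0..1}. \<bar>f x - spline q j a k x\<bar> \<le> C * h powr \<alpha>) \<and> vec_norm_inf j a \<le> M"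
proof -
  obtain D where D: "\<And>j k a i f e w A. \<lbrakk>q \<le> j; k \<in> inner_knots q j; i \<in> {1..j};
      \<And>x. x \<in> {0..1} \<Longrightarrow> \<bar>f x - spline q j a k x\<bar> \<le> e; \<And>x. x \<in> {0..1} \<Longrightarrow> \<bar>f x\<bar> \<le> A;
      \<And>x y. \<lbrakk>x \<in> {0..1}; y \<in> {0..1}; \<bar>x - y\<bar> \<le> mesh_size q j k\<rbrakk> \<Longrightarrow> \<bar>f x - f y\<bar> \<le> w\<rbrakk>
    \<Longrightarrow> \<bar>a i\<bar> \<le> A + D * (e + w)"
    using spline_coeff_bound[OF q] by blast
  have "((\<lambda>h. sup_norm f + D * (C * h powr \<alpha> + L * h powr \<kappa>)) \<longlongrightarrow> sup_norm f + D * (C * 0 + L * 0)) (at_right 0)"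
  proof (intro tendsto_intros)
    show "((\<lambda>h. h powr \<alpha>) \<longlongrightarrow> 0) (at_right (0::real))" using \<alpha> by real_asymp
    show "((\<lambda>h. h powr \<kappa>) \<longlongrightarrow> 0) (at_right (0::real))" using holder(1) by real_asymp
  qed
  then have "((\<lambda>h. sup_norm f + D * (C * h powr \<alpha> + L * h powr \<kappa>)) \<longlongrightarrow> sup_norm f) (at_right 0)" by simp
  from order_tendstoD(2)[OF this f(2)] obtain h0 where h0: "0 < h0"
    "\<And>h. 0 < h \<Longrightarrow> h < h0 \<Longrightarrow> sup_norm f + D * (C * h powr \<alpha> + L * h powr \<kappa>) < M"
    unfolding eventually_at_right[OF zero_less_one] by blast
  have A: "\<bar>f x\<bar> \<le> sup_norm f" if "x \<in> {0..1}" for x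
    using sup_norm_le_iff[OF f(1), of "sup_norm f"] that by blast
  show ?thesis
  proof (rule that[OF h0(1)])
    fix j k h
    assume j: "q \<le> j" and k: "k \<in> inner_knots q j" and h: "mesh_size q j k \<le> h" "h < h0"
    let ?m = "mesh_size q j k"
    have "0 < \<bar>full_knots q j k 1 - full_knots q j k (1 - 1)\<bar>"
      using full_knots_less[OF k j, of 0 1] j by simp
    also have "\<dots> \<le> ?m" by (rule knot_interval_le_mesh_size) (use j in auto)
    finally have m: "0 < ?m" .
    obtain a where a: "a \<in> {1..j} \<rightarrow>\<^sub>E UNIV" "sup_norm (\<lambda>x. f x - spline q j a k x) \<le> C * ?m powr \<alpha>"
      using C(2) j k unfolding spline_approx_const_def by blast
    have "bounded ((\<lambda>x. f x - spline q j a k x) ` {0..1})"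
      by (intro bounded_minus_comp f(1) bounded_spline[OF k q j])
    then have e: "\<bar>f x - spline q j a k x\<bar> \<le> C * ?m powr \<alpha>" if "x \<in> {0..1}" for x
      using a(2) sup_norm_le_iff that by blast
    have w: "\<bar>f x - f y\<bar> \<le> L * ?m powr \<kappa>" if "x \<in> {0..1}" "y \<in> {0..1}" "\<bar>x - y\<bar> \<le> ?m" for x y
    proof -
      have "\<bar>f x - f y\<bar> \<le> L * \<bar>x - y\<bar> powr \<kappa>" using holder(3) that by blast
      also have "\<dots> \<le> L * ?m powr \<kappa>" using holder that by (intro mult_left_mono powr_mono2) auto
      finally show ?thesis .
    qed
    have "\<bar>a i\<bar> \<le> M" if "i \<in> {1..j}" for i
      using D[OF j k that e A w] h0(2)[OF m] h by linarith
    then have "vec_norm_inf j a \<le> M" using q j by (subst vec_norm_inf_le_iff) auto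
    moreover have "C * ?m powr \<alpha> \<le> C * h powr \<alpha>" using C(1) \<alpha> m h by (intro mult_left_mono powr_mono2) auto
    then have "\<forall>x\<in>{0..1}. \<bar>f x - spline q j a k x\<bar> \<le> C * h powr \<alpha>" using e by force
    ultimately show "\<exists>a\<in>{1..j} \<rightarrow>\<^sub>E UNIV.
      (\<forall>x\<in>{0..1}. \<bar>f x - spline q j a k x\<bar> \<le> C * h powr \<alpha>) \<and> vec_norm_inf j a \<le> M"
      using a(1) by blast
  qed
qed

text \<open>The quadratic Taylor bound for \<open>exp (u / 2)\<close> already lies above
  \<open>u\<close>, since the difference has negative discriminant. It will give
  \<open>u * r < 1\<close> for \<open>r = exp (- u / 2)\<close>, whatever the smoothness.\<close>

lemma times_exp_half_less_one: "u * exp (- u / 2) < (1::real)" if "0 < u"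
proof -
  have "0 < ((u - 2)\<^sup>2 + 4) / 8" by (simp add: add_nonneg_pos)
  also have "\<dots> = 1 + u / 2 + (u / 2)\<^sup>2 / 2 - u" by (simp add: power2_eq_square field_simps)
  finally have "u < 1 + u / 2 + (u / 2)\<^sup>2 / 2" by simp
  also have "\<dots> \<le> exp (u / 2)" using that by (intro exp_lower_Taylor_quadratic) simp
  finally show ?thesis by (simp add: exp_minus field_simps)
qed

text \<open>The factor \<open>s < 1\<close> leaves a reserve of \<open>1 - s\<close> times the
  leading term, and the constants \<open>c\<close> and \<open>v\<close> contribute only terms of
  lower order.\<close>

lemma eventually_dimension_bound:
  fixes u A c s v :: real
  assumes "0 < u" "0 < A" "0 < s" "s < 1" "0 < v"
  shows "\<forall>\<^sub>F z in at_right 0. (s * (A * z powr - u) + v) * (c + ln (1 / z)) \<le> A * z powr - u * ln (1 / z)"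
  using assms by real_asymp

text \<open>The logarithm of \<open>r * (A * z powr - u)\<close> is \<open>u * ln (1 / z)\<close> up
  to a constant, so the leading term carries the factor \<open>u * r < 1\<close>. Moving
  \<open>u\<close> from the logarithm into the dimension reduces the claim to the previous bound
  with \<open>s = u * r\<close> and \<open>v = u\<close>.\<close>

lemma eventually_dimension_log_bound:
  fixes u A r :: real
  assumes "0 < u" "0 < A" "0 < r" "u * r < 1"
  shows "\<forall>\<^sub>F z in at_right 0. (r * (A * z powr - u) + 1) * ln (r * (A * z powr - u) + 1) \<le> A * z powr - u * ln (1 / z)"
proof -
  have "\<forall>\<^sub>F z in at_right 0. 1 \<le> r * (A * z powr - u)" using assms by real_asymp
  moreover have "\<forall>\<^sub>F z in at_right 0. (0::real) < z" by (rule eventually_at_right_less)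
  moreover have "\<forall>\<^sub>F z in at_right 0. ((u * r) * (A * z powr - u) + u) * (ln (2 * r * A) / u + ln (1 / z))
    \<le> A * z powr - u * ln (1 / z)"
    using assms by (intro eventually_dimension_bound) auto
  ultimately show ?thesis
  proof eventually_elim
    case (elim z)
    let ?Y = "r * (A * z powr - u)"
    have "?Y + 1 \<le> (2 * r * A) * z powr - u" using elim(1) by (simp add: mult_ac)
    then have "ln (?Y + 1) \<le> ln ((2 * r * A) * z powr - u)" using elim(1) by (intro ln_mono) auto
    also have "\<dots> = ln (2 * r * A) + u * ln (1 / z)"
      using assms elim by (subst ln_mult) (auto simp: ln_powr ln_div)
    finally have "(?Y + 1) * ln (?Y + 1) \<le> (?Y + 1) * (ln (2 * r * A) + u * ln (1 / z))"
      using elim by (intro mult_left_mono) auto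
    also have "\<dots> = ((u * r) * (A * z powr - u) + u) * (ln (2 * r * A) / u + ln (1 / z))"
      using assms(1) by (simp add: field_simps)
    finally show ?case using elim by linarith
  qed
qed

text \<open>With a negative rate the lower bound would grow beyond 1 as \<open>e\<close> tends to 0,
  which a probability cannot. The sign is needed to enlarge quantities in the exponent that are
  multiplied by \<open>c0 M\<close>.\<close>

lemma (in spline_prior) coeff_rate_nonneg:
  assumes j: "q \<le> j" and C: "0 < C" "0 < \<epsilon>\<^sub>0"
    and P: "\<And>e. 0 < e \<Longrightarrow> e < \<epsilon>\<^sub>0 \<Longrightarrow> C * exp (- c * real j * ln (1 / e)) \<le> \<P>(\<omega> in \<Omega>. Q e \<omega> \<bar> J \<omega> = j)"
  shows "0 \<le> c"
proof (rule ccontr)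
  assume "\<not> 0 \<le> c"
  then have cj: "0 < - c * real j" using j q_ge_1 by (simp add: mult_neg_pos)
  define b where "b = - c * real j"
  have "filterlim (\<lambda>e. C * exp (b * ln (1 / e))) at_top (at_right 0)"
    using C(1) cj unfolding b_def[symmetric] by real_asymp
  then have "\<forall>\<^sub>F e in at_right 0. 1 < C * exp (- c * real j * ln (1 / e))"
    unfolding b_def filterlim_at_top_dense by blast
  moreover have "\<forall>\<^sub>F e in at_right 0. 0 < e \<and> e < \<epsilon>\<^sub>0"
    using C(2) by (auto simp: eventually_at_right[OF C(2)])
  ultimately have "\<forall>\<^sub>F e in at_right 0. 1 < C * exp (- c * real j * ln (1 / e)) \<and> 0 < e \<and> e < \<epsilon>\<^sub>0"
    by (rule eventually_conj)
  from eventually_happens'[OF trivial_limit_at_right_real this]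
  obtain e where e: "1 < C * exp (- c * real j * ln (1 / e))" "0 < e" "e < \<epsilon>\<^sub>0" by blast
  have "\<P>(\<omega> in \<Omega>. Q e \<omega> \<bar> J \<omega> = j) \<le> 1"
    unfolding cond_prob_def by (intro divide_le_eq_1[THEN iffD2]) (auto intro!: finite_measure_mono simp: zero_less_measure_iff)
  then show False using e P[OF e(2,3)] by linarith
qed
theorem theorem1:
  fixes q :: nat
    and \<Omega> :: "'w measure"
    and J :: "'w \<Rightarrow> nat"
    and K \<Theta> :: "nat \<Rightarrow> 'w \<Rightarrow> nat \<Rightarrow> real"
    and c1 c2 c3 t1 t2 t3 \<tau> :: real
    and \<delta> :: "nat \<Rightarrow> real"
    and c0 :: "real \<Rightarrow> real"
    and \<alpha> M C_f0 c_M :: real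
    and F :: "(real \<Rightarrow> real) set"
    and f0 :: "real \<Rightarrow> real"
    and \<epsilon> \<epsilon>' Mn :: "nat \<Rightarrow> real"
    and Jn Jn' :: "nat \<Rightarrow> nat"
  assumes q: "q \<ge> 2"
    and prior: "hierarchical_spline_prior q \<Omega> J K \<Theta>"
    and parameters: "c1 > 0" "c2 > 0" "c3 > 0"
      "0 \<le> t1" "t1 \<le> 1" "0 \<le> t2" "t2 \<le> 1" "0 \<le> t3" "t3 \<le> 1" "\<tau> \<ge> 1"
    and \<delta>: "\<And>j. 0 < \<delta> j \<and> \<delta> j \<le> 1" "\<And>i j. i < j \<Longrightarrow> \<delta> j < \<delta> i"
    and P1: "\<exists>C>0. \<forall>\<^sub>F j in sequentially.
      \<P>(\<omega> in \<Omega>. J \<omega> > j) \<le> C * exp (- c1 * real j * ln (real j) powr t1)"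
    and P2: "\<exists>C>0. \<forall>\<^sub>F j in sequentially.
      \<P>(\<omega> in \<Omega>. J \<omega> = j) \<ge> C * exp (- c2 * real j * ln (real j) powr t2)"
    and P3: "\<forall>j\<ge>q. \<P>(\<omega> in \<Omega>. J \<omega> = j) > 0 \<longrightarrow>
      \<P>(\<omega> in \<Omega>. sparseness q j (K j \<omega>) < \<delta> j \<bar> J \<omega> = j) = 0"
    and P4: "\<exists>C>0. \<forall>j\<ge>q. \<P>(\<omega> in \<Omega>. J \<omega> = j) > 0 \<longrightarrow>
      \<P>(\<omega> in \<Omega>. mesh_size q j (K j \<omega>) \<le> \<tau> / real j \<bar> J \<omega> = j)
        \<ge> C * exp (- c3 * real j * ln (real j) powr t3)"
    and P5: "\<forall>B>0. \<exists>C>0. \<exists>\<epsilon>\<^sub>0>0. \<forall>j\<ge>q. \<P>(\<omega> in \<Omega>. J \<omega> = j) > 0 \<longrightarrow>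
      (\<forall>e. 0 < e \<and> e < \<epsilon>\<^sub>0 \<longrightarrow>
        (\<forall>\<theta>\<^sub>0\<in>{1..j} \<rightarrow>\<^sub>E UNIV. vec_norm_inf j \<theta>\<^sub>0 \<le> B \<longrightarrow>
          \<P>(\<omega> in \<Omega>. vec_norm_inf j (\<lambda>i. \<Theta> j \<omega> i - \<theta>\<^sub>0 i) \<le> e \<bar> J \<omega> = j)
            \<ge> C * exp (- c0 B * real j * ln (1 / e))))"
    and \<alpha>: "\<alpha> > 0"
    and F: "smoothness_class q \<alpha> F"
    and f0: "f0 \<in> F" "M > 0" "sup_norm f0 < M"
    and C_f0: "C_f0 > 0" "spline_approx_const q \<alpha> f0 C_f0"
    and \<epsilon>_pos: "\<And>n. \<epsilon> n > 0" "\<And>n. \<epsilon>' n > 0"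
    and \<epsilon>_ge: "\<forall>\<^sub>F n in sequentially. \<epsilon> n \<ge> \<epsilon>' n"
    and \<epsilon>_lim: "\<epsilon> \<longlonglongrightarrow> 0"
    and n\<epsilon>: "\<forall>\<^sub>F n in sequentially. real n * (\<epsilon>' n)\<^sup>2 > 1"
    and seqs: "\<And>n. Jn n > q" "\<And>n. Jn' n > q" "\<And>n. Mn n > 0"
    and c_M: "c_M \<ge> c1"
    and entropy: "\<exists>C>0. \<forall>\<^sub>F n in sequentially.
      real (Jn n) * ln (real (Jn n) * max (Mn n) 1 / (\<epsilon> n * \<delta> (Jn n))) \<le> C * (real n * (\<epsilon> n)\<^sup>2)"
    and Jn: "\<forall>\<^sub>F n in sequentially.
      real n * (\<epsilon>' n)\<^sup>2 / ln (real (Jn n)) powr t1 \<le> real (Jn n)"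
    and tail: "\<exists>C>0. \<forall>\<^sub>F n in sequentially. \<forall>j\<in>{q..Jn n}. \<P>(\<omega> in \<Omega>. J \<omega> = j) > 0 \<longrightarrow>
      \<P>(\<omega> in \<Omega>. \<not> (\<forall>i\<in>{1..j}. \<Theta> j \<omega> i \<in> {- Mn n..Mn n}) \<bar> J \<omega> = j)
        \<le> C * exp (- c_M * (real n * (\<epsilon>' n)\<^sup>2))"
    and Jn'_ge: "\<forall>\<^sub>F n in sequentially.
      (\<epsilon>' n / (\<tau> powr \<alpha> * C_f0)) powr (- 1 / \<alpha>) \<le> real (Jn' n)"
    and Jn'_log: "\<exists>C>0. \<forall>\<^sub>F n in sequentially.
      ln (real (Jn' n)) powr (max t2 t3) \<le> C * ln (1 / \<epsilon>' n)"
  shows "(\<exists>C>0. \<forall>\<^sub>F n in sequentially.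
      covering_number l2_functions l2_dist (\<epsilon> n) (spline_sieve q \<delta> (Jn n) (Mn n)) < \<infinity> \<and>
      ln (real (the_enat
        (covering_number l2_functions l2_dist (\<epsilon> n) (spline_sieve q \<delta> (Jn n) (Mn n)))))
      \<le> C * (real n * (\<epsilon> n)\<^sup>2)) \<and>
    (\<exists>C>0. \<forall>\<^sub>F n in sequentially.
      outer_measure_of \<Omega> {\<omega> \<in> space \<Omega>. random_spline q J K \<Theta> \<omega> \<notin> spline_sieve q \<delta> (Jn n) (Mn n)}
      \<le> ennreal (C * exp (- c1 * (real n * (\<epsilon>' n)\<^sup>2)))) \<and>
    (\<exists>C>0. \<forall>\<^sub>F n in sequentially.
      \<P>(\<omega> in \<Omega>. sup_norm (\<lambda>x. random_spline q J K \<Theta> \<omega> x - f0 x) \<le> 2 * \<epsilon>' n)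
      \<ge> C * exp (- (c0 M + c2 + c3) * real (Jn' n) * ln (1 / \<epsilon>' n)))"
proof (intro conjI)
  interpret spline_prior q \<Omega> J K \<Theta>
    using q prior by unfold_locales auto

  \<comment> \<open>Entropy of the sieve along the sequence\<close>
  have "antimono \<delta>"
    using \<delta>(2) by (intro antimonoI) (metis le_less order.strict_implies_order order_refl)
  have \<epsilon>_le_1: "\<forall>\<^sub>F n in sequentially. \<epsilon> n \<le> 1"
    using order_tendstoD(2)[OF \<epsilon>_lim zero_less_one] by eventually_elim simp
  obtain C\<^sub>S where C\<^sub>S: "0 < C\<^sub>S" "\<And>J m \<epsilon>. \<lbrakk>q < J; 0 < \<epsilon>; \<epsilon> \<le> 1\<rbrakk> \<Longrightarrow>
    covering_number l2_functions l2_dist \<epsilon> (spline_sieve q \<delta> J m) < \<infinity> \<and>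
    ln (real (the_enat (covering_number l2_functions l2_dist \<epsilon> (spline_sieve q \<delta> J m))))
      \<le> C\<^sub>S * (real J * ln (real J * max m 1 / (\<epsilon> * \<delta> J)))"
    using ln_covering_number_spline_sieve[OF q \<delta>(1) \<open>antimono \<delta>\<close>] by blast
  obtain C\<^sub>E where C\<^sub>E: "0 < C\<^sub>E" "\<forall>\<^sub>F n in sequentially.
      real (Jn n) * ln (real (Jn n) * max (Mn n) 1 / (\<epsilon> n * \<delta> (Jn n))) \<le> C\<^sub>E * (real n * (\<epsilon> n)\<^sup>2)"
    using entropy by blast
  show "\<exists>C>0. \<forall>\<^sub>F n in sequentially.
      covering_number l2_functions l2_dist (\<epsilon> n) (spline_sieve q \<delta> (Jn n) (Mn n)) < \<infinity> \<and>
      ln (real (the_enat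
        (covering_number l2_functions l2_dist (\<epsilon> n) (spline_sieve q \<delta> (Jn n) (Mn n)))))
      \<le> C * (real n * (\<epsilon> n)\<^sup>2)"
  proof (intro exI[of _ "C\<^sub>S * C\<^sub>E"] conjI)
    show "0 < C\<^sub>S * C\<^sub>E" using C\<^sub>S(1) C\<^sub>E(1) by simp
    show "\<forall>\<^sub>F n in sequentially.
      covering_number l2_functions l2_dist (\<epsilon> n) (spline_sieve q \<delta> (Jn n) (Mn n)) < \<infinity> \<and>
      ln (real (the_enat
        (covering_number l2_functions l2_dist (\<epsilon> n) (spline_sieve q \<delta> (Jn n) (Mn n)))))
      \<le> C\<^sub>S * C\<^sub>E * (real n * (\<epsilon> n)\<^sup>2)"
      using \<epsilon>_le_1 C\<^sub>E(2)
    proof eventually_elim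
      case (elim n)
      note cov = C\<^sub>S(2)[OF seqs(1)[of n] \<epsilon>_pos(1)[of n] elim(1), of "Mn n"]
      have "C\<^sub>S * (real (Jn n) * ln (real (Jn n) * max (Mn n) 1 / (\<epsilon> n * \<delta> (Jn n))))
        \<le> C\<^sub>S * (C\<^sub>E * (real n * (\<epsilon> n)\<^sup>2))"
        using elim(2) C\<^sub>S(1) by (intro mult_left_mono) auto
      then show ?case using cov by (auto simp: mult.assoc intro: order.trans)
    qed
  qed

  \<comment> \<open>Prior mass outside the sieve\<close>
  obtain C\<^sub>1 j\<^sub>1 where C\<^sub>1: "0 < C\<^sub>1"
    "\<And>j. j\<^sub>1 \<le> j \<Longrightarrow> \<P>(\<omega> in \<Omega>. J \<omega> > j) \<le> C\<^sub>1 * exp (- c1 * real j * ln (real j) powr t1)"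
    using P1 unfolding eventually_sequentially by blast
  obtain C\<^sub>T where C\<^sub>T: "0 < C\<^sub>T" "\<forall>\<^sub>F n in sequentially. \<forall>j\<in>{q..Jn n}. \<P>(\<omega> in \<Omega>. J \<omega> = j) > 0 \<longrightarrow>
      \<P>(\<omega> in \<Omega>. \<not> (\<forall>i\<in>{1..j}. \<Theta> j \<omega> i \<in> {- Mn n..Mn n}) \<bar> J \<omega> = j)
        \<le> C\<^sub>T * exp (- c_M * (real n * (\<epsilon>' n)\<^sup>2))"
    using tail by blast
  \<comment> \<open>The tail bound \<open>P1\<close> holds from \<open>j\<^sub>1\<close> on, but
    \<open>Jn n\<close> is not assumed to grow. While \<open>Jn n < j\<^sub>1\<close>, the quantity
    \<open>y\<close> stays bounded, and \<open>H\<close> lifts the claimed bound to at least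
    1.\<close>
  define H where "H = exp (c1 * (real j\<^sub>1 * ln (real j\<^sub>1 + 3) powr t1))"
  show "\<exists>C>0. \<forall>\<^sub>F n in sequentially.
      outer_measure_of \<Omega> {\<omega> \<in> space \<Omega>. random_spline q J K \<Theta> \<omega> \<notin> spline_sieve q \<delta> (Jn n) (Mn n)}
      \<le> ennreal (C * exp (- c1 * (real n * (\<epsilon>' n)\<^sup>2)))"
  proof (intro exI[of _ "C\<^sub>1 + H + C\<^sub>T"] conjI)
    show "0 < C\<^sub>1 + H + C\<^sub>T" using C\<^sub>1(1) C\<^sub>T(1) by (simp add: H_def add_pos_pos)
    show "\<forall>\<^sub>F n in sequentially.
      outer_measure_of \<Omega> {\<omega> \<in> space \<Omega>. random_spline q J K \<Theta> \<omega> \<notin> spline_sieve q \<delta> (Jn n) (Mn n)}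
      \<le> ennreal ((C\<^sub>1 + H + C\<^sub>T) * exp (- c1 * (real n * (\<epsilon>' n)\<^sup>2)))"
      using Jn C\<^sub>T(2)
    proof eventually_elim
      case (elim n)
      define y where "y = real n * (\<epsilon>' n)\<^sup>2"
      have y: "0 \<le> y" by (simp add: y_def)
      have J3: "3 \<le> real (Jn n)" using seqs(1)[of n] q by linarith
      have pos: "0 < ln (real (Jn n)) powr t1" using J3 by simp
      then have yJ: "y \<le> real (Jn n) * ln (real (Jn n)) powr t1"
        using elim(1) by (simp add: y_def divide_le_eq)
      have large: "\<P>(\<omega> in \<Omega>. J \<omega> > Jn n) \<le> (C\<^sub>1 + H) * exp (- c1 * y)"
      proof (cases "j\<^sub>1 \<le> Jn n")
        case True
        have "\<P>(\<omega> in \<Omega>. J \<omega> > Jn n) \<le> C\<^sub>1 * exp (- c1 * real (Jn n) * ln (real (Jn n)) powr t1)"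
          by (rule C\<^sub>1(2)[OF True])
        also have "\<dots> \<le> C\<^sub>1 * exp (- c1 * y)"
          using C\<^sub>1(1) parameters(1) yJ by (simp add: mult.assoc)
        also have "\<dots> \<le> (C\<^sub>1 + H) * exp (- c1 * y)" by (intro mult_right_mono) (auto simp: H_def)
        finally show ?thesis .
      next
        case False
        have "y \<le> real j\<^sub>1 * ln (real j\<^sub>1 + 3) powr t1"
          using False J3 parameters(4) by (intro order.trans[OF yJ] mult_mono powr_mono2 ln_mono) auto
        then have "exp (c1 * y) \<le> H" unfolding H_def using parameters(1) by simp
        then have "1 \<le> H * exp (- c1 * y)" by (simp add: exp_minus field_simps)
        also have "\<dots> \<le> (C\<^sub>1 + H) * exp (- c1 * y)" using C\<^sub>1(1) by (intro mult_right_mono) auto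
        finally show ?thesis using prob_le_1 order.trans by blast
      qed
      define B where "B = C\<^sub>T * exp (- c_M * y)"
      have "outer_measure_of \<Omega> {\<omega> \<in> space \<Omega>. random_spline q J K \<Theta> \<omega> \<notin> spline_sieve q \<delta> (Jn n) (Mn n)}
        \<le> ennreal (\<P>(\<omega> in \<Omega>. Jn n < J \<omega>) + B)"
        by (rule outer_measure_not_in_sieve) (use P3 elim(2) C\<^sub>T(1) in \<open>auto simp: B_def y_def\<close>)
      also have "\<dots> \<le> ennreal ((C\<^sub>1 + H + C\<^sub>T) * exp (- c1 * y))"
      proof (rule ennreal_leI)
        have "B \<le> C\<^sub>T * exp (- c1 * y)"
          unfolding B_def using C\<^sub>T(1) c_M y by (intro mult_left_mono) (auto intro: mult_right_mono)
        then show "\<P>(\<omega> in \<Omega>. Jn n < J \<omega>) + B \<le> (C\<^sub>1 + H + C\<^sub>T) * exp (- c1 * y)"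
          using large by (simp add: distrib_right)
      qed
      finally show ?case by (simp add: y_def)
    qed
  qed

  \<comment> \<open>Prior mass of sup-norm balls around \<open>f0\<close>\<close>
  obtain \<kappa> L where holder: "0 < \<kappa>" "0 < L"
    "\<And>x y. \<lbrakk>x \<in> {0..1}; y \<in> {0..1}\<rbrakk> \<Longrightarrow> \<bar>f0 x - f0 y\<bar> \<le> L * \<bar>x - y\<bar> powr \<kappa>"
    using F f0(1) unfolding smoothness_class_def by blast
  have f0_right: "(f0 \<longlongrightarrow> f0 x) (at_right x)" if "0 \<le> x" "x < 1" for x
  proof -
    have "((\<lambda>y. L * \<bar>y - x\<bar> powr \<kappa>) \<longlongrightarrow> 0) (at_right x)"
      using holder(1) by real_asymp
    moreover have "\<forall>\<^sub>F y in at_right x. norm (f0 y - f0 x) \<le> L * \<bar>y - x\<bar> powr \<kappa>"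
      unfolding eventually_at_right[OF that(2)] real_norm_def
    proof (intro exI[of _ 1] conjI allI impI)
      fix y assume "x < y" "y < 1"
      then show "\<bar>f0 y - f0 x\<bar> \<le> L * \<bar>y - x\<bar> powr \<kappa>" using that by (intro holder(3)) auto
    qed (rule that(2))
    ultimately have "((\<lambda>y. f0 y - f0 x) \<longlongrightarrow> 0) (at_right x)" by (rule Lim_null_comparison[rotated])
    then show ?thesis by (simp add: LIM_zero_iff)
  qed
  have f0_bounded: "bounded (f0 ` {0..1})"
  proof -
    have "\<bar>f0 x\<bar> \<le> \<bar>f0 0\<bar> + L" if x: "x \<in> {0..1}" for x
    proof -
      have "\<bar>x - 0\<bar> powr \<kappa> \<le> 1 powr \<kappa>" using x holder(1) by (intro powr_mono2) auto
      then have "L * \<bar>x - 0\<bar> powr \<kappa> \<le> L * 1" using holder(2) by (intro mult_left_mono) auto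
      then show ?thesis using holder(3)[OF x, of 0] by simp
    qed
    then show ?thesis unfolding bounded_iff by force
  qed
  obtain h0 where h0: "0 < h0" "\<And>j k h. \<lbrakk>q \<le> j; k \<in> inner_knots q j; mesh_size q j k \<le> h; h < h0\<rbrakk> \<Longrightarrow>
    \<exists>a\<in>{1..j} \<rightarrow>\<^sub>E UNIV. (\<forall>x\<in>{0..1}. \<bar>f0 x - spline q j a k x\<bar> \<le> C_f0 * h powr \<alpha>) \<and> vec_norm_inf j a \<le> M"
    using spline_approx_bounded_coeffs[OF q_ge_1 \<alpha> C_f0 holder f0_bounded f0(3)] by blast
  obtain C\<^sub>2 j\<^sub>2 where C\<^sub>2: "0 < C\<^sub>2"
    "\<And>j. j\<^sub>2 \<le> j \<Longrightarrow> C\<^sub>2 * exp (- c2 * real j * ln (real j) powr t2) \<le> \<P>(\<omega> in \<Omega>. J \<omega> = j)"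
    using P2 unfolding eventually_sequentially by blast
  have J_pos: "0 < \<P>(\<omega> in \<Omega>. J \<omega> = j)" if "j\<^sub>2 \<le> j" for j
  proof -
    have "0 < C\<^sub>2 * exp (- c2 * real j * ln (real j) powr t2)" using C\<^sub>2(1) by simp
    also have "\<dots> \<le> \<P>(\<omega> in \<Omega>. J \<omega> = j)" by (rule C\<^sub>2(2)[OF that])
    finally show ?thesis .
  qed
  obtain C\<^sub>4 where C\<^sub>4: "0 < C\<^sub>4" "\<And>j. q \<le> j \<Longrightarrow> \<P>(\<omega> in \<Omega>. J \<omega> = j) > 0 \<Longrightarrow>
      C\<^sub>4 * exp (- c3 * real j * ln (real j) powr t3)
        \<le> \<P>(\<omega> in \<Omega>. mesh_size q j (K j \<omega>) \<le> \<tau> / real j \<bar> J \<omega> = j)"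
    using P4 by blast
  obtain C\<^sub>5 \<epsilon>\<^sub>0 where C\<^sub>5: "0 < C\<^sub>5" "0 < \<epsilon>\<^sub>0"
    and P5': "\<forall>j\<ge>q. \<P>(\<omega> in \<Omega>. J \<omega> = j) > 0 \<longrightarrow> (\<forall>e. 0 < e \<and> e < \<epsilon>\<^sub>0 \<longrightarrow>
      (\<forall>\<theta>\<^sub>0\<in>{1..j} \<rightarrow>\<^sub>E UNIV. vec_norm_inf j \<theta>\<^sub>0 \<le> M \<longrightarrow>
        \<P>(\<omega> in \<Omega>. vec_norm_inf j (\<lambda>i. \<Theta> j \<omega> i - \<theta>\<^sub>0 i) \<le> e \<bar> J \<omega> = j)
          \<ge> C\<^sub>5 * exp (- c0 M * real j * ln (1 / e))))"
    using P5[THEN spec, THEN mp, OF f0(2)] by blast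
  have coeffs: "C\<^sub>5 * exp (- c0 M * real j * ln (1 / e))
      \<le> \<P>(\<omega> in \<Omega>. vec_norm_inf j (\<lambda>i. \<Theta> j \<omega> i - \<theta>\<^sub>0 i) \<le> e \<bar> J \<omega> = j)"
    if "q \<le> j" "j\<^sub>2 \<le> j" "0 < e" "e < \<epsilon>\<^sub>0" "\<theta>\<^sub>0 \<in> {1..j} \<rightarrow>\<^sub>E UNIV" "vec_norm_inf j \<theta>\<^sub>0 \<le> M" for j e \<theta>\<^sub>0
    using P5'[rule_format, OF that(1) J_pos[OF that(2)] conjI[OF that(3,4)] that(5,6)] .
  \<comment> \<open>Tested with the zero vector as centre, in a dimension of positive prior
    probability.\<close>
  have c0: "0 \<le> c0 M"
  proof (rule coeff_rate_nonneg[of "max q j\<^sub>2" C\<^sub>5 \<epsilon>\<^sub>0])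
    let ?j = "max q j\<^sub>2" and ?\<theta> = "restrict (\<lambda>_. 0) {1..max q j\<^sub>2} :: nat \<Rightarrow> real"
    fix e :: real assume e: "0 < e" "e < \<epsilon>\<^sub>0"
    have \<theta>: "?\<theta> \<in> {1..?j} \<rightarrow>\<^sub>E UNIV" "vec_norm_inf ?j ?\<theta> \<le> M"
      using q f0(2) by (simp, subst vec_norm_inf_le_iff) auto
    show "C\<^sub>5 * exp (- c0 M * real ?j * ln (1 / e))
      \<le> \<P>(\<omega> in \<Omega>. vec_norm_inf ?j (\<lambda>i. \<Theta> ?j \<omega> i - ?\<theta> i) \<le> e \<bar> J \<omega> = ?j)"
      by (rule coeffs[OF max.cobounded1 max.cobounded2 e \<theta>])
  qed (use C\<^sub>5 in auto)

  text \<open>A spline of dimension \<open>r Y\<close> with \<open>Y = (\<epsilon>' n / (\<tau>\<^sup>\<alpha> C_f0))\<^sup>-\<^sup>1\<^sup>/\<^sup>\<alpha>\<close> and \<open>r = e\<^sup>-\<^sup>u\<^sup>/\<^sup>2\<close>, \<open>u = 1 / \<alpha>\<close>,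
    already approximates \<open>f0\<close> up to \<open>b \<epsilon>' n\<close> with \<open>b = \<surd>e < 2\<close>; since \<open>r < 1\<close> and \<open>u r < 1\<close>, this
    smaller dimension absorbs the factor \<open>u\<close> of \<open>ln Y \<approx> u ln (1 / \<epsilon>' n)\<close> and all lower order terms.\<close>
  define u where "u = 1 / \<alpha>"
  define b where "b = exp (1 / 2 :: real)"
  define r where "r = exp (- u / 2)"
  define B where "B = \<tau> powr \<alpha> * C_f0"
  define A where "A = B powr u"
  have u: "0 < u" "u * \<alpha> = 1" using \<alpha> by (auto simp: u_def)
  have b: "0 < b" "b < 2"
  proof -
    have "b\<^sup>2 = exp 1" by (simp add: b_def flip: exp_double)
    also have "\<dots> < 2\<^sup>2" using exp_le by simp
    finally show "b < 2" by (rule power2_less_imp_less) simp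
  qed (simp add: b_def)
  have r: "0 < r" "r < 1" "u * r < 1" using u times_exp_half_less_one by (auto simp: r_def)
  have B: "0 < B" using parameters(10) C_f0(1) by (simp add: B_def)
  then have A: "0 < A" by (simp add: A_def)
  define Y where "Y n = A * \<epsilon>' n powr - u" for n
  have Y: "(\<epsilon>' n / B) powr (- u) = Y n" for n
    using B \<epsilon>_pos(2)[of n] by (simp add: Y_def A_def powr_divide powr_minus field_simps)
  define j where "j n = nat \<lceil>r * Y n\<rceil>" for n
  have "\<epsilon>' \<longlonglongrightarrow> 0"
    by (rule tendsto_sandwich[OF _ \<epsilon>_ge tendsto_const \<epsilon>_lim]) (intro always_eventually allI less_imp_le \<epsilon>_pos(2))
  then have \<epsilon>'_lim: "filterlim \<epsilon>' (at_right 0) sequentially"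
    using \<epsilon>_pos(2) by (intro tendsto_imp_filterlim_at_right) auto
  have Y_lim: "filterlim Y at_top sequentially"
  proof -
    have "filterlim (\<lambda>z. A * z powr - u) at_top (at_right 0)" using A u(1) by real_asymp
    then show ?thesis unfolding Y_def using \<epsilon>'_lim by (rule filterlim_compose)
  qed
  have Y_pos: "0 < Y n" for n using A \<epsilon>_pos(2)[of n] by (simp add: Y_def)
  have j_bounds: "r * Y n \<le> real (j n)" "real (j n) \<le> r * Y n + 1" for n
  proof -
    have "0 < r * Y n" using r(1) Y_pos by simp
    then have "real (j n) = real_of_int \<lceil>r * Y n\<rceil>" by (simp add: j_def)
    then show "r * Y n \<le> real (j n)" "real (j n) \<le> r * Y n + 1" by linarith+
  qed
  have j_lim: "filterlim (\<lambda>n. real (j n)) at_top sequentially"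
  proof (rule filterlim_at_top_mono)
    show "filterlim (\<lambda>n. r * Y n) at_top sequentially"
      by (rule filterlim_tendsto_pos_mult_at_top[OF tendsto_const r(1) Y_lim])
  qed (use j_bounds in auto)
  \<comment> \<open>The summand \<open>q\<close> makes the dimension admissible,
    \<open>j\<^sub>2\<close> brings it into the range of \<open>P2\<close>, and 3 makes its
    logarithm at least 1.\<close>
  have "\<forall>\<^sub>F n in sequentially. real (q + j\<^sub>2 + 3) \<le> real (j n)"
    using j_lim unfolding filterlim_at_top by blast
  moreover have "\<forall>\<^sub>F n in sequentially. \<tau> / h0 < real (j n)"
    using j_lim unfolding filterlim_at_top_dense by blast
  moreover have "\<forall>\<^sub>F n in sequentially. (2 - b) * \<epsilon>' n < \<epsilon>\<^sub>0"
  proof -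
    have "(\<lambda>n. (2 - b) * \<epsilon>' n) \<longlonglongrightarrow> (2 - b) * 0" by (intro tendsto_intros \<open>\<epsilon>' \<longlonglongrightarrow> 0\<close>)
    from order_tendstoD(2)[OF this, of \<epsilon>\<^sub>0] C\<^sub>5(2) show ?thesis by simp
  qed
  moreover have "\<forall>\<^sub>F n in sequentially. \<epsilon>' n < 1"
    using order_tendstoD(2)[OF \<open>\<epsilon>' \<longlonglongrightarrow> 0\<close> zero_less_one] .
  moreover have "\<forall>\<^sub>F n in sequentially.
    (r * Y n + 1) * (ln (1 / (2 - b)) + ln (1 / \<epsilon>' n)) \<le> Y n * ln (1 / \<epsilon>' n)"
    unfolding Y_def
    using filterlim_iff[THEN iffD1, OF \<epsilon>'_lim, rule_format,
        OF eventually_dimension_bound[OF u(1) A r(1,2) zero_less_one]] .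
  moreover have "\<forall>\<^sub>F n in sequentially. (r * Y n + 1) * ln (r * Y n + 1) \<le> Y n * ln (1 / \<epsilon>' n)"
    unfolding Y_def
    using filterlim_iff[THEN iffD1, OF \<epsilon>'_lim, rule_format,
        OF eventually_dimension_log_bound[OF u(1) A r(1,3)]] .
  moreover have "\<forall>\<^sub>F n in sequentially. Y n \<le> real (Jn' n)"
    using Jn'_ge by (simp add: Y[symmetric] B_def u_def)
  ultimately have "\<forall>\<^sub>F n in sequentially.
      \<P>(\<omega> in \<Omega>. sup_norm (\<lambda>x. random_spline q J K \<Theta> \<omega> x - f0 x) \<le> 2 * \<epsilon>' n)
      \<ge> C\<^sub>2 * C\<^sub>4 * C\<^sub>5 * exp (- (c0 M + c2 + c3) * real (Jn' n) * ln (1 / \<epsilon>' n))"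
  proof eventually_elim
    case (elim n)
    let ?z = "\<epsilon>' n" and ?j = "j n"
    have z: "0 < ?z" "0 < ln (1 / ?z)" using \<epsilon>_pos(2)[of n] elim(4) by (auto simp: ln_div)
    have j: "q \<le> ?j" "j\<^sub>2 \<le> ?j" "3 \<le> real ?j" using elim(1) by linarith+
    have ln1: "1 \<le> ln (real ?j)" using j(3) exp_le by (subst ln_ge_iff) linarith+
    define p where "p = C\<^sub>5 * exp (- c0 M * real ?j * ln (1 / ((2 - b) * ?z)))"
    have approx: "C_f0 * (\<tau> / real ?j) powr \<alpha> \<le> b * ?z"
    proof -
      have rY: "0 < r * Y n" using r(1) Y_pos by simp
      have "\<tau> / real ?j \<le> \<tau> / (r * Y n)"
        using j_bounds(1)[of n] rY parameters(10) by (intro divide_left_mono) auto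
      then have "C_f0 * (\<tau> / real ?j) powr \<alpha> \<le> C_f0 * (\<tau> / (r * Y n)) powr \<alpha>"
        using C_f0(1) parameters(10) \<alpha> by (intro mult_left_mono powr_mono2) auto
      also have "\<dots> = B / (r powr \<alpha> * Y n powr \<alpha>)"
        using parameters(10) rY r(1) Y_pos[of n] by (simp add: B_def powr_divide powr_mult)
      \<comment> \<open>Here \<open>u * \<alpha> = 1\<close> cancels the smoothness: reducing the
        dimension by the factor \<open>r\<close> enlarges the approximation error by exactly
        \<open>b\<close>, for every \<alpha>.\<close>
      also have "r powr \<alpha> = exp (- (1 / 2) * (u * \<alpha>))" by (simp add: r_def exp_powr_real)
      also have "\<dots> = 1 / b" unfolding u(2) by (simp add: b_def exp_minus inverse_eq_divide)
      also have "Y n powr \<alpha> = (?z / B) powr (- (u * \<alpha>))" unfolding Y[symmetric] powr_powr by simp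
      also have "\<dots> = B / ?z" unfolding u(2) using B z by (simp add: powr_neg_one)
      also have "B / (1 / b * (B / ?z)) = b * ?z" using B by simp
      finally show ?thesis .
    qed
    \<comment> \<open>The smaller dimension uses up \<open>b * \<epsilon>' n\<close>, more than half
      of the radius, for approximation. The remaining radius for the coefficients is smaller than
      \<open>\<epsilon>' n\<close>, which costs only the additive constant
      \<open>ln (1 / (2 - b))\<close>.\<close>
    have split: "b * ?z + (2 - b) * ?z = 2 * ?z" by (simp add: algebra_simps)
    have "\<P>(\<omega> in \<Omega>. J \<omega> = ?j) * (\<P>(\<omega> in \<Omega>. mesh_size q ?j (K ?j \<omega>) \<le> \<tau> / real ?j \<bar> J \<omega> = ?j) * p)
      \<le> \<P>(\<omega> in \<Omega>. sup_norm (\<lambda>x. random_spline q J K \<Theta> \<omega> x - f0 x) \<le> 2 * ?z)"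
      unfolding split[symmetric]
    proof (rule prob_random_spline_near[OF f0_bounded f0_right j(1) J_pos[OF j(2)]])
      show "0 \<le> p" using C\<^sub>5(1) by (simp add: p_def)
      fix k assume k: "k \<in> inner_knots q ?j" "mesh_size q ?j k \<le> \<tau> / real ?j"
      have "\<tau> / real ?j < h0" using elim(2) h0(1) j(3) by (simp add: field_simps)
      from h0(2)[OF j(1) k this] obtain a where a: "a \<in> {1..?j} \<rightarrow>\<^sub>E UNIV"
        "\<forall>x\<in>{0..1}. \<bar>f0 x - spline q ?j a k x\<bar> \<le> C_f0 * (\<tau> / real ?j) powr \<alpha>" "vec_norm_inf ?j a \<le> M"
        by blast
      have "p \<le> \<P>(\<omega> in \<Omega>. vec_norm_inf ?j (\<lambda>i. \<Theta> ?j \<omega> i - a i) \<le> (2 - b) * ?z \<bar> J \<omega> = ?j)"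
        unfolding p_def by (rule coeffs[OF j(1,2) _ elim(3) a(1,3)]) (use b z in simp)
      moreover have "\<forall>x\<in>{0..1}. \<bar>f0 x - spline q ?j a k x\<bar> \<le> b * ?z" using a(2) approx by force
      ultimately show "\<exists>a. (\<forall>x\<in>{0..1}. \<bar>f0 x - spline q ?j a k x\<bar> \<le> b * ?z) \<and>
        p \<le> \<P>(\<omega> in \<Omega>. vec_norm_inf ?j (\<lambda>i. \<Theta> ?j \<omega> i - a i) \<le> (2 - b) * ?z \<bar> J \<omega> = ?j)" by blast
    qed
    moreover have "C\<^sub>2 * exp (- c2 * (Y n * ln (1 / ?z))) * (C\<^sub>4 * exp (- c3 * (Y n * ln (1 / ?z))) *
        (C\<^sub>5 * exp (- c0 M * (Y n * ln (1 / ?z)))))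
      \<le> \<P>(\<omega> in \<Omega>. J \<omega> = ?j) * (\<P>(\<omega> in \<Omega>. mesh_size q ?j (K ?j \<omega>) \<le> \<tau> / real ?j \<bar> J \<omega> = ?j) * p)"
    proof (intro mult_mono)
      \<comment> \<open>The exponents \<open>t2\<close> and \<open>t3\<close> are at most 1 and the
        logarithm is at least 1, so it suffices to treat \<open>j * ln j\<close>, the worst
        case.\<close>
      have jln: "real ?j * ln (real ?j) powr t \<le> Y n * ln (1 / ?z)" if "t \<le> 1" for t
      proof -
        have "ln (real ?j) powr t \<le> ln (real ?j) powr 1" using ln1 that by (intro powr_mono) auto
        then have "real ?j * ln (real ?j) powr t \<le> real ?j * ln (real ?j)"
          using ln1 by (intro mult_left_mono) auto
        also have "\<dots> \<le> (r * Y n + 1) * ln (r * Y n + 1)"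
          using j_bounds(2)[of n] j(3) ln1 by (intro mult_mono ln_mono) auto
        also have "\<dots> \<le> Y n * ln (1 / ?z)" by (rule elim(6))
        finally show ?thesis .
      qed
      have "C\<^sub>2 * exp (- c2 * (Y n * ln (1 / ?z))) \<le> C\<^sub>2 * exp (- c2 * real ?j * ln (real ?j) powr t2)"
        using C\<^sub>2(1) parameters(2) jln[OF parameters(7)] by (simp add: mult.assoc)
      then show "C\<^sub>2 * exp (- c2 * (Y n * ln (1 / ?z))) \<le> \<P>(\<omega> in \<Omega>. J \<omega> = ?j)"
        using C\<^sub>2(2)[OF j(2)] by (rule order.trans)
      have "C\<^sub>4 * exp (- c3 * (Y n * ln (1 / ?z))) \<le> C\<^sub>4 * exp (- c3 * real ?j * ln (real ?j) powr t3)"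
        using C\<^sub>4(1) parameters(3) jln[OF parameters(9)] by (simp add: mult.assoc)
      then show "C\<^sub>4 * exp (- c3 * (Y n * ln (1 / ?z)))
        \<le> \<P>(\<omega> in \<Omega>. mesh_size q ?j (K ?j \<omega>) \<le> \<tau> / real ?j \<bar> J \<omega> = ?j)"
        using C\<^sub>4(2)[OF j(1) J_pos[OF j(2)]] by (rule order.trans)
      have "real ?j * ln (1 / ((2 - b) * ?z)) = real ?j * (ln (1 / (2 - b)) + ln (1 / ?z))"
        using b z by (simp add: ln_div ln_mult)
      also have "\<dots> \<le> (r * Y n + 1) * (ln (1 / (2 - b)) + ln (1 / ?z))"
      proof (rule mult_right_mono[OF j_bounds(2)])
        have "2 - b \<le> 1" by (simp add: b_def)
        then show "0 \<le> ln (1 / (2 - b)) + ln (1 / ?z)" using b z by (intro add_nonneg_nonneg ln_ge_zero) auto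
      qed
      also have "\<dots> \<le> Y n * ln (1 / ?z)" by (rule elim(5))
      finally have "c0 M * (real ?j * ln (1 / ((2 - b) * ?z))) \<le> c0 M * (Y n * ln (1 / ?z))"
        using c0 by (rule mult_left_mono)
      then show "C\<^sub>5 * exp (- c0 M * (Y n * ln (1 / ?z))) \<le> p"
        unfolding p_def using C\<^sub>5(1) by (simp add: mult.assoc)
    qed (use C\<^sub>2(1) C\<^sub>4(1) C\<^sub>5(1) in \<open>auto simp: cond_prob_def\<close>)
    moreover have "C\<^sub>2 * exp (- c2 * (Y n * ln (1 / ?z))) * (C\<^sub>4 * exp (- c3 * (Y n * ln (1 / ?z))) *
        (C\<^sub>5 * exp (- c0 M * (Y n * ln (1 / ?z))))) =
      C\<^sub>2 * C\<^sub>4 * C\<^sub>5 * exp (- (c0 M + c2 + c3) * (Y n * ln (1 / ?z)))"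
      by (simp add: algebra_simps flip: exp_add)
    moreover have "C\<^sub>2 * C\<^sub>4 * C\<^sub>5 * exp (- (c0 M + c2 + c3) * real (Jn' n) * ln (1 / ?z))
      \<le> C\<^sub>2 * C\<^sub>4 * C\<^sub>5 * exp (- (c0 M + c2 + c3) * (Y n * ln (1 / ?z)))"
    proof -
      \<comment> \<open>Passing from \<open>Y n\<close> to the larger \<open>Jn' n\<close> only
        weakens the bound, since the total rate and the logarithm are nonnegative.\<close>
      have "(c0 M + c2 + c3) * (Y n * ln (1 / ?z)) \<le> (c0 M + c2 + c3) * (real (Jn' n) * ln (1 / ?z))"
        using elim(7) z c0 parameters by (intro mult_left_mono mult_right_mono) auto
      then have "exp (- (c0 M + c2 + c3) * real (Jn' n) * ln (1 / ?z)) \<le> exp (- (c0 M + c2 + c3) * (Y n * ln (1 / ?z)))"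
        by (simp only: mult.assoc mult_minus_left exp_le_cancel_iff neg_le_iff_le)
      then show ?thesis using C\<^sub>2(1) C\<^sub>4(1) C\<^sub>5(1) by (intro mult_left_mono) auto
    qed
    ultimately show ?case by linarith
  qed
  then show "\<exists>C>0. \<forall>\<^sub>F n in sequentially.
      \<P>(\<omega> in \<Omega>. sup_norm (\<lambda>x. random_spline q J K \<Theta> \<omega> x - f0 x) \<le> 2 * \<epsilon>' n)
      \<ge> C * exp (- (c0 M + c2 + c3) * real (Jn' n) * ln (1 / \<epsilon>' n))"
    using C\<^sub>2(1) C\<^sub>4(1) C\<^sub>5(1) by (intro exI[of _ "C\<^sub>2 * C\<^sub>4 * C\<^sub>5"]) auto
qed

end
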